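(* Let $I \subseteq \mathbb{R}$ be an interval. Consider a generic curve of monic polynomials \[ P(t)(z) = z^n + \sum_{j=1}^n (-1)^j a_j(t) z^{n-j}, \qquad t \in I, \] with smooth coefficients $a_j : I \to \mathbb{C}$, $1 \le j \le n$. For any $t_0 \in I$ there exists a positive integer $N$ such that, for each choice of the sign $\pm$, the roots of $t \mapsto P(t_0 \pm (t-t_0)^N)$ can be parameterized smoothly near $t_0$. If the coefficients $a_j$ are real analytic, then the roots of $t \mapsto P(t_0 \pm (t-t_0)^N)$ can be parameterized real analytically near $t_0$.
   Context: Smooth means $C^\infty$. A (continuous, smooth, ...) parameterization of the roots of a curve of monic polynomials $Q(t)$ of degree $n$ on a set $J$ is an $n$-tuple of (continuous, smooth, ...) functions $\lambda_1,\ldots,\lambda_n : J \to \mathbb{C}$ such that $Q(t)(z)=\prod_{j=1}^n (z-\lambda_j(t))$ for all $t\in J$. If $t_0$ is an endpoint of $I$, "near $t_0$" refers to those $t$ near $t_0$ for which $t_0 \pm (t-t_0)^N \in I$. For a monic polynomial $P$ of degree $n$ with roots $\lambda_1,\ldots,\lambda_n\in\mathbb{C}$ (with multiplicity) and $1\le k\le n$ put \[ \tilde\Delta_k(P) := \sum_{i_1<\cdots<i_k}\ \prod_{1\le p<q\le k} (\lambda_{i_p}-\lambda_{i_q})^2 , \] which is a polynomial in the coefficients of $P$ (so $\tilde\Delta_1(P)=n$). For a continuous function $f$ defined near $t_0$, the multiplicity (order of flatness) $m_{t_0}(f)$ is the supremum of all integers $p$ such that $f(t)=(t-t_0)^p g(t)$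 near $t_0$ with $g$ continuous; $f$ is infinitely flat at $t_0$ if $m_{t_0}(f)=\infty$. The curve $P$ is called generic if for every $t_0\in I$: when $k$ is maximal such that the germ at $t_0$ of $t\mapsto \tilde\Delta_k(P(t))$ is not $0$, then $t\mapsto\tilde\Delta_k(P(t))$ is not infinitely flat at $t_0$. (Equivalently: for continuous parameterizations of the roots, if two of the roots meet of infinite order of flatness at $t_0$, i.e. $m_{t_0}(\lambda_i-\lambda_j)=\infty$, then their germs at $t_0$ are equal.) *)

theory Defs
  imports
    "HOL-Analysis.Analysis"
    "HOL-Combinatorics.List_Permutation"
    "HOL-Computational_Algebra.Fundamental_Theorem_Algebra"
    "HOL-Library.Extended_Nat"
begin

(* Both notions below are meant for intervals J. Derivatives at endpoints in J are one-sided. On a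
   one-point set every function is smooth and real analytic. *)

definition smooth_on :: "(real \<Rightarrow> complex) \<Rightarrow> real set \<Rightarrow> bool" where
  "smooth_on f J \<longleftrightarrow>
     (\<exists>F :: nat \<Rightarrow> real \<Rightarrow> complex. (\<forall>t\<in>J. F 0 t = f t) \<and>
        (\<forall>k. \<forall>t\<in>J. (F k has_vector_derivative F (Suc k) t) (at t within J)))"

definition real_analytic_on :: "(real \<Rightarrow> complex) \<Rightarrow> real set \<Rightarrow> bool" where
  "real_analytic_on f J \<longleftrightarrow>
     (\<forall>s\<in>J. \<exists>r>0. \<exists>c :: nat \<Rightarrow> complex.
        \<forall>t\<in>J \<inter> ball s r. (\<lambda>k. c k * of_real (t - s) ^ k) sums f t)"

definition root_parameterization ::
    "nat \<Rightarrow> (real \<Rightarrow> complex poly) \<Rightarrow> real set \<Rightarrow> (nat \<Rightarrow> real \<Rightarrow> complex) \<Rightarrow> bool" where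
  "root_parameterization n Q J lam \<longleftrightarrow>
     (\<forall>t\<in>J. \<forall>z. poly (Q t) z = (\<Prod>j=1..n. z - lam j t))"

definition smooth_roots_near ::
    "nat \<Rightarrow> (real \<Rightarrow> complex poly) \<Rightarrow> real set \<Rightarrow> real \<Rightarrow> bool" where
  "smooth_roots_near n Q J t0 \<longleftrightarrow>
     (\<exists>\<delta>>0. \<exists>lam. root_parameterization n Q (J \<inter> ball t0 \<delta>) lam \<and>
        (\<forall>j\<in>{1..n}. smooth_on (lam j) (J \<inter> ball t0 \<delta>)))"

definition real_analytic_roots_near ::
    "nat \<Rightarrow> (real \<Rightarrow> complex poly) \<Rightarrow> real set \<Rightarrow> real \<Rightarrow> bool" where
  "real_analytic_roots_near n Q J t0 \<longleftrightarrow>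
     (\<exists>\<delta>>0. \<exists>lam. root_parameterization n Q (J \<inter> ball t0 \<delta>) lam \<and>
        (\<forall>j\<in>{1..n}. real_analytic_on (lam j) (J \<inter> ball t0 \<delta>)))"

(* A k-subset S of the finite index set A stands for the indices i_1 < ... < i_k. *)

definition Delta_family :: "nat set \<Rightarrow> nat \<Rightarrow> (nat \<Rightarrow> complex) \<Rightarrow> complex" where
  "Delta_family A k l =
     (\<Sum>S | S \<subseteq> A \<and> card S = k.
        \<Prod>(p, q)\<in>{(p, q). p \<in> S \<and> q \<in> S \<and> p < q}. (l p - l q)\<^sup>2)"

(* The roots are enumerated in an arbitrary order; the value does not depend on it, see
   Delta_eq_Delta_family. *)

definition Delta :: "nat \<Rightarrow> complex poly \<Rightarrow> complex" where
  "Delta k P =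
     (let xs = (SOME xs. mset xs = proots P) in Delta_family {..<length xs} k (\<lambda>i. xs ! i))"

definition germ_zero_at :: "real set \<Rightarrow> real \<Rightarrow> (real \<Rightarrow> complex) \<Rightarrow> bool" where
  "germ_zero_at I t0 f \<longleftrightarrow> (\<exists>\<delta>>0. \<forall>t\<in>I \<inter> ball t0 \<delta>. f t = 0)"

(* Meant for f continuous on I near t0, so that p = 0 is always admissible and restricting p to
   natural numbers does not change the supremum. *)

definition flatness_order :: "real set \<Rightarrow> real \<Rightarrow> (real \<Rightarrow> complex) \<Rightarrow> enat" where
  "flatness_order I t0 f =
     Sup {enat p | p. \<exists>\<delta>>0. \<exists>g :: real \<Rightarrow> complex. continuous_on (I \<inter> ball t0 \<delta>) g \<and>
        (\<forall>t\<in>I \<inter> ball t0 \<delta>. f t = of_real (t - t0) ^ p * g t)}"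

definition generic_curve :: "nat \<Rightarrow> real set \<Rightarrow> (real \<Rightarrow> complex poly) \<Rightarrow> bool" where
  "generic_curve n I P \<longleftrightarrow>
     (\<forall>t0\<in>I. \<forall>k\<in>{1..n}.
        \<not> germ_zero_at I t0 (\<lambda>t. Delta k (P t)) \<and>
        (\<forall>j\<in>{k<..n}. germ_zero_at I t0 (\<lambda>t. Delta j (P t)))
        \<longrightarrow> flatness_order I t0 (\<lambda>t. Delta k (P t)) \<noteq> \<infinity>)"

lemma Delta_family_reindex:
  assumes g: "bij_betw g A B" and l: "\<And>i. i \<in> A \<Longrightarrow> l i = m (g i)"
  shows "Delta_family A k l = Delta_family B k m"
proof -
  have inj: "inj_on g A" and img: "g ` A = B" using g by (auto simp: bij_betw_def)
  let ?h = "the_inv_into A g"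
  have hg: "?h (g i) = i" if "i \<in> A" for i using that inj by (simp add: the_inv_into_f_f)
  have "Delta_family B k m =
     (\<Sum>S | S \<subseteq> A \<and> card S = k. \<Prod>(p, q)\<in>{(p, q). p \<in> g ` S \<and> q \<in> g ` S \<and> p < q}. (m p - m q)\<^sup>2)"
    unfolding Delta_family_def
  proof (rule sum.reindex_bij_witness[of _ "\<lambda>S. g ` S" "\<lambda>T. ?h ` T"], goal_cases)
    case (1 T)
    then show ?case
      unfolding img[symmetric] using hg
      by (auto simp: image_image subset_iff image_iff the_inv_into_f_f[OF inj])
         (metis f_the_inv_into_f imageI inj)+
  next
    case (2 T)
    then obtain S where "S \<subseteq> A" "T = g ` S"
      by (metis (no_types, lifting) img mem_Collect_eq subset_imageE)
    then show ?case using 2 inj hg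
      by (auto simp: card_image inj_on_subset subset_iff image_image)
  next
    case (3 S)
    then show ?case using hg by (auto simp: image_image subset_iff image_iff)
  next
    case (4 S)
    then show ?case using inj img by (auto simp: card_image inj_on_subset)
  next
    case (5 T)
    then obtain S where "S \<subseteq> A" "T = g ` S"
      by (metis (no_types, lifting) img mem_Collect_eq subset_imageE)
    then have "g ` ?h ` T = T" using hg by (auto simp: image_image subset_iff image_iff)
    then show ?case by simp
  qed
  also have "\<dots> = Delta_family A k l"
    unfolding Delta_family_def
  proof (rule sum.cong[OF refl], goal_cases)
    case (1 S)
    then have S: "S \<subseteq> A" by auto
    have lS: "l i = m (g i)" if "i \<in> S" for i using that S l by auto
    have hS: "?h (g i) = i" if "i \<in> S" for i using that S hg by auto
    have ne: "g i \<noteq> g j" if "i \<in> S" "j \<in> S" "i \<noteq> j" for i j using that S inj by (auto dest: inj_onD)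
    define sw where "sw = (\<lambda>(x, y). if (x::nat) < y then (x, y) else (y, x))"
    show ?case
    proof (rule prod.reindex_bij_witness
        [of _ "\<lambda>(i, j). sw (g i, g j)" "\<lambda>(p, q). sw (?h p, ?h q)"], goal_cases)
      case (1 x)
      then obtain i j where "i \<in> S" "j \<in> S" "g i < g j" "x = (g i, g j)" by auto
      then show ?case by (simp add: sw_def hS)
    next
      case (2 x)
      then obtain i j where x: "i \<in> S" "j \<in> S" "g i < g j" "x = (g i, g j)" by auto
      then have "i \<noteq> j" by auto
      with x show ?case by (simp add: sw_def hS)
    next
      case (3 x)
      then obtain i j where "i \<in> S" "j \<in> S" "i < j" "x = (i, j)" by auto
      then show ?case by (simp add: sw_def hS)
    next
      case (4 x)
      then obtain i j where x: "i \<in> S" "j \<in> S" "i < j" "x = (i, j)" by auto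
      then have "g i \<noteq> g j" using ne by blast
      with x show ?case by (auto simp add: sw_def)
    next
      case (5 x)
      then obtain i j where "i \<in> S" "j \<in> S" "g i < g j" "x = (g i, g j)" by auto
      then show ?case by (simp add: sw_def hS lS power2_commute)
    qed
  qed
  finally show ?thesis ..
qed

lemma Delta_eq_Delta_family:
  assumes "\<And>z. poly P z = (\<Prod>j=1..n. z - l j)"
  shows "Delta k P = Delta_family {1..n} k l"
proof -
  define ys where "ys = map l [1..<Suc n]"
  define xs where "xs = (SOME xs. mset xs = proots P)"
  have "poly P = poly (\<Prod>j=1..n. [:- l j, 1:])"
    by (rule ext) (simp add: assms poly_prod)
  then have "P = (\<Prod>j=1..n. [:- l j, 1:])" by (simp add: poly_eq_poly_eq_iff)
  then have "proots P = (\<Sum>j=1..n. {#l j#})" by (simp add: proots_prod)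
  also have "\<dots> = mset ys"
    unfolding ys_def by (induction n) auto
  finally have "mset ys = proots P" ..
  then have "mset xs = proots P" unfolding xs_def by (rule someI)
  with \<open>mset ys = proots P\<close> have eq: "mset xs = mset ys" by simp
  then obtain f where f: "f permutes {..<length ys}" "permute_list f ys = xs"
    using mset_eq_permutation by blast
  have len: "length xs = n" "length ys = n" using mset_eq_length[OF eq] by (auto simp: ys_def)
  have "bij_betw Suc {..<n} {1..n}"
    by (rule bij_betwI[of _ _ _ "\<lambda>i. i - 1"]) auto
  with f(1) len have b: "bij_betw (Suc \<circ> f) {..<n} {1..n}"
    by (metis bij_betw_trans permutes_imp_bij)
  have "xs ! i = l ((Suc \<circ> f) i)" if "i \<in> {..<n}" for i
  proof -
    have "f i < n" using that f(1) len permutes_in_image by fastforce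
    then show ?thesis
      using that f len by (auto simp: permute_list_nth ys_def simp del: upt_Suc)
  qed
  then have "Delta_family {..<n} k (\<lambda>i. xs ! i) = Delta_family {1..n} k l"
    by (rule Delta_family_reindex[OF b])
  then show ?thesis
    by (simp add: Delta_def xs_def[symmetric] len Let_def)
qed

end

theory Submission
  imports Defs "HOL-Complex_Analysis.Complex_Analysis"
begin

text \<open>Substituting \<open>t0 \<plusminus> t\<^sup>2\<close> for the parameter reduces everything to germs on both sides of \<open>0\<close>. Smooth
  and real analytic germs share the properties the argument needs: they form a ring, a germ vanishing
  at \<open>0\<close> is divisible by \<open>t\<close>, and contour integrals of rational expressions whose denominator does not
  vanish on the contour depend on the parameter in the same class.

  Puiseux's algorithm then works as for formal power series. After centring the roots, either all
  coefficients are flat, or a substitution \<open>t ^ N\<close> and a rescaling of the roots by a power of \<open>t\<close>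
  (Newton polygon) yield a curve with two distinct roots at \<open>0\<close>. Its power sums over the roots in a
  small disc are contour integrals, so the curve splits and induction on the degree applies. The result
  is a partition of the roots into \<open>m\<close> clusters: inside a cluster the roots agree with their mean up to
  flat functions, and different means differ by a nonflat function.

  For \<open>k > m\<close> two of any \<open>k\<close> roots lie in the same cluster, so \<open>\<Delta>\<^sub>k\<close> is flat along the curve and
  vanishes near \<open>t0\<close> by genericity. Hence there are at most \<open>m\<close> distinct roots, every cluster is a
  single multiple root, and that root is the mean of its cluster.\<close>

text \<open>No continuous enumeration of the roots is available in advance, so curves of roots are
  multiset-valued, and their regularity is that of their power sums. Power sums are additive under
  union of multisets: a factor is split off by subtraction.

  Clusters are needed because of flat functions. A coefficient all of whose derivatives vanish at 0
  bounds no slope of the Newton polygon, so the algorithm may stop before the roots are separated.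

  The square turns a one-sided germ at \<open>t0\<close> into a two-sided germ at 0, even if
  \<open>t0\<close> is an endpoint of \<open>I\<close>. The price is that clusters see only one side
  of \<open>t0\<close>, whereas genericity concerns \<open>\<Delta>\<^sub>k\<close> on all of
  \<open>I\<close>. The gap is closed by the smoothness of \<open>\<Delta>\<^sub>k\<close> along
  \<open>I\<close>: its Taylor coefficients at \<open>t0\<close> can be read off on either side, so
  flatness on one side is flatness on \<open>I\<close>.

  One exponent has to serve both signs and both claims. Each sign is therefore treated for all
  multiples of an exponent, and a common multiple is taken in the end.\<close>

subsection \<open>Smooth functions\<close>

text \<open>Choosing a derivative inside \<open>X\<close> for each member and iterating the choice
  produces the sequence \<open>F\<close> that the definition asks for. Smoothness thus reduces to
  finding a family closed under differentiation.\<close>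

lemma smooth_on_coinduct:
  assumes "f \<in> X"
    and step: "\<And>g. g \<in> X \<Longrightarrow> \<exists>g'\<in>X. \<forall>t\<in>J. (g has_vector_derivative g' t) (at t within J)"
  shows "smooth_on f J"
proof -
  obtain D where D: "\<And>g. g \<in> X \<Longrightarrow> D g \<in> X"
    "\<And>g t. g \<in> X \<Longrightarrow> t \<in> J \<Longrightarrow> (g has_vector_derivative D g t) (at t within J)"
    using step by metis
  have "(D ^^ k) f \<in> X" for k by (induction k) (auto simp: assms(1) D)
  then show ?thesis unfolding smooth_on_def
    by (intro exI[of _ "\<lambda>k. (D ^^ k) f"]) (auto simp: D)
qed

lemma smooth_on_cong:
  assumes "smooth_on f J" "\<And>t. t \<in> J \<Longrightarrow> f t = g t"
  shows "smooth_on g J"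
  using assms unfolding smooth_on_def by auto

lemma smooth_on_subset:
  assumes "smooth_on f J" "K \<subseteq> J"
  shows "smooth_on f K"
proof -
  obtain F where F: "\<And>t. t \<in> J \<Longrightarrow> F 0 t = f t"
    "\<And>k t. t \<in> J \<Longrightarrow> (F k has_vector_derivative F (Suc k) t) (at t within J)"
    using assms(1) unfolding smooth_on_def by auto
  show ?thesis unfolding smooth_on_def
    using F assms(2) by (intro exI[of _ F]) (auto intro!: has_vector_derivative_within_subset[OF F(2)])
qed

lemma smooth_on_derivative:
  assumes "smooth_on f J"
  obtains f' where "smooth_on f' J" "\<And>t. t \<in> J \<Longrightarrow> (f has_vector_derivative f' t) (at t within J)"
proof -
  obtain F where F: "\<And>t. t \<in> J \<Longrightarrow> F 0 t = f t"
    "\<And>k t. t \<in> J \<Longrightarrow> (F k has_vector_derivative F (Suc k) t) (at t within J)"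
    using assms unfolding smooth_on_def by auto
  have "smooth_on (F 1) J" unfolding smooth_on_def
    by (rule exI[of _ "\<lambda>k. F (Suc k)"]) (auto simp: F)
  moreover have "(f has_vector_derivative F 1 t) (at t within J)" if "t \<in> J" for t
    using has_vector_derivative_transform[OF that F(1)[symmetric] F(2)[OF that, of 0]] by simp
  ultimately show ?thesis using that by blast
qed

lemma smooth_on_continuous:
  assumes "smooth_on f J"
  shows "continuous_on J f"
proof -
  obtain f' where f': "\<And>t. t \<in> J \<Longrightarrow> (f has_vector_derivative f' t) (at t within J)"
    using smooth_on_derivative[OF assms] by blast
  then show ?thesis
    unfolding continuous_on_eq_continuous_within by (metis has_vector_derivative_continuous)
qed

lemma smooth_on_const: "smooth_on (\<lambda>_. c) J"
proof (rule smooth_on_coinduct[where X = "range (\<lambda>c _. c)"])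
  show "\<And>g. g \<in> range (\<lambda>c _. c) \<Longrightarrow>
         \<exists>g'\<in>range (\<lambda>c _. c). \<forall>t\<in>J. (g has_vector_derivative g' t) (at t within J)"
    by (auto intro!: exI[of _ 0] derivative_eq_intros)
qed auto

lemma smooth_on_of_real: "smooth_on of_real J"
proof (rule smooth_on_coinduct[where X = "insert of_real (Collect (\<lambda>f. smooth_on f J))"])
  fix g assume "g \<in> insert of_real (Collect (\<lambda>f. smooth_on f J))"
  then consider "g = of_real" | "smooth_on g J" by auto
  then show "\<exists>g'\<in>insert of_real (Collect (\<lambda>f. smooth_on f J)). \<forall>t\<in>J. (g has_vector_derivative g' t) (at t within J)"
  proof cases
    case 1
    have "(of_real has_vector_derivative (1 :: complex)) (at t within J)" for t
      by (auto intro!: derivative_eq_intros)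
    then show ?thesis using 1 by (intro bexI[of _ "\<lambda>_. 1"]) (auto simp: smooth_on_const)
  next
    case 2
    obtain g' where g': "smooth_on g' J"
      "\<And>t. t \<in> J \<Longrightarrow> (g has_vector_derivative g' t) (at t within J)"
      using smooth_on_derivative[OF 2] by blast
    show ?thesis by (rule bexI[of _ g']) (use g' in simp_all)
  qed
qed auto

lemma smooth_on_add:
  assumes "smooth_on f J" "smooth_on g J"
  shows "smooth_on (\<lambda>t. f t + g t) J"
proof (rule smooth_on_coinduct[where X = "{\<lambda>t. f t + g t | f g. smooth_on f J \<and> smooth_on g J}"])
  fix h assume "h \<in> {\<lambda>t. f t + g t | f g. smooth_on f J \<and> smooth_on g J}"
  then obtain f g where h: "h = (\<lambda>t. f t + g t)" "smooth_on f J" "smooth_on g J" by auto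
  obtain f' where f': "smooth_on f' J"
    "\<And>t. t \<in> J \<Longrightarrow> (f has_vector_derivative f' t) (at t within J)"
    using smooth_on_derivative[OF h(2)] by blast
  obtain g' where g': "smooth_on g' J"
    "\<And>t. t \<in> J \<Longrightarrow> (g has_vector_derivative g' t) (at t within J)"
    using smooth_on_derivative[OF h(3)] by blast
  show "\<exists>h'\<in>{\<lambda>t. f t + g t | f g. smooth_on f J \<and> smooth_on g J}.
      \<forall>t\<in>J. (h has_vector_derivative h' t) (at t within J)"
    unfolding h using f' g'
    by (intro bexI[of _ "\<lambda>t. f' t + g' t"] ballI has_vector_derivative_add) auto
qed (use assms in auto)

text \<open>The derivative of a product is a sum of two products, so the products alone are not
  closed under differentiation; their sums are.\<close>

inductive_set smooth_products :: "real set \<Rightarrow> (real \<Rightarrow> complex) set" for J where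
  product: "smooth_on f J \<Longrightarrow> smooth_on g J \<Longrightarrow> (\<lambda>t. f t * g t) \<in> smooth_products J"
| plus: "f \<in> smooth_products J \<Longrightarrow> g \<in> smooth_products J \<Longrightarrow> (\<lambda>t. f t + g t) \<in> smooth_products J"

lemma smooth_on_mult:
  assumes "smooth_on f J" "smooth_on g J"
  shows "smooth_on (\<lambda>t. f t * g t) J"
proof (rule smooth_on_coinduct[where X = "smooth_products J"])
  fix h assume "h \<in> smooth_products J"
  then show "\<exists>h'\<in>smooth_products J. \<forall>t\<in>J. (h has_vector_derivative h' t) (at t within J)"
  proof induction
    case (product f g)
    obtain f' where f': "smooth_on f' J"
      "\<And>t. t \<in> J \<Longrightarrow> (f has_vector_derivative f' t) (at t within J)"
      using smooth_on_derivative[OF product(1)] by blast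
    obtain g' where g': "smooth_on g' J"
      "\<And>t. t \<in> J \<Longrightarrow> (g has_vector_derivative g' t) (at t within J)"
      using smooth_on_derivative[OF product(2)] by blast
    show ?case
      by (rule bexI[of _ "\<lambda>t. f t * g' t + f' t * g t"])
        (intro ballI has_vector_derivative_mult f' g' smooth_products.plus
          smooth_products.product product | assumption)+
  next
    case (plus f g)
    then obtain f' g' where "f' \<in> smooth_products J" "g' \<in> smooth_products J"
      "\<And>t. t \<in> J \<Longrightarrow> (f has_vector_derivative f' t) (at t within J)"
      "\<And>t. t \<in> J \<Longrightarrow> (g has_vector_derivative g' t) (at t within J)" by blast
    then show ?case
      by (intro bexI[of _ "\<lambda>t. f' t + g' t"])
        (simp_all add: has_vector_derivative_add smooth_products.plus)
  qed
qed (use assms smooth_products.intros in auto)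

text \<open>Nonempty sums of smooth multiples of members of \<open>X\<close>: the module that
  \<open>X\<close> generates over the smooth functions.\<close>

inductive_set smooth_span :: "real set \<Rightarrow> (real \<Rightarrow> complex) set \<Rightarrow> (real \<Rightarrow> complex) set"
  for J X where
  single: "smooth_on f J \<Longrightarrow> g \<in> X \<Longrightarrow> (\<lambda>t. f t * g t) \<in> smooth_span J X"
| plus: "f \<in> smooth_span J X \<Longrightarrow> g \<in> smooth_span J X \<Longrightarrow> (\<lambda>t. f t + g t) \<in> smooth_span J X"

lemma smooth_span_mult:
  assumes "h \<in> smooth_span J X" "smooth_on f J"
  shows "(\<lambda>t. f t * h t) \<in> smooth_span J X"
  using assms
proof induction
  case (single g h)
  have "(\<lambda>t. (f t * g t) * h t) \<in> smooth_span J X"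
    using single by (intro smooth_span.single smooth_on_mult)
  then show ?case by (simp add: mult.assoc)
next
  case (plus g h)
  then show ?case using smooth_span.plus[of "\<lambda>t. f t * g t" J X "\<lambda>t. f t * h t"]
    by (simp add: distrib_left)
qed

lemma smooth_span_sum:
  assumes "finite A" "A \<noteq> {}" "\<And>i. i \<in> A \<Longrightarrow> h i \<in> smooth_span J X"
  shows "(\<lambda>t. \<Sum>i\<in>A. h i t) \<in> smooth_span J X"
  using assms by (induction rule: finite_ne_induct) (simp_all add: smooth_span.plus)

text \<open>Only derivatives of generators have to be examined: \<open>f * g\<close> has derivative
  \<open>f * g' + f' * g\<close>, and both terms stay in the module. It serves families that
  differentiation reproduces only up to smooth coefficients.\<close>

lemma smooth_on_module_coinduct:
  assumes "g \<in> X"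
    and step: "\<And>g. g \<in> X \<Longrightarrow>
      \<exists>g'\<in>smooth_span J X. \<forall>t\<in>J. (g has_vector_derivative g' t) (at t within J)"
  shows "smooth_on g J"
proof (rule smooth_on_coinduct[where X = "smooth_span J X"])
  have "(\<lambda>t. 1 * g t) \<in> smooth_span J X"
    using assms(1) by (intro smooth_span.single smooth_on_const)
  then show "g \<in> smooth_span J X" by simp
next
  fix h assume "h \<in> smooth_span J X"
  then show "\<exists>h'\<in>smooth_span J X. \<forall>t\<in>J. (h has_vector_derivative h' t) (at t within J)"
  proof induction
    case (single f g)
    obtain f' where f': "smooth_on f' J"
      "\<And>t. t \<in> J \<Longrightarrow> (f has_vector_derivative f' t) (at t within J)"
      using smooth_on_derivative[OF single(1)] by blast
    obtain g' where g': "g' \<in> smooth_span J X"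
      "\<And>t. t \<in> J \<Longrightarrow> (g has_vector_derivative g' t) (at t within J)"
      using step single by blast
    show ?case
      by (rule bexI[of _ "\<lambda>t. f t * g' t + f' t * g t"])
        (intro ballI has_vector_derivative_mult f' g' smooth_span.plus smooth_span_mult
          smooth_span.single[OF f'(1)] single | assumption)+
  next
    case (plus f g)
    then obtain f' g' where "f' \<in> smooth_span J X" "g' \<in> smooth_span J X"
      "\<And>t. t \<in> J \<Longrightarrow> (f has_vector_derivative f' t) (at t within J)"
      "\<And>t. t \<in> J \<Longrightarrow> (g has_vector_derivative g' t) (at t within J)" by blast
    then show ?case
      by (intro bexI[of _ "\<lambda>t. f' t + g' t"])
        (simp_all add: has_vector_derivative_add smooth_span.plus)
  qed
qed

lemma smooth_on_power: "smooth_on f J \<Longrightarrow> smooth_on (\<lambda>t. f t ^ k) J"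
  by (induction k) (auto intro: smooth_on_const smooth_on_mult)

text \<open>By the chain rule the derivative is the smooth coefficient \<open>\<phi>'\<close> times
  another composition with \<open>\<phi>\<close>, hence in the module generated by such
  compositions.\<close>

lemma smooth_on_compose:
  fixes \<phi> \<phi>' :: "real \<Rightarrow> real"
  assumes f: "smooth_on f J" and \<phi>: "\<phi> ` K \<subseteq> J"
    and deriv: "\<And>t. t \<in> K \<Longrightarrow> (\<phi> has_real_derivative \<phi>' t) (at t within K)"
    and \<phi>': "smooth_on (\<lambda>t. of_real (\<phi>' t)) K"
  shows "smooth_on (\<lambda>t. f (\<phi> t)) K"
proof (rule smooth_on_module_coinduct[where X = "{\<lambda>t. f (\<phi> t) | f. smooth_on f J}"])
  fix h assume "h \<in> {\<lambda>t. f (\<phi> t) | f. smooth_on f J}"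
  then obtain f where h: "h = (\<lambda>t. f (\<phi> t))" "smooth_on f J" by auto
  obtain f' where f': "smooth_on f' J"
    "\<And>t. t \<in> J \<Longrightarrow> (f has_vector_derivative f' t) (at t within J)"
    using smooth_on_derivative[OF h(2)] by blast
  have "(h has_vector_derivative of_real (\<phi>' t) * f' (\<phi> t)) (at t within K)" if "t \<in> K" for t
  proof -
    have "(f has_vector_derivative f' (\<phi> t)) (at (\<phi> t) within \<phi> ` K)"
      using f'(2) \<phi> that by (meson has_vector_derivative_within_subset image_subset_iff)
    moreover have "(\<phi> has_vector_derivative \<phi>' t) (at t within K)"
      using deriv[OF that] by (simp add: has_real_derivative_iff_has_vector_derivative)
    ultimately have "(f \<circ> \<phi> has_vector_derivative \<phi>' t *\<^sub>R f' (\<phi> t)) (at t within K)"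
      by (metis vector_diff_chain_within)
    then show ?thesis by (simp add: h o_def scaleR_conv_of_real)
  qed
  then show "\<exists>h'\<in>smooth_span K {\<lambda>t. f (\<phi> t) | f. smooth_on f J}.
      \<forall>t\<in>K. (h has_vector_derivative h' t) (at t within K)"
    using f' by (intro bexI[of _ "\<lambda>t. of_real (\<phi>' t) * f' (\<phi> t)"] ballI
      smooth_span.single \<phi>') auto
qed (use f in auto)

lemma smooth_on_affine_power:
  assumes f: "smooth_on f J" and \<phi>: "(\<lambda>t. c + s * (t - b) ^ N) ` K \<subseteq> J"
  shows "smooth_on (\<lambda>t. f (c + s * (t - b) ^ N)) K"
proof (rule smooth_on_compose[OF f \<phi>])
  show "((\<lambda>t. c + s * (t - b) ^ N) has_real_derivative s * (real N * (t - b) ^ (N - 1)))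
        (at t within K)" for t
    by (auto intro!: derivative_eq_intros)
  have "smooth_on (\<lambda>t. of_real s * (of_nat N * (of_real t + of_real (- b)) ^ (N - 1))) K"
    by (intro smooth_on_mult smooth_on_power smooth_on_add smooth_on_const smooth_on_of_real)
  then show "smooth_on (\<lambda>t. of_real (s * (real N * (t - b) ^ (N - 1)))) K" by simp
qed

text \<open>Hadamard's lemma: the quotient is \<open>\<lambda>t. \<integral> s\<in>{0..1}. f' (t0 + s (t - t0))\<close>.\<close>

lemma smooth_on_divide:
  fixes I :: "real set"
  assumes f: "smooth_on f I" and I: "is_interval I" and t0: "t0 \<in> I" and zero: "f t0 = 0"
  obtains g where "smooth_on g I" "\<And>t. t \<in> I \<Longrightarrow> f t = of_real (t - t0) * g t"
proof -
  obtain F where F: "\<And>t. t \<in> I \<Longrightarrow> F 0 t = f t"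
    "\<And>k t. t \<in> I \<Longrightarrow> (F k has_vector_derivative F (Suc k) t) (at t within I)"
    using f unfolding smooth_on_def by auto
  have conv: "convex I" using I is_interval_convex by blast
  define \<phi> where "\<phi> = (\<lambda>t s. t0 + s * (t - t0))"
  have \<phi>: "\<phi> t s \<in> I" if "t \<in> I" "s \<in> {0..1}" for t s
  proof -
    have "(1 - s) *\<^sub>R t0 + s *\<^sub>R t \<in> I" using that conv t0 by (intro convexD) auto
    then show ?thesis by (simp add: \<phi>_def algebra_simps)
  qed
  have contF: "continuous_on I (F k)" for k
    unfolding continuous_on_eq_continuous_within
    by (auto intro: has_vector_derivative_continuous[OF F(2)])
  have cont: "continuous_on (I \<times> {0..1}) (\<lambda>(t, s). of_real s ^ k * F j (\<phi> t s))" for j k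
    unfolding split_beta
    by (intro continuous_intros continuous_on_compose2[OF contF])
      (auto simp: \<phi> \<phi>_def intro!: continuous_intros \<phi>[unfolded \<phi>_def])
  \<comment> \<open>Each differentiation in \<open>t\<close> brings down a factor \<open>s\<close>,
    the slope of \<open>\<phi>\<close> in \<open>t\<close>. So \<open>G k\<close> is the
    \<open>k\<close>-th derivative of the quotient \<open>G 0\<close>.\<close>
  define G where "G = (\<lambda>k t. integral (cbox 0 1) (\<lambda>s. of_real s ^ k * F (Suc k) (\<phi> t s)))"
  have "(G k has_vector_derivative G (Suc k) t) (at t within I)" if "t \<in> I" for k t
    unfolding G_def
  proof (rule leibniz_rule_vector_derivative[OF _ _ _ that conv])
    fix t s :: real assume ts: "t \<in> I" "s \<in> cbox 0 1"
    have "(F (Suc k) has_vector_derivative F (Suc (Suc k)) (\<phi> t s)) (at (\<phi> t s) within (\<lambda>t. \<phi> t s) ` I)"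
      using F(2) \<phi> ts by (intro has_vector_derivative_within_subset[OF F(2)]) auto
    moreover have "((\<lambda>t. \<phi> t s) has_vector_derivative s) (at t within I)"
      unfolding \<phi>_def has_real_derivative_iff_has_vector_derivative[symmetric]
      by (auto intro!: derivative_eq_intros)
    ultimately have "((\<lambda>t. F (Suc k) (\<phi> t s)) has_vector_derivative s *\<^sub>R F (Suc (Suc k)) (\<phi> t s))
        (at t within I)"
      using vector_diff_chain_within[of "\<lambda>t. \<phi> t s" s t I "F (Suc k)"] by (simp add: o_def)
    then show "((\<lambda>t. of_real s ^ k * F (Suc k) (\<phi> t s)) has_vector_derivative
        of_real s ^ Suc k * F (Suc (Suc k)) (\<phi> t s)) (at t within I)"
      by (auto intro!: derivative_eq_intros simp: scaleR_conv_of_real)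
  next
    fix t assume "t \<in> I"
    then have "continuous_on {0..1} (\<lambda>s. (\<lambda>(t, s). of_real s ^ k * F (Suc k) (\<phi> t s)) (t, s))"
      by (intro continuous_on_compose2[OF cont]) (auto intro!: continuous_intros)
    then show "(\<lambda>s. of_real s ^ k * F (Suc k) (\<phi> t s)) integrable_on cbox 0 1"
      using integrable_continuous_real by simp
  next
    show "continuous_on (I \<times> cbox 0 1) (\<lambda>(t, s). of_real s ^ Suc k * F (Suc (Suc k)) (\<phi> t s))"
      using cont[of "Suc k"] by simp
  qed
  then have "smooth_on (G 0) I" unfolding smooth_on_def by (intro exI[of _ G]) simp
  moreover have "f t = of_real (t - t0) * G 0 t" if t: "t \<in> I" for t
  proof -
    have "((\<lambda>s. F 0 (\<phi> t s)) has_vector_derivative of_real (t - t0) * F 1 (\<phi> t s)) (at s within {0..1})"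
      if "s \<in> {0..1}" for s
    proof -
      have "(F 0 has_vector_derivative F 1 (\<phi> t s)) (at (\<phi> t s) within \<phi> t ` {0..1})"
        using has_vector_derivative_within_subset[OF F(2)[OF \<phi>[OF t that], of 0]] \<phi>[OF t]
        by (simp add: image_subset_iff)
      moreover have "(\<phi> t has_vector_derivative (t - t0)) (at s within {0..1})"
        unfolding \<phi>_def has_real_derivative_iff_has_vector_derivative[symmetric]
        by (auto intro!: derivative_eq_intros)
      ultimately show ?thesis
        using vector_diff_chain_within[of "\<phi> t" "t - t0" s "{0..1}" "F 0"]
        by (simp add: o_def scaleR_conv_of_real)
    qed
    then have "((\<lambda>s. of_real (t - t0) * F 1 (\<phi> t s)) has_integral F 0 (\<phi> t 1) - F 0 (\<phi> t 0)) {0..1}"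
      by (intro fundamental_theorem_of_calculus) auto
    from integral_unique[OF this] show ?thesis
      using F(1) t t0 zero by (simp add: G_def \<phi>_def)
  qed
  ultimately show ?thesis using that by blast
qed

subsection \<open>Symmetric functions of a multiset of roots\<close>

text \<open>The reversed polynomial: adding a root does not shift the indices of its coefficients,
  and its logarithmic derivative generates the power sums.\<close>

definition esym_fps :: "complex multiset \<Rightarrow> complex fps" where
  "esym_fps M = (\<Prod>x\<in>#M. 1 - fps_const x * fps_X)"

text \<open>The signed elementary symmetric functions: \<open>esym M j\<close> is the coefficient of
  \<open>z ^ (size M - j)\<close> in \<open>\<Prod>x\<in>#M. z - x\<close>.\<close>

definition esym :: "complex multiset \<Rightarrow> nat \<Rightarrow> complex" where
  "esym M j = fps_nth (esym_fps M) j"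

definition psum :: "nat \<Rightarrow> complex multiset \<Rightarrow> complex" where
  "psum e M = (\<Sum>x\<in>#M. x ^ e)"

lemma psum_simps [simp]:
  "psum e {#} = 0" "psum e (add_mset x M) = x ^ e + psum e M" "psum e (M + N) = psum e M + psum e N"
  by (simp_all add: psum_def)

lemma psum_0: "psum 0 M = of_nat (size M)"
  by (induction M) auto

lemma psum_1: "psum (Suc 0) M = \<Sum>\<^sub># M"
  by (simp add: psum_def)

lemma esym_empty: "esym {#} j = (if j = 0 then 1 else 0)"
  by (simp add: esym_def esym_fps_def)

lemma esym_add_mset: "esym (add_mset x M) j = esym M j - (if j = 0 then 0 else x * esym M (j - 1))"
  by (simp add: esym_def esym_fps_def left_diff_distrib mult.assoc)

lemma esym_0 [simp]: "esym M 0 = 1"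
  by (induction M) (auto simp: esym_empty esym_add_mset)

lemma esym_eq_0: "size M < j \<Longrightarrow> esym M j = 0"
  by (induction M arbitrary: j) (auto simp: esym_empty esym_add_mset)

lemma esym_scale: "esym (image_mset ((*) s) M) j = s ^ j * esym M j"
  by (induction M arbitrary: j)
     (auto simp: esym_empty esym_add_mset algebra_simps power_eq_if)

lemma prod_mset_eq_esym:
  "(\<Prod>x\<in>#M. z - x) = (\<Sum>j\<le>size M. esym M j * z ^ (size M - j))"
proof (induction M)
  case (add x M)
  let ?n = "size M"
  have "(\<Sum>j\<le>Suc ?n. esym (add_mset x M) j * z ^ (Suc ?n - j)) =
      (\<Sum>j\<le>Suc ?n. esym M j * z ^ (Suc ?n - j)) -
      (\<Sum>j\<le>Suc ?n. (if j = 0 then 0 else x * esym M (j - 1)) * z ^ (Suc ?n - j))"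
    by (simp add: esym_add_mset left_diff_distrib sum_subtractf)
  also have "(\<Sum>j\<le>Suc ?n. esym M j * z ^ (Suc ?n - j)) = (\<Sum>j\<le>?n. esym M j * z ^ (Suc ?n - j))"
    by (simp add: esym_eq_0)
  also have "\<dots> = z * (\<Sum>j\<le>?n. esym M j * z ^ (?n - j))"
    unfolding sum_distrib_left by (intro sum.cong) (auto simp: Suc_diff_le)
  also have "(\<Sum>j\<le>Suc ?n. (if j = 0 then 0 else x * esym M (j - 1)) * z ^ (Suc ?n - j)) =
      x * (\<Sum>j\<le>?n. esym M j * z ^ (?n - j))"
    unfolding sum.atMost_Suc_shift sum_distrib_left by (simp add: mult.assoc)
  finally show ?case using add by (simp add: left_diff_distrib)
qed (simp add: esym_empty)

lemma poly_prod_mset_linear: "poly (\<Prod>x\<in>#M. [:- x, 1:]) z = (\<Prod>x\<in>#M. z - x)"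
  for z :: complex
  by (induction M) (auto simp: algebra_simps)

lemma proots_prod_mset_linear: "proots (\<Prod>x\<in>#M. [:- x, 1:]) = M" for M :: "complex multiset"
proof (induction M)
  case (add x M)
  have "(\<Prod>x\<in>#M. [:- x, 1:]) \<noteq> (0 :: complex poly)" by (auto simp: prod_mset_zero_iff)
  then have "proots ([:- x, 1:] * (\<Prod>x\<in>#M. [:- x, 1:])) =
      proots [:- x, 1:] + proots (\<Prod>x\<in>#M. [:- x, 1:])"
    by (intro proots_mult) simp_all
  then show ?case using add by simp
qed simp

lemma mset_eq_if_poly_eq:
  assumes "\<And>z. (\<Prod>x\<in>#M. z - x) = (\<Prod>x\<in>#N. z - x :: complex)"
  shows "M = N"
proof -
  have "poly (\<Prod>x\<in>#M. [:- x, 1:]) = poly (\<Prod>x\<in>#N. [:- x, 1:])"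
    using assms by (simp add: poly_prod_mset_linear fun_eq_iff)
  then show ?thesis by (metis poly_eq_poly_eq_iff proots_prod_mset_linear)
qed

lemma mset_eq_if_esym_eq:
  assumes "size M = size N" "\<And>j. j \<le> size N \<Longrightarrow> esym M j = esym N j"
  shows "M = N"
  by (rule mset_eq_if_poly_eq) (use assms in \<open>simp add: prod_mset_eq_esym\<close>)

text \<open>The fundamental theorem of algebra gives the factorization, and the coefficients are
  compared in two expansions in powers of \<open>z\<close>. This is the passage from polynomials to
  multisets of roots.\<close>

lemma poly_factors_mset:
  assumes "c 0 = 1" "\<And>z. poly p z = (\<Sum>j\<le>n. c j * z ^ (n - j))"
  shows "size (proots p) = n" "\<And>z. poly p z = (\<Prod>x\<in>#proots p. z - x)"
    "\<And>j. j \<le> n \<Longrightarrow> esym (proots p) j = (c j :: complex)"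
proof -
  define q where "q = (\<Sum>j\<le>n. monom (c j) (n - j))"
  have "p = q"
    by (simp add: q_def poly_eq_poly_eq_iff[symmetric] fun_eq_iff assms poly_sum poly_monom)
  have coeff: "coeff q i = (\<Sum>j\<le>n. if n - j = i then c j else 0)" for i
    by (simp add: q_def coeff_sum if_distrib cong: if_cong)
  have q: "coeff q (n - j) = c j" if "j \<le> n" for j
  proof -
    have "coeff q (n - j) = (\<Sum>i\<le>n. if i = j then c i else 0)"
      unfolding coeff by (rule sum.cong) (use that in auto)
    then show ?thesis using that by (simp add: sum.delta)
  qed
  have "degree q = n"
  proof (rule antisym)
    show "degree q \<le> n" by (rule degree_le) (auto simp: coeff intro!: sum.neutral)
    show "n \<le> degree q" using q[of 0] assms(1) by (intro le_degree) auto
  qed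
  with \<open>p = q\<close> have deg: "degree p = n" "lead_coeff p = 1" using q[of 0] assms(1) by auto
  then show size: "size (proots p) = n" by (simp add: size_proots_complex)
  have "p \<noteq> 0" using deg(2) by auto
  then obtain A where A: "p = (\<Prod>x\<in>#A. [:- x, 1:])"
    using alg_closed_imp_factorization[of p] deg by auto
  then have "p = (\<Prod>x\<in>#proots p. [:- x, 1:])" using proots_prod_mset_linear by simp
  then show p: "poly p z = (\<Prod>x\<in>#proots p. z - x)" for z
    by (metis poly_prod_mset_linear)
  fix j assume j: "j \<le> n"
  define r where "r = (\<Sum>j\<le>n. monom (esym (proots p) j) (n - j))"
  have "p = r"
    by (simp add: r_def poly_eq_poly_eq_iff[symmetric] fun_eq_iff p prod_mset_eq_esym size
        poly_sum poly_monom)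
  have "coeff r (n - j) = (\<Sum>i\<le>n. if n - i = n - j then esym (proots p) i else 0)"
    by (simp add: r_def coeff_sum if_distrib cong: if_cong)
  also have "\<dots> = (\<Sum>i\<le>n. if i = j then esym (proots p) i else 0)"
    by (rule sum.cong) (use j in auto)
  also have "\<dots> = esym (proots p) j" using j by (simp add: sum.delta)
  finally show "esym (proots p) j = c j" using q[OF j] \<open>p = q\<close> \<open>p = r\<close> by simp
qed

text \<open>Roots prescribed through coefficients. The Newton polygon step needs this at
  \<open>t = 0\<close>, where roots cannot be divided by a power of \<open>t\<close>.\<close>

lemma exists_mset_esym:
  assumes "c 0 = 1"
  shows "\<exists>M. size M = n \<and> (\<forall>j\<le>n. esym M j = c j)"
proof -
  define p where "p = (\<Sum>j\<le>n. monom (c j) (n - j))"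
  have "poly p z = (\<Sum>j\<le>n. c j * z ^ (n - j))" for z by (simp add: p_def poly_sum poly_monom)
  from poly_factors_mset[of c, OF assms this] show ?thesis by blast
qed

text \<open>Logarithmic differentiation: for \<open>E = esym_fps M\<close>, the series
  \<open>- X E' / E\<close> is the sum of \<open>1 / (1 - x X) - 1\<close> over the roots
  \<open>x\<close>. The identity is multiplied by \<open>E\<close>; in the induction
  \<open>G\<close> is the geometric series inverse to the new factor \<open>L\<close>.\<close>

lemma newton_fps:
  "esym_fps M * (Abs_fps (\<lambda>e. psum e M) - of_nat (size M)) = - fps_X * fps_deriv (esym_fps M)"
proof (induction M)
  case (add x M)
  define L where "L = 1 - fps_const x * fps_X"
  define G where "G = Abs_fps (\<lambda>e. x ^ e)"
  have LG: "L * G = 1"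
    unfolding L_def G_def by (rule fps_ext) (auto simp: left_diff_distrib mult.assoc power_eq_if)
  define E where "E = esym_fps M"
  define S where "S = Abs_fps (\<lambda>e. psum e M)"
  have E: "esym_fps (add_mset x M) = L * E" by (simp add: esym_fps_def E_def L_def)
  have S: "Abs_fps (\<lambda>e. psum e (add_mset x M)) = G + S"
    by (rule fps_ext) (simp add: G_def S_def)
  have dL: "fps_deriv (L * E) = L * fps_deriv E - fps_const x * E"
    by (simp add: L_def algebra_simps fps_const_neg[symmetric] del: fps_const_neg)
  have "L * E * (G + S - of_nat (Suc (size M))) = L * (E * (S - of_nat (size M))) + E * (L * G) - L * E"
    by (simp add: algebra_simps)
  also have "\<dots> = L * (- fps_X * fps_deriv E) + E - L * E"
    using add LG by (simp add: E_def S_def)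
  also have "\<dots> = - fps_X * (L * fps_deriv E - fps_const x * E)" by (simp add: L_def algebra_simps)
  finally have "L * E * (G + S - of_nat (Suc (size M))) = - fps_X * (L * fps_deriv E - fps_const x * E)" .
  then show ?case unfolding E S dL size_add_mset .
qed (simp add: esym_fps_def fps_zero_def[symmetric])

text \<open>The sum includes \<open>i = 0\<close> and \<open>i = m\<close>, where
  \<open>psum 0\<close> is the number of roots. It can therefore be solved for \<open>psum m\<close>
  as well as for \<open>esym m\<close>.\<close>

lemma newton_identity:
  "(\<Sum>i\<le>m. esym M i * psum (m - i) M) = (of_nat (size M) - of_nat m) * esym M m"
proof -
  have "esym_fps M * Abs_fps (\<lambda>e. psum e M) =
      fps_const (of_nat (size M)) * esym_fps M - fps_X * fps_deriv (esym_fps M)"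
    using newton_fps[of M] by (simp add: fps_of_nat algebra_simps)
  then have "fps_nth (esym_fps M * Abs_fps (\<lambda>e. psum e M)) m =
      fps_nth (fps_const (of_nat (size M)) * esym_fps M - fps_X * fps_deriv (esym_fps M)) m"
    by simp
  then show ?thesis
    by (cases m) (simp_all add: fps_mult_nth[of "esym_fps M"] esym_def atLeast0AtMost left_diff_distrib)
qed

locale function_ring =
  fixes C :: "('a \<Rightarrow> complex) \<Rightarrow> bool"
  assumes const: "C (\<lambda>_. c)"
    and add: "C f \<Longrightarrow> C g \<Longrightarrow> C (\<lambda>t. f t + g t)"
    and mult: "C f \<Longrightarrow> C g \<Longrightarrow> C (\<lambda>t. f t * g t)"
begin

lemma sum: "(\<And>i. i \<in> A \<Longrightarrow> C (f i)) \<Longrightarrow> C (\<lambda>t. \<Sum>i\<in>A. f i t)"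
  by (induction A rule: infinite_finite_induct) (auto intro: const add)

lemma prod: "(\<And>i. i \<in> A \<Longrightarrow> C (f i)) \<Longrightarrow> C (\<lambda>t. \<Prod>i\<in>A. f i t)"
  by (induction A rule: infinite_finite_induct) (auto intro: const mult)

lemma power: "C f \<Longrightarrow> C (\<lambda>t. f t ^ k)"
  by (induction k) (auto intro: const mult)

lemma cmult: "C f \<Longrightarrow> C (\<lambda>t. c * f t)"
  using mult[OF const] .

lemma uminus: "C f \<Longrightarrow> C (\<lambda>t. - f t)"
  using cmult[of f "-1"] by simp

lemma diff: "C f \<Longrightarrow> C g \<Longrightarrow> C (\<lambda>t. f t - g t)"
  using add[OF _ uminus] by simp

text \<open>The size is fixed for all \<open>t\<close>, not only near a point, so partial curves
  have to be completed by dummy roots. By the next two lemmas the power sums may be exchanged for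
  the coefficients.\<close>

definition root_curve :: "nat \<Rightarrow> ('a \<Rightarrow> complex multiset) \<Rightarrow> bool" where
  "root_curve n M \<longleftrightarrow> (\<forall>t. size (M t) = n) \<and> (\<forall>e. C (\<lambda>t. psum e (M t)))"

text \<open>Newton's identity contains \<open>psum e\<close> with coefficient 1, in the term
  \<open>i = 0\<close>; this gives a recursion for the power sums, also beyond
  \<open>e = n\<close>.\<close>

lemma root_curveI_esym:
  assumes "\<And>t. size (M t) = n" "\<And>j. C (\<lambda>t. esym (M t) j)"
  shows "root_curve n M"
proof -
  have "C (\<lambda>t. psum e (M t))" for e
  proof (induction e rule: less_induct)
    case (less e)
    have "psum e (M t) = (of_nat n - of_nat e) * esym (M t) e -
        (\<Sum>i\<in>{1..e}. esym (M t) i * psum (e - i) (M t))" for t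
    proof -
      have "(\<Sum>i\<le>e. esym (M t) i * psum (e - i) (M t)) =
          psum e (M t) + (\<Sum>i\<in>{1..e}. esym (M t) i * psum (e - i) (M t))"
        by (simp add: sum.atLeast1_atMost_eq sum.atMost_shift)
      then show ?thesis using newton_identity[where m = e and M = "M t"] assms(1)
        by (simp add: algebra_simps)
    qed
    moreover have "C (\<lambda>t. (of_nat n - of_nat e) * esym (M t) e -
        (\<Sum>i\<in>{1..e}. esym (M t) i * psum (e - i) (M t)))"
      by (intro diff cmult assms sum mult less) auto
    ultimately show ?case by simp
  qed
  then show ?thesis using assms by (simp add: root_curve_def)
qed

text \<open>The converse recursion: the multiples of \<open>esym j\<close> on the two sides of
  Newton's identity differ by the factor \<open>j\<close>, which is invertible for
  \<open>j > 0\<close>.\<close>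

lemma root_curve_esym:
  assumes "root_curve n M"
  shows "C (\<lambda>t. esym (M t) j)"
proof (induction j rule: less_induct)
  case (less j)
  show ?case
  proof (cases "j = 0")
    case False
    have "esym (M t) j = - 1 / of_nat j * (\<Sum>i<j. esym (M t) i * psum (j - i) (M t))" for t
    proof -
      have "{..j} = insert j {..<j}" by auto
      then have "(\<Sum>i\<le>j. esym (M t) i * psum (j - i) (M t)) =
          of_nat (size (M t)) * esym (M t) j + (\<Sum>i<j. esym (M t) i * psum (j - i) (M t))"
        by (simp add: psum_0)
      then have "(\<Sum>i<j. esym (M t) i * psum (j - i) (M t)) = - of_nat j * esym (M t) j"
        using newton_identity[where m = j and M = "M t"] by (simp add: algebra_simps add_eq_0_iff)
      then show ?thesis using False by simp
    qed
    moreover have "C (\<lambda>t. - 1 / of_nat j * (\<Sum>i<j. esym (M t) i * psum (j - i) (M t)))"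
      using assms by (intro cmult sum mult less) (auto simp: root_curve_def)
    ultimately show ?thesis by simp
  qed (simp add: const)
qed

text \<open>The binomial theorem expresses the power sums of the shifted roots by the old ones and
  powers of \<open>\<mu>\<close>.\<close>

lemma root_curve_shift:
  assumes M: "root_curve n M" and \<mu>: "C \<mu>"
  shows "root_curve n (\<lambda>t. image_mset (\<lambda>x. x - \<mu> t) (M t))"
proof -
  have "psum e (image_mset (\<lambda>x. x - u) N) = (\<Sum>k\<le>e. of_nat (e choose k) * (- u) ^ (e - k) * psum k N)"
    for e u N
  proof -
    have "(x - u) ^ e = (\<Sum>k\<le>e. of_nat (e choose k) * (- u) ^ (e - k) * x ^ k)" for x
      using binomial_ring[of x "- u" e] by (simp add: mult_ac)
    then show ?thesis
      by (induction N) (simp_all add: sum.distrib distrib_left)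
  qed
  moreover have "C (\<lambda>t. \<Sum>k\<le>e. of_nat (e choose k) * (- \<mu> t) ^ (e - k) * psum k (M t))" for e
    using M \<mu> by (intro sum mult power uminus const) (auto simp: root_curve_def)
  ultimately show ?thesis using M by (simp add: root_curve_def)
qed

end

subsection \<open>The functions \<open>\<Delta>\<^sub>k\<close>\<close>

text \<open>\<open>Delta\<close> sees a polynomial only through its roots; this version applies to
  curves of multisets directly.\<close>

definition Delta_mset :: "nat \<Rightarrow> complex multiset \<Rightarrow> complex" where
  "Delta_mset k M =
     (let xs = (SOME xs. mset xs = M) in Delta_family {..<length xs} k (\<lambda>i. xs ! i))"

lemma Delta_eq_Delta_mset: "Delta k P = Delta_mset k (proots P)"
  by (simp add: Delta_def Delta_mset_def)

lemma Delta_mset_enumeration: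
  obtains xs where "mset xs = M" "\<And>k. Delta_mset k M = Delta_family {..<length xs} k (\<lambda>i. xs ! i)"
proof -
  have "\<exists>xs. mset xs = M" using ex_mset by blast
  then have "mset (SOME xs. mset xs = M) = M" by (rule someI_ex)
  then show ?thesis by (rule that) (simp add: Delta_mset_def Let_def)
qed

lemma Delta_family_full:
  assumes "finite S"
  shows "Delta_family S (card S) l =
    (\<Prod>(p, q)\<in>{(p, q). p \<in> S \<and> q \<in> S \<and> p < q}. (l p - l q)\<^sup>2)"
proof -
  have "{T. T \<subseteq> S \<and> card T = card S} = {S}"
    using assms card_subset_eq by blast
  then show ?thesis by (simp add: Delta_family_def)
qed

lemma Delta_family_decomp:
  assumes "finite A"
  shows "Delta_family A k l = (\<Sum>S | S \<subseteq> A \<and> card S = k. Delta_family S k l)"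
  unfolding Delta_family_def[of A]
proof (rule sum.cong[OF refl])
  fix S assume "S \<in> {S. S \<subseteq> A \<and> card S = k}"
  then have "finite S" "card S = k" using assms finite_subset by auto
  then show "(\<Prod>(p, q)\<in>{(p, q). p \<in> S \<and> q \<in> S \<and> p < q}. (l p - l q)\<^sup>2) = Delta_family S k l"
    using Delta_family_full[of S l] by simp
qed

lemma finite_pairs: "finite S \<Longrightarrow> finite {(p :: nat, q). p \<in> S \<and> q \<in> S \<and> p < q}"
  by (rule finite_subset[of _ "S \<times> S"]) auto

lemma Delta_family_full_eq_0:
  assumes "finite S" "\<not> inj_on l S"
  shows "Delta_family S (card S) l = 0"
proof -
  obtain p q where "p \<in> S" "q \<in> S" "p \<noteq> q" "l p = l q" using assms(2) by (auto simp: inj_on_def)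
  then have "\<exists>x\<in>{(p, q). p \<in> S \<and> q \<in> S \<and> p < q}. (case x of (p, q) \<Rightarrow> (l p - l q)\<^sup>2) = 0"
    by (intro bexI[of _ "if p < q then (p, q) else (q, p)"]) auto
  then show ?thesis
    unfolding Delta_family_full[OF assms(1)] using finite_pairs[OF assms(1)]
    by (subst prod_zero_iff) auto
qed

text \<open>A map that is not injective contributes 0, since a squared difference vanishes. Each
  \<open>k\<close>-subset is the image of \<open>k!\<close> injective maps, which all contribute its
  own summand by symmetry. The product over \<open>i < k\<close> is \<open>k!\<close>, written as
  injections are counted.\<close>

lemma sum_maps_eq_Delta_family:
  "(\<Sum>g\<in>{..<k} \<rightarrow>\<^sub>E {..<n}. Delta_family {..<k} k (\<lambda>p. l (g p))) =
   of_nat (\<Prod>i<k. k - i) * Delta_family {..<n} k l"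
proof -
  let ?G = "{g \<in> {..<k} \<rightarrow>\<^sub>E {..<n}. inj_on g {..<k}}"
  let ?T = "{S. S \<subseteq> {..<n} \<and> card S = k}"
  have fin: "finite ({..<k} \<rightarrow>\<^sub>E {..<n})" by (simp add: finite_PiE)
  have "(\<Sum>g\<in>{..<k} \<rightarrow>\<^sub>E {..<n}. Delta_family {..<k} k (\<lambda>p. l (g p))) =
      (\<Sum>g\<in>?G. Delta_family {..<k} k (\<lambda>p. l (g p)))"
  proof (rule sum.mono_neutral_right[OF fin])
    show "\<forall>g\<in>({..<k} \<rightarrow>\<^sub>E {..<n}) - ?G. Delta_family {..<k} k (\<lambda>p. l (g p)) = 0"
    proof
      fix g assume "g \<in> ({..<k} \<rightarrow>\<^sub>E {..<n}) - ?G"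
      then have "\<not> inj_on (\<lambda>p. l (g p)) {..<k}" by (auto simp: inj_on_def)
      from Delta_family_full_eq_0[OF _ this] show "Delta_family {..<k} k (\<lambda>p. l (g p)) = 0" by simp
    qed
  qed auto
  also have "\<dots> = (\<Sum>S\<in>?T. \<Sum>g | g \<in> ?G \<and> g ` {..<k} = S. Delta_family {..<k} k (\<lambda>p. l (g p)))"
  proof (rule sum.group[symmetric])
    show "finite ?G" using fin by (rule rev_finite_subset) auto
    show "(\<lambda>g. g ` {..<k}) ` ?G \<subseteq> ?T"
    proof (rule image_subsetI)
      fix g assume "g \<in> ?G"
      then have "g ` {..<k} \<subseteq> {..<n}" "inj_on g {..<k}" by auto
      then show "g ` {..<k} \<in> ?T" using card_image[of g "{..<k}"] by simp
    qed
  qed simp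
  also have "\<dots> = (\<Sum>S\<in>?T. of_nat (\<Prod>i<k. k - i) * Delta_family S k l)"
  proof (rule sum.cong[OF refl])
    fix S assume S: "S \<in> ?T"
    then have finS: "finite S" using finite_subset by auto
    have eq: "{g. g \<in> ?G \<and> g ` {..<k} = S} = {g \<in> {..<k} \<rightarrow>\<^sub>E S. inj_on g {..<k}}"
    proof (intro set_eqI iffI)
      fix g assume "g \<in> {g. g \<in> ?G \<and> g ` {..<k} = S}"
      then show "g \<in> {g \<in> {..<k} \<rightarrow>\<^sub>E S. inj_on g {..<k}}" by (auto simp: PiE_iff)
    next
      fix g assume g: "g \<in> {g \<in> {..<k} \<rightarrow>\<^sub>E S. inj_on g {..<k}}"
      then have "g ` {..<k} \<subseteq> S" "card (g ` {..<k}) = card S"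
        using S card_image[of g "{..<k}"] by auto
      then have "g ` {..<k} = S" using finS card_subset_eq by blast
      then show "g \<in> {g. g \<in> ?G \<and> g ` {..<k} = S}" using g S by (auto simp: PiE_iff)
    qed
    have "(\<Sum>g | g \<in> ?G \<and> g ` {..<k} = S. Delta_family {..<k} k (\<lambda>p. l (g p))) =
        (\<Sum>g | g \<in> ?G \<and> g ` {..<k} = S. Delta_family S k l)"
      by (rule sum.cong[OF refl], rule Delta_family_reindex) (auto simp: bij_betw_def)
    also have "\<dots> = of_nat (card {g \<in> {..<k} \<rightarrow>\<^sub>E S. inj_on g {..<k}}) * Delta_family S k l"
      unfolding eq by simp
    also have "card {g \<in> {..<k} \<rightarrow>\<^sub>E S. inj_on g {..<k}} = (\<Prod>i<k. k - i)"
      using S finS by (subst card_inj_on_subset_funcset) (auto simp: atLeast0LessThan)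
    finally show "(\<Sum>g | g \<in> ?G \<and> g ` {..<k} = S. Delta_family {..<k} k (\<lambda>p. l (g p))) =
        of_nat (\<Prod>i<k. k - i) * Delta_family S k l" .
  qed
  also have "\<dots> = of_nat (\<Prod>i<k. k - i) * Delta_family {..<n} k l"
    by (simp add: Delta_family_decomp[of "{..<n}"] sum_distrib_left)
  finally show ?thesis .
qed

text \<open>Polynomial functions of the first \<open>k\<close> coordinates, presented as sums of
  monomials: for a monomial, the sum over all tuples of roots factors.\<close>

inductive_set polyfuns :: "nat \<Rightarrow> ((nat \<Rightarrow> complex) \<Rightarrow> complex) set" for k where
  monomial: "(\<lambda>x. c * (\<Prod>p<k. x p ^ e p)) \<in> polyfuns k"
| plus: "f \<in> polyfuns k \<Longrightarrow> g \<in> polyfuns k \<Longrightarrow> (\<lambda>x. f x + g x) \<in> polyfuns k"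

lemma polyfuns_const: "(\<lambda>x. c) \<in> polyfuns k"
  using polyfuns.monomial[of c "\<lambda>_. 0" k] by simp

lemma polyfuns_cmult_coordinate:
  assumes "q < k"
  shows "(\<lambda>x. c * x q) \<in> polyfuns k"
proof -
  have "(\<Prod>p<k. x p ^ (if p = q then 1 else 0)) = x q" for x :: "nat \<Rightarrow> complex"
    using assms by (simp add: if_distrib prod.delta cong: if_cong)
  then show ?thesis using polyfuns.monomial[of c "\<lambda>p. if p = q then 1 else 0" k] by simp
qed

lemma polyfuns_mult:
  assumes "f \<in> polyfuns k" "g \<in> polyfuns k"
  shows "(\<lambda>x. f x * g x) \<in> polyfuns k"
  using assms
proof (induction f)
  case (monomial c e)
  from monomial(1) show ?case
  proof (induction g)
    case (monomial c' e')
    show ?case using polyfuns.monomial[of "c * c'" "\<lambda>p. e p + e' p" k]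
      by (simp add: power_add prod.distrib mult_ac)
  next
    case (plus g h)
    from polyfuns.plus[OF plus.IH] show ?case by (simp add: distrib_left)
  qed
next
  case (plus f h)
  from polyfuns.plus[OF plus.IH(1)[OF plus.prems] plus.IH(2)[OF plus.prems]]
  show ?case by (simp add: distrib_right)
qed

lemma polyfuns_prod:
  assumes "\<And>i. i \<in> A \<Longrightarrow> f i \<in> polyfuns k"
  shows "(\<lambda>x. \<Prod>i\<in>A. f i x) \<in> polyfuns k"
  using assms by (induction A rule: infinite_finite_induct) (auto intro: polyfuns_const polyfuns_mult)

lemma Delta_family_polyfun: "Delta_family {..<k} k \<in> polyfuns k"
proof -
  have "(\<lambda>x. \<Prod>i\<in>{(p, q). p \<in> {..<k} \<and> q \<in> {..<k} \<and> p < q}. (x (fst i) + (-1) * x (snd i))\<^sup>2) \<in> polyfuns k"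
  proof (rule polyfuns_prod)
    fix i assume "i \<in> {(p, q). p \<in> {..<k} \<and> q \<in> {..<k} \<and> p < q}"
    then have "(\<lambda>x. 1 * x (fst i) + (-1) * x (snd i)) \<in> polyfuns k"
      by (intro polyfuns.plus polyfuns_cmult_coordinate) auto
    then show "(\<lambda>x. (x (fst i) + (-1) * x (snd i))\<^sup>2) \<in> polyfuns k"
      unfolding power2_eq_square by (intro polyfuns_mult) simp_all
  qed
  moreover have "Delta_family {..<k} k =
      (\<lambda>x. \<Prod>i\<in>{(p, q). p \<in> {..<k} \<and> q \<in> {..<k} \<and> p < q}. (x (fst i) + (-1) * x (snd i))\<^sup>2)"
    using Delta_family_full[of "{..<k}"] by (simp add: fun_eq_iff case_prod_beta)
  ultimately show ?thesis by simp
qed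

context function_ring
begin

text \<open>Up to a constant factor, \<open>Delta_mset k\<close> is the sum of a polynomial over all \<open>k\<close>-tuples of roots,
  and this turns each monomial into a product of power sums.\<close>

lemma root_curve_Delta:
  assumes "root_curve n M"
  shows "C (\<lambda>t. Delta_mset k (M t))"
proof -
  obtain X where X: "\<And>t. mset (X t) = M t"
    "\<And>t k. Delta_mset k (M t) = Delta_family {..<length (X t)} k (\<lambda>i. X t ! i)"
  proof -
    have "\<exists>xs. mset xs = M t \<and> (\<forall>k. Delta_mset k (M t) = Delta_family {..<length xs} k (\<lambda>i. xs ! i))" for t
      using Delta_mset_enumeration[of "M t"] by blast
    then show ?thesis using that by metis
  qed
  have len: "length (X t) = n" for t
    using assms X(1) unfolding root_curve_def by (metis size_mset)
  have psum: "(\<Sum>i<n. (X t ! i) ^ e) = psum e (M t)" for t e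
    by (simp add: X(1)[symmetric] psum_def mset_map[symmetric] sum_mset_sum_list sum_list_sum_nth
        len atLeast0LessThan del: mset_map)
  have "C (\<lambda>t. \<Sum>g\<in>{..<k} \<rightarrow>\<^sub>E {..<n}. f (\<lambda>p. X t ! g p))" if "f \<in> polyfuns k" for f
    using that
  proof induction
    case (monomial c e)
    have "(\<Sum>g\<in>{..<k} \<rightarrow>\<^sub>E {..<n}. c * (\<Prod>p<k. (X t ! g p) ^ e p)) = c * (\<Prod>p<k. psum (e p) (M t))" for t
      using prod_sum_PiE[of "{..<k}" "\<lambda>_. {..<n}" "\<lambda>p i. (X t ! i) ^ e p"]
      by (simp add: psum sum_distrib_left)
    moreover have "C (\<lambda>t. c * (\<Prod>p<k. psum (e p) (M t)))"
      using assms by (intro cmult prod) (simp add: root_curve_def)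
    ultimately show ?case by simp
  next
    case (plus f g)
    from add[OF plus.IH] show ?case by (simp add: sum.distrib)
  qed
  from this[OF Delta_family_polyfun]
  have "C (\<lambda>t. of_nat (\<Prod>i<k. k - i) * Delta_family {..<n} k (\<lambda>i. X t ! i))"
    by (simp add: sum_maps_eq_Delta_family)
  then have "C (\<lambda>t. 1 / of_nat (\<Prod>i<k. k - i) * (of_nat (\<Prod>i<k. k - i) * Delta_family {..<n} k (\<lambda>i. X t ! i)))"
    by (rule cmult)
  moreover have "(\<Prod>i<k. k - i) \<noteq> 0" by (simp add: prod_zero_iff)
  then have "of_nat (\<Prod>i<k. k - i) \<noteq> (0 :: complex)" by (metis of_nat_eq_0_iff)
  ultimately show ?thesis by (simp add: X(2) len)
qed

end

text \<open>If \<open>k\<close> is the number of distinct roots, a set of \<open>k\<close> indices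
  with distinct roots meets every root exactly once. All such sets contribute the same nonzero value
  and the others contribute 0, so nothing cancels.\<close>

lemma Delta_mset_neq_0:
  assumes "card (set_mset M) = k"
  shows "Delta_mset k M \<noteq> 0"
proof -
  obtain xs where xs: "mset xs = M" "Delta_mset k M = Delta_family {..<length xs} k (\<lambda>i. xs ! i)"
    using Delta_mset_enumeration by blast
  define l where "l = (\<lambda>i. xs ! i)"
  define n where "n = length xs"
  define T where "T = {S. S \<subseteq> {..<n} \<and> card S = k \<and> inj_on l S}"
  have set: "set_mset M = l ` {..<n}"
    unfolding xs(1)[symmetric] by (auto simp: l_def n_def set_conv_nth)
  have finT: "finite T" unfolding T_def by (rule finite_subset[of _ "Pow {..<n}"]) auto
  obtain S0 where S0: "S0 \<subseteq> {..<n}" "inj_on l S0" "l ` S0 = set_mset M"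
    using subset_image_inj[of "set_mset M" l "{..<n}"] set by auto
  then have card0: "card S0 = k" using assms card_image by metis
  have finS0: "finite S0" using S0(1) finite_subset by blast
  have eq: "Delta_family S k l = Delta_family S0 k l" if "S \<in> T" for S
  \<comment> \<open>Indices in \<open>S\<close> and \<open>S0\<close> are matched when they carry
    the same root.\<close>
  proof (rule Delta_family_reindex[where g = "\<lambda>i. the_inv_into S0 l (l i)"])
    have S: "S \<subseteq> {..<n}" "card S = k" "inj_on l S" using that by (auto simp: T_def)
    then have "l ` S = l ` S0"
      using set S0 assms by (intro card_subset_eq) (auto simp: card_image)
    then have "bij_betw l S (l ` S0)" using S by (auto simp: bij_betw_def)
    moreover have "bij_betw (the_inv_into S0 l) (l ` S0) S0"
      using S0(2) by (intro bij_betw_the_inv_into) (simp add: bij_betw_def)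
    ultimately show "bij_betw (\<lambda>i. the_inv_into S0 l (l i)) S S0"
      using bij_betw_trans[of l S "l ` S0"] by (simp add: o_def)
    fix i assume "i \<in> S"
    then show "l i = l (the_inv_into S0 l (l i))"
      using \<open>l ` S = l ` S0\<close> S0(2) by (metis f_the_inv_into_f imageI)
  qed
  have "Delta_family {..<n} k l = (\<Sum>S | S \<subseteq> {..<n} \<and> card S = k. Delta_family S k l)"
    by (rule Delta_family_decomp) simp
  also have "\<dots> = (\<Sum>S\<in>T. Delta_family S k l)"
  proof (rule sum.mono_neutral_right)
    show "\<forall>S\<in>{S. S \<subseteq> {..<n} \<and> card S = k} - T. Delta_family S k l = 0"
    proof
      fix S assume "S \<in> {S. S \<subseteq> {..<n} \<and> card S = k} - T"
      then have "finite S" "card S = k" "\<not> inj_on l S" using finite_subset by (auto simp: T_def)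
      then show "Delta_family S k l = 0" using Delta_family_full_eq_0[of S l] by simp
    qed
  qed (auto simp: T_def)
  also have "\<dots> = of_nat (card T) * Delta_family S0 k l" by (simp add: eq)
  finally have "Delta_mset k M = of_nat (card T) * Delta_family S0 k l"
    by (simp add: xs(2) l_def n_def)
  moreover have "card T \<noteq> 0" using finT S0 card0 by (auto simp: T_def)
  moreover have "Delta_family S0 k l \<noteq> 0"
    using Delta_family_full[OF finS0, of l] S0(2) finite_pairs[OF finS0]
    by (auto simp: card0 inj_on_def)
  ultimately show ?thesis by simp
qed

text \<open>By the pigeonhole principle two of any \<open>k\<close> roots share a centre.\<close>

lemma norm_Delta_mset_le:
  assumes near: "\<And>x. x \<in># M \<Longrightarrow> \<exists>i<m. norm (x - \<mu> i) \<le> \<epsilon>"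
    and K: "\<And>x. x \<in># M \<Longrightarrow> norm x \<le> K" "K \<ge> 1" and k: "m < k"
  shows "norm (Delta_mset k M) \<le> 2 ^ size M * ((4 * K\<^sup>2) ^ (k * k) * (2 * \<epsilon>)\<^sup>2)"
proof -
  obtain xs where xs: "mset xs = M" "Delta_mset k M = Delta_family {..<length xs} k (\<lambda>i. xs ! i)"
    using Delta_mset_enumeration by blast
  define l where "l = (\<lambda>i. xs ! i)"
  define n where "n = length xs"
  have l: "l i \<in># M" if "i < n" for i using that by (auto simp: l_def n_def xs(1)[symmetric])
  have 1: "4 * K\<^sup>2 \<ge> 1" using one_le_power[OF K(2), of 2] by linarith
  \<comment> \<open>The pair that shares a centre contributes at most
    \<open>(2 * \<epsilon>)^2\<close>, every other pair at most \<open>4 * K^2\<close>. Since the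
    latter bound is at least 1, the number of remaining pairs may be enlarged to
    \<open>k * k\<close>.\<close>
  have bound: "norm (\<Prod>(p, q)\<in>{(p, q). p \<in> S \<and> q \<in> S \<and> p < q}. (l p - l q)\<^sup>2) \<le>
      (4 * K\<^sup>2) ^ (k * k) * (2 * \<epsilon>)\<^sup>2" if "S \<in> {S. S \<subseteq> {..<n} \<and> card S = k}" for S
  proof -
    have S: "S \<subseteq> {..<n}" "card S = k" and fin: "finite S" using that finite_subset by auto
    define E where "E = {(p, q). p \<in> S \<and> q \<in> S \<and> p < q}"
    have finE: "finite E" unfolding E_def using fin by (rule finite_pairs)
    have cardE: "card E \<le> k * k"
      using card_mono[of "S \<times> S" E] fin S(2) by (auto simp: E_def card_cartesian_product)
    have "\<forall>p\<in>S. \<exists>i<m. norm (l p - \<mu> i) \<le> \<epsilon>" using near l S(1) by blast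
    then obtain c where c: "\<And>p. p \<in> S \<Longrightarrow> c p < m \<and> norm (l p - \<mu> (c p)) \<le> \<epsilon>"
      by metis
    have "\<not> inj_on c S"
    proof
      assume "inj_on c S"
      then have "card S \<le> card {..<m}" using c by (intro card_inj_on_le) auto
      then show False using S(2) k by simp
    qed
    then obtain p' q' where "p' \<in> S" "q' \<in> S" "p' \<noteq> q'" "c p' = c q'" by (auto simp: inj_on_def)
    then obtain p q where pq: "p \<in> S" "q \<in> S" "p < q" "c p = c q" by (metis linorder_neqE_nat)
    have "norm (l p - l q) \<le> norm (l p - \<mu> (c p)) + norm (l q - \<mu> (c q))"
      using norm_triangle_ineq4[of "l p - \<mu> (c p)" "l q - \<mu> (c q)"] pq(4) by simp
    also have "\<dots> \<le> 2 * \<epsilon>" using c[OF pq(1)] c[OF pq(2)] by linarith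
    finally have close: "(norm (l p - l q))\<^sup>2 \<le> (2 * \<epsilon>)\<^sup>2" by (intro power_mono) auto
    have other: "(norm (l i - l j))\<^sup>2 \<le> 4 * K\<^sup>2" if "i \<in> S" "j \<in> S" for i j
    proof -
      have "norm (l i - l j) \<le> norm (l i) + norm (l j)" by (rule norm_triangle_ineq4)
      also have "\<dots> \<le> 2 * K" using K(1)[OF l] that S(1) by (smt (verit) lessThan_iff subsetD)
      finally have "(norm (l i - l j))\<^sup>2 \<le> (2 * K)\<^sup>2" by (intro power_mono) auto
      then show ?thesis by (simp add: power_mult_distrib)
    qed
    have "norm (\<Prod>(p, q)\<in>E. (l p - l q)\<^sup>2) = (\<Prod>(p, q)\<in>E. (norm (l p - l q))\<^sup>2)"
      by (simp add: prod_norm[symmetric] norm_power case_prod_beta)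
    also have "\<dots> = (norm (l p - l q))\<^sup>2 * (\<Prod>(p, q)\<in>E - {(p, q)}. (norm (l p - l q))\<^sup>2)"
      using finE pq by (subst prod.remove[of _ "(p, q)"]) (auto simp: E_def)
    also have "\<dots> \<le> (2 * \<epsilon>)\<^sup>2 * (\<Prod>(p, q)\<in>E - {(p, q)}. 4 * K\<^sup>2)"
      by (intro mult_mono close prod_mono) (auto simp: E_def other intro!: prod_nonneg)
    also have "\<dots> \<le> (2 * \<epsilon>)\<^sup>2 * (4 * K\<^sup>2) ^ (k * k)"
    proof (rule mult_left_mono)
      have "card (E - {(p, q)}) \<le> k * k" using card_Diff1_le cardE by (rule order.trans)
      then have "(4 * K\<^sup>2) ^ card (E - {(p, q)}) \<le> (4 * K\<^sup>2) ^ (k * k)"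
        using 1 by (rule power_increasing)
      then show "(\<Prod>(p, q)\<in>E - {(p, q)}. 4 * K\<^sup>2) \<le> (4 * K\<^sup>2) ^ (k * k)"
        by (simp add: case_prod_beta)
    qed simp
    finally show ?thesis by (simp add: E_def mult.commute)
  qed
  have "norm (Delta_family {..<n} k l) \<le> of_nat (card {S. S \<subseteq> {..<n} \<and> card S = k}) *
      ((4 * K\<^sup>2) ^ (k * k) * (2 * \<epsilon>)\<^sup>2)"
    unfolding Delta_family_def using bound by (rule sum_norm_bound)
  also have "\<dots> \<le> 2 ^ n * ((4 * K\<^sup>2) ^ (k * k) * (2 * \<epsilon>)\<^sup>2)"
  proof (rule mult_right_mono)
    have "card {S. S \<subseteq> {..<n} \<and> card S = k} \<le> card (Pow {..<n})" by (intro card_mono) auto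
    then have "real (card {S. S \<subseteq> {..<n} \<and> card S = k}) \<le> real (2 ^ n)"
      by (simp only: card_Pow of_nat_le_iff finite_lessThan card_lessThan)
    then show "real (card {S. S \<subseteq> {..<n} \<and> card S = k}) \<le> 2 ^ n" by simp
  qed simp
  finally show ?thesis unfolding xs(2) l_def n_def using xs(1) by (metis size_mset)
qed

subsection \<open>Smooth and real analytic germs\<close>

text \<open>Functions are total, and by \<open>cong\<close> only their values near 0 (including 0)
  count. In \<open>integral\<close>, \<open>z\<close> is the contour, \<open>h\<close> collects the
  factors free of \<open>t\<close>, and the denominator is assumed nonzero at \<open>t = 0\<close>
  only; compactness extends this to nearby \<open>t\<close>.\<close>

locale germ_class = function_ring C for C :: "(real \<Rightarrow> complex) \<Rightarrow> bool" +
  assumes of_real: "C of_real"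
    and cong: "C f \<Longrightarrow> (\<forall>\<^sub>F t in nhds 0. f t = g t) \<Longrightarrow> C g"
    and cont: "C f \<Longrightarrow> isCont f 0"
    and subst: "C f \<Longrightarrow> N > 0 \<Longrightarrow> C (\<lambda>t. f (t ^ N))"
    and divide: "C f \<Longrightarrow> f 0 = 0 \<Longrightarrow> \<exists>g. C g \<and> (\<forall>\<^sub>F t in nhds 0. f t = of_real t * g t)"
    and integral: "(\<And>j. j \<le> n \<Longrightarrow> C (a j)) \<Longrightarrow> continuous_on {0..1} h \<Longrightarrow> continuous_on {0..1} z \<Longrightarrow>
      (\<And>x :: real. x \<in> {0..1} \<Longrightarrow> (\<Sum>j\<le>n. a j 0 * z x ^ (n - j)) \<noteq> 0) \<Longrightarrow>
      C (\<lambda>t. integral {0..1} (\<lambda>x. h x / (\<Sum>j\<le>n. a j t * z x ^ (n - j))))"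

text \<open>On the compact interval the modulus at \<open>t0\<close> has a positive minimum, while
  its change with \<open>t\<close> is bounded uniformly in \<open>x\<close> by a quantity tending to
  0. The parameter space is left general because real and complex \<open>t\<close> both
  occur.\<close>

lemma poly_family_nonzero_near:
  fixes a :: "nat \<Rightarrow> 'a::t2_space \<Rightarrow> complex" and z :: "real \<Rightarrow> complex"
  assumes a: "\<And>j. j \<le> n \<Longrightarrow> isCont (a j) t0" and z: "continuous_on {0..1} z"
    and nz: "\<And>x. x \<in> {0..1} \<Longrightarrow> (\<Sum>j\<le>n. a j t0 * z x ^ (n - j)) \<noteq> 0"
  shows "\<forall>\<^sub>F t in nhds t0. \<forall>x\<in>{0..1}. (\<Sum>j\<le>n. a j t * z x ^ (n - j)) \<noteq> 0"
proof -
  define D where "D = (\<lambda>t x. \<Sum>j\<le>n. a j t * z x ^ (n - j))"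
  have "continuous_on {0..1} (\<lambda>x. norm (D t0 x))"
    unfolding D_def by (intro continuous_intros z)
  then obtain x0 where x0: "x0 \<in> {0..1}" "\<And>x. x \<in> {0..1} \<Longrightarrow> norm (D t0 x0) \<le> norm (D t0 x)"
    using continuous_attains_inf[of "{0..1::real}" "\<lambda>x. norm (D t0 x)"] by auto
  have pos: "norm (D t0 x0) > 0" using nz[OF x0(1)] by (simp add: D_def)
  have "bounded (z ` {0..1})" using z by (intro compact_imp_bounded compact_continuous_image) auto
  then obtain K where "\<forall>x\<in>{0..1}. norm (z x) \<le> K" by (auto simp: bounded_iff)
  then have K: "norm (z x) \<le> K" if "x \<in> {0..1}" for x using that by blast
  have "((\<lambda>t. \<Sum>j\<le>n. norm (a j t - a j t0) * K ^ (n - j)) \<longlongrightarrow>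
      (\<Sum>j\<le>n. norm (a j t0 - a j t0) * K ^ (n - j))) (nhds t0)"
    using a by (intro tendsto_intros) (simp add: tendsto_nhds_iff isCont_def)
  then have "\<forall>\<^sub>F t in nhds t0. (\<Sum>j\<le>n. norm (a j t - a j t0) * K ^ (n - j)) < norm (D t0 x0)"
    using pos by (intro order_tendstoD) auto
  then show ?thesis
  proof eventually_elim
    case (elim t)
    show ?case
    proof
      fix x :: real assume x: "x \<in> {0..1}"
      have "norm (D t x - D t0 x) \<le> (\<Sum>j\<le>n. norm ((a j t - a j t0) * z x ^ (n - j)))"
        unfolding D_def sum_subtractf[symmetric] left_diff_distrib[symmetric] by (rule norm_sum)
      also have "\<dots> \<le> (\<Sum>j\<le>n. norm (a j t - a j t0) * K ^ (n - j))"
        using K[OF x] by (intro sum_mono) (auto simp: norm_mult norm_power intro!: mult_left_mono power_mono)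
      also have "\<dots> < norm (D t0 x)" using elim x0(2)[OF x] by linarith
      finally have "D t x \<noteq> 0" by (auto simp: norm_minus_commute)
      then show "(\<Sum>j\<le>n. a j t * z x ^ (n - j)) \<noteq> 0" by (simp add: D_def)
    qed
  qed
qed

section \<open>Smooth germs at 0\<close>

lemma norm_power_less_min:
  fixes w :: "'a :: real_normed_div_algebra"
  assumes "norm w < min r 1" "N > 0"
  shows "norm (w ^ N) < r"
  using assms power_decreasing[of 1 N "norm w"] by (simp add: norm_power)

text \<open>Asking for all small radii lets finitely many germs share one radius by combining
  \<open>eventually\<close> statements; \<open>smooth_germI\<close> shows that a single radius is
  enough.\<close>

definition smooth_germ :: "(real \<Rightarrow> complex) \<Rightarrow> bool" where
  "smooth_germ f \<longleftrightarrow> (\<forall>\<^sub>F \<delta> in at_right 0. smooth_on f (ball 0 \<delta>))"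

lemma smooth_germI:
  assumes "\<delta> > 0" "smooth_on f (ball 0 \<delta>)"
  shows "smooth_germ f"
  unfolding smooth_germ_def eventually_at_right_field
  using assms by (intro exI[of _ \<delta>]) (auto intro: smooth_on_subset)

lemma smooth_germE:
  assumes "smooth_germ f"
  obtains \<delta> where "\<delta> > 0" "smooth_on f (ball 0 \<delta>)"
proof -
  obtain b where "b > 0" "\<And>y. 0 < y \<Longrightarrow> y < b \<Longrightarrow> smooth_on f (ball 0 y)"
    using assms unfolding smooth_germ_def eventually_at_right_field by blast
  then show ?thesis using that[of "b / 2"] by simp
qed

lemma eventually_at_right_balls:
  fixes P :: "'a::real_normed_vector \<Rightarrow> bool"
  assumes "\<forall>\<^sub>F t in nhds 0. P t"
  shows "\<forall>\<^sub>F \<delta> in at_right 0. \<forall>t\<in>ball 0 \<delta>. P t"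
proof -
  obtain d where "d > 0" "\<And>t. dist t 0 < d \<Longrightarrow> P t" using assms unfolding eventually_nhds_metric by blast
  then show ?thesis unfolding eventually_at_right_field
    by (intro exI[of _ d]) auto
qed

lemma reciprocal_power_derivative:
  fixes w c :: complex
  assumes "w \<noteq> 0"
  shows "((\<lambda>w. c / w ^ k) has_field_derivative - of_nat k * c / w ^ Suc k) (at w within S)"
proof (cases k)
  case (Suc m)
  have "((\<lambda>w. c / w ^ k) has_field_derivative - (c * (of_nat k * w ^ m)) / (w ^ k * w ^ k)) (at w within S)"
    using assms by (auto intro!: derivative_eq_intros) (simp add: Suc)
  also have "- (c * (of_nat k * w ^ m)) / (w ^ k * w ^ k) = - of_nat k * c / w ^ Suc k"
    using assms by (simp add: Suc divide_simps algebra_simps)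
  finally show ?thesis .
qed simp

text \<open>Consider all integrals of \<open>h / D ^ k\<close> with \<open>h\<close> continuous and
  any \<open>k\<close>. Differentiation produces \<open>D' / D ^ Suc k\<close>; the coefficients
  \<open>a' j\<close> of \<open>D'\<close> leave the integral as smooth factors and the powers of
  \<open>z\<close> are absorbed into \<open>h\<close>. So the family generates a module closed under
  differentiation.\<close>

lemma smooth_on_integral:
  fixes U :: "real set" and z :: "real \<Rightarrow> complex"
  assumes U: "convex U" and a: "\<And>j. j \<le> n \<Longrightarrow> smooth_on (a j) U"
    and h: "continuous_on {0..1} h" and z: "continuous_on {0..1} z"
    and nz: "\<And>t x. t \<in> U \<Longrightarrow> x \<in> {0..1} \<Longrightarrow> (\<Sum>j\<le>n. a j t * z x ^ (n - j)) \<noteq> 0"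
  shows "smooth_on (\<lambda>t. integral {0..1} (\<lambda>x. h x / (\<Sum>j\<le>n. a j t * z x ^ (n - j)))) U"
proof -
  define D where "D = (\<lambda>t x. \<Sum>j\<le>n. a j t * z x ^ (n - j))"
  have "\<forall>j\<in>{..n}. \<exists>f'. smooth_on f' U \<and> (\<forall>t\<in>U. (a j has_vector_derivative f' t) (at t within U))"
    using a smooth_on_derivative by (metis atMost_iff)
  then obtain a' where a': "\<And>j. j \<le> n \<Longrightarrow> smooth_on (a' j) U"
    "\<And>j t. j \<le> n \<Longrightarrow> t \<in> U \<Longrightarrow> (a j has_vector_derivative a' j t) (at t within U)"
    by (metis atMost_iff)
  define D' where "D' = (\<lambda>t x. \<Sum>j\<le>n. a' j t * z x ^ (n - j))"
  have contfst: "continuous_on (U \<times> {0..1}) (\<lambda>y. f (fst y))" if "smooth_on f U" for f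
    by (rule continuous_on_compose2[OF smooth_on_continuous[OF that]]) (auto intro: continuous_intros)
  have contsnd: "continuous_on (U \<times> {0..1}) (\<lambda>y. g (snd y))" if "continuous_on {0..1} g" for g :: "real \<Rightarrow> complex"
    by (rule continuous_on_compose2[OF that]) (auto intro: continuous_intros)
  have contD: "continuous_on (U \<times> {0..1}) (\<lambda>y. D (fst y) (snd y))"
    unfolding D_def by (intro continuous_intros contfst contsnd a z) auto
  have contD': "continuous_on (U \<times> {0..1}) (\<lambda>y. D' (fst y) (snd y))"
    unfolding D'_def by (intro continuous_intros contfst contsnd a' z) auto
  have nzD: "D t x \<noteq> 0" if "t \<in> U" "x \<in> {0..1}" for t x using nz that by (simp add: D_def)
  have contx: "continuous_on {0..1} (\<lambda>x. D t x)" for t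
    unfolding D_def by (intro continuous_intros z)
  define X where "X = {\<lambda>t. integral {0..1} (\<lambda>x. h x / D t x ^ k) | h k. continuous_on {0..1} h}"
  have "smooth_on g U" if "g \<in> X" for g
  proof (rule smooth_on_module_coinduct[OF that])
    fix g assume "g \<in> X"
    then obtain h k where g: "g = (\<lambda>t. integral {0..1} (\<lambda>x. h x / D t x ^ k))" and h: "continuous_on {0..1} h"
      unfolding X_def by blast
    define g' where "g' = (\<lambda>t. \<Sum>j\<le>n. (- of_nat k * a' j t) * integral {0..1} (\<lambda>x. (h x * z x ^ (n - j)) / D t x ^ Suc k))"
    have "g' \<in> smooth_span U X" unfolding g'_def
    proof (rule smooth_span_sum)
      fix j assume "j \<in> {..n}"
      then have "smooth_on (\<lambda>t. - of_nat k * a' j t) U" by (intro smooth_on_mult smooth_on_const a') auto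
      moreover have "(\<lambda>t. integral {0..1} (\<lambda>x. (h x * z x ^ (n - j)) / D t x ^ Suc k)) \<in> X"
        unfolding X_def using h z
        by (intro CollectI exI[of _ "\<lambda>x. h x * z x ^ (n - j)"] exI[of _ "Suc k"] conjI refl continuous_intros)
      ultimately show "(\<lambda>t. - of_nat k * a' j t * integral {0..1} (\<lambda>x. h x * z x ^ (n - j) / D t x ^ Suc k))
          \<in> smooth_span U X"
        by (rule smooth_span.single)
    qed auto
    moreover have "(g has_vector_derivative g' t) (at t within U)" if t: "t \<in> U" for t
    proof -
      have "((\<lambda>t. integral (cbox 0 1) (\<lambda>x. h x / D t x ^ k)) has_vector_derivative
          integral (cbox 0 1) (\<lambda>x. D' t x * (- of_nat k * h x / D t x ^ Suc k))) (at t within U)"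
      proof (rule leibniz_rule_vector_derivative[OF _ _ _ t U])
        fix t x :: real assume t: "t \<in> U" and x: "x \<in> cbox 0 1"
        have "((\<lambda>t. D t x) has_vector_derivative D' t x) (at t within U)"
          unfolding D_def D'_def
          by (intro has_vector_derivative_sum has_vector_derivative_mult_left a') (use t in auto)
        moreover have "((\<lambda>w. h x / w ^ k) has_field_derivative - of_nat k * h x / D t x ^ Suc k)
            (at (D t x) within (\<lambda>t. D t x) ` U)"
          using reciprocal_power_derivative nzD[OF t, of x] x by simp
        ultimately have "((\<lambda>w. h x / w ^ k) \<circ> (\<lambda>t. D t x) has_vector_derivative
            D' t x * (- of_nat k * h x / D t x ^ Suc k)) (at t within U)"
          by (rule field_vector_diff_chain_within)
        then show "((\<lambda>t. h x / D t x ^ k) has_vector_derivative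
            D' t x * (- of_nat k * h x / D t x ^ Suc k)) (at t within U)"
          by (simp add: o_def)
      next
        fix t assume "t \<in> U"
        then have "continuous_on {0..1} (\<lambda>x. h x / D t x ^ k)"
          by (intro continuous_intros h contx) (use nzD in auto)
        then show "(\<lambda>x. h x / D t x ^ k) integrable_on cbox 0 1"
          using integrable_continuous_real by simp
      next
        show "continuous_on (U \<times> cbox 0 1) (\<lambda>(t, x). D' t x * (- of_nat k * h x / D t x ^ Suc k))"
          unfolding case_prod_beta cbox_interval
          by (intro continuous_intros contD contD' contsnd[OF h]) (use nzD in auto)
      qed
      also have "integral (cbox 0 1) (\<lambda>x. D' t x * (- of_nat k * h x / D t x ^ Suc k)) =
          integral {0..1} (\<lambda>x. \<Sum>j\<le>n. (- of_nat k * a' j t) * ((h x * z x ^ (n - j)) / D t x ^ Suc k))"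
        unfolding cbox_interval
        by (intro integral_cong) (simp add: D'_def sum_distrib_left sum_distrib_right sum_divide_distrib sum_negf mult_ac)
      also have "\<dots> = g' t"
        unfolding g'_def
      proof (subst integral_sum)
        fix j assume "j \<in> {..n}"
        have "continuous_on {0..1} (\<lambda>x. (- of_nat k * a' j t) * ((h x * z x ^ (n - j)) / D t x ^ Suc k))"
          by (intro continuous_intros h z contx) (use nzD t in auto)
        then show "(\<lambda>x. (- of_nat k * a' j t) * ((h x * z x ^ (n - j)) / D t x ^ Suc k)) integrable_on {0..1}"
          by (rule integrable_continuous_real)
      qed (simp_all only: integral_mult_right finite_atMost)
      finally show ?thesis by (simp add: g)
    qed
    ultimately show "\<exists>g'\<in>smooth_span U X. \<forall>t\<in>U. (g has_vector_derivative g' t) (at t within U)"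
      by blast
  qed
  moreover have "(\<lambda>t. integral {0..1} (\<lambda>x. h x / D t x ^ 1)) \<in> X" unfolding X_def using h by blast
  ultimately show ?thesis by (simp add: D_def)
qed

lemma smooth_germ_isCont:
  assumes "smooth_germ f"
  shows "isCont f 0"
proof -
  obtain \<delta> where "\<delta> > 0" "smooth_on f (ball 0 \<delta>)" using smooth_germE[OF assms] by blast
  then show ?thesis using smooth_on_continuous continuous_on_eq_continuous_at[of "ball 0 \<delta>" f] by auto
qed

interpretation smooth_germ: germ_class smooth_germ
proof
  show "smooth_germ (\<lambda>_. c)" for c
    by (rule smooth_germI[of 1]) (auto intro: smooth_on_const)
  show "smooth_germ (\<lambda>t. f t + g t)" if "smooth_germ f" "smooth_germ g" for f g
    using that unfolding smooth_germ_def by eventually_elim (rule smooth_on_add)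
  show "smooth_germ (\<lambda>t. f t * g t)" if "smooth_germ f" "smooth_germ g" for f g
    using that unfolding smooth_germ_def by eventually_elim (rule smooth_on_mult)
  show "smooth_germ complex_of_real"
    by (rule smooth_germI[of 1]) (auto intro: smooth_on_of_real)
  show "smooth_germ g" if "smooth_germ f" "\<forall>\<^sub>F t in nhds 0. f t = g t" for f g
    using that(1) eventually_at_right_balls[OF that(2)] unfolding smooth_germ_def
    by eventually_elim (auto intro: smooth_on_cong)
  show "isCont f 0" if "smooth_germ f" for f using that by (rule smooth_germ_isCont)
  show "smooth_germ (\<lambda>t. f (t ^ N))" if f: "smooth_germ f" and N: "N > 0" for f N
  proof -
    obtain \<delta> where \<delta>: "\<delta> > 0" "smooth_on f (ball 0 \<delta>)" using smooth_germE[OF f(1)] by blast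
    have "smooth_on (\<lambda>t. f (0 + 1 * (t - 0) ^ N)) (ball 0 (min \<delta> 1))"
      using norm_power_less_min[OF _ N, where 'a = real]
      by (intro smooth_on_affine_power[OF \<delta>(2)]) auto
    then show ?thesis using \<delta>(1) by (intro smooth_germI[of "min \<delta> 1"]) auto
  qed
  show "\<exists>g. smooth_germ g \<and> (\<forall>\<^sub>F t in nhds 0. f t = complex_of_real t * g t)"
    if f: "smooth_germ f" "f 0 = 0" for f
  proof -
    obtain \<delta> where \<delta>: "\<delta> > 0" "smooth_on f (ball 0 \<delta>)" using smooth_germE[OF f(1)] by blast
    then obtain g where g: "smooth_on g (ball 0 \<delta>)" "\<And>t. t \<in> ball 0 \<delta> \<Longrightarrow> f t = of_real (t - 0) * g t"
      using smooth_on_divide[OF \<delta>(2), of 0] f(2) is_interval_ball_real by auto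
    have "\<forall>\<^sub>F t in nhds 0. t \<in> ball 0 \<delta>" using \<delta>(1) by (intro eventually_nhds_in_open) auto
    then have "\<forall>\<^sub>F t in nhds 0. f t = of_real t * g t"
      by eventually_elim (use g(2) in simp)
    then show ?thesis using smooth_germI[OF \<delta>(1) g(1)] by blast
  qed
  fix n :: nat and a :: "nat \<Rightarrow> real \<Rightarrow> complex" and h z :: "real \<Rightarrow> complex"
  assume a: "\<And>j. j \<le> n \<Longrightarrow> smooth_germ (a j)" and h: "continuous_on {0..1} h" and z: "continuous_on {0..1} z"
    and nz: "\<And>x. x \<in> {0..1} \<Longrightarrow> (\<Sum>j\<le>n. a j 0 * z x ^ (n - j)) \<noteq> 0"
  have "\<forall>\<^sub>F \<delta> in at_right 0. \<forall>j\<in>{..n}. smooth_on (a j) (ball 0 \<delta>)"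
    using a by (intro eventually_ball_finite) (auto simp: smooth_germ_def)
  moreover have "\<forall>\<^sub>F \<delta> in at_right 0. \<forall>t\<in>ball 0 \<delta>. \<forall>x\<in>{0..1}. (\<Sum>j\<le>n. a j t * z x ^ (n - j)) \<noteq> 0"
    by (intro eventually_at_right_balls poly_family_nonzero_near smooth_germ_isCont a z nz)
  ultimately show "smooth_germ (\<lambda>t. integral {0..1} (\<lambda>x. h x / (\<Sum>j\<le>n. a j t * z x ^ (n - j))))"
    unfolding smooth_germ_def
    by eventually_elim (intro smooth_on_integral, auto intro: h z)
qed


section \<open>Real analytic germs as restrictions of holomorphic functions\<close>

definition analytic_germ :: "(real \<Rightarrow> complex) \<Rightarrow> bool" where
  "analytic_germ f \<longleftrightarrow>
     (\<forall>\<^sub>F r in at_right 0. \<exists>g. g holomorphic_on ball 0 r \<and> (\<forall>t\<in>ball 0 r. f t = g (of_real t)))"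

lemma analytic_germI:
  assumes "r > 0" "g holomorphic_on ball 0 r" "\<And>t. t \<in> ball 0 r \<Longrightarrow> f t = g (of_real t)"
  shows "analytic_germ f"
  unfolding analytic_germ_def eventually_at_right_field
  using assms by (intro exI[of _ r]) (auto intro!: exI[of _ g] elim: holomorphic_on_subset)

lemma analytic_germE:
  assumes "analytic_germ f"
  obtains r g where "r > 0" "g holomorphic_on ball 0 r" "\<And>t. t \<in> ball 0 r \<Longrightarrow> f t = g (of_real t)"
proof -
  obtain b where "b > 0" and b: "\<And>y. 0 < y \<Longrightarrow> y < b \<Longrightarrow>
      \<exists>g. g holomorphic_on ball 0 y \<and> (\<forall>t\<in>ball 0 y. f t = g (of_real t))"
    using assms unfolding analytic_germ_def eventually_at_right_field by blast
  then have "0 < b / 2" "b / 2 < b" by simp_all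
  from b[OF this] obtain g where "g holomorphic_on ball 0 (b / 2)"
    "\<forall>t\<in>ball 0 (b / 2). f t = g (of_real t)" by blast
  then show ?thesis using that[of "b / 2" g] \<open>b > 0\<close> by simp
qed

text \<open>An expansion is required at every point, not only at 0. The Taylor series at
  \<open>s\<close> converges in the disc of radius \<open>r - \<bar>s\<bar>\<close>, which lies in
  the given disc.\<close>

lemma analytic_germ_real_analytic_on:
  assumes "r > 0" "g holomorphic_on ball 0 r" "\<And>t. t \<in> ball 0 r \<Longrightarrow> f t = g (of_real t)"
  shows "real_analytic_on f (ball 0 r)"
  unfolding real_analytic_on_def
proof
  fix s :: real assume s: "s \<in> ball 0 r"
  define \<rho> where "\<rho> = r - \<bar>s\<bar>"
  have sub: "ball (of_real s :: complex) \<rho> \<subseteq> ball 0 r"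
  proof
    fix w :: complex assume "w \<in> ball (of_real s) \<rho>"
    then show "w \<in> ball 0 r"
      using dist_triangle[of 0 w "of_real s"] by (simp add: \<rho>_def dist_commute)
  qed
  have "(\<lambda>k. (deriv ^^ k) g (of_real s) / fact k * of_real (t - s) ^ k) sums f t"
    if t: "t \<in> ball 0 r \<inter> ball s \<rho>" for t
  proof -
    have "(of_real t :: complex) \<in> ball (of_real s) \<rho>"
      using t by (simp add: dist_norm of_real_diff[symmetric] del: of_real_diff)
    then have "(\<lambda>k. (deriv ^^ k) g (of_real s) / fact k * (of_real t - of_real s) ^ k) sums g (of_real t)"
      by (intro holomorphic_power_series[OF holomorphic_on_subset[OF assms(2) sub]])
    then show ?thesis using assms(3) t by simp
  qed
  then show "\<exists>\<rho>>0. \<exists>c. \<forall>t\<in>ball 0 r \<inter> ball s \<rho>. (\<lambda>k. c k * of_real (t - s) ^ k) sums f t"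
    using s by (intro exI[of _ \<rho>] conjI exI[of _ "\<lambda>k. (deriv ^^ k) g (of_real s) / fact k"]) (auto simp: \<rho>_def)
qed

lemma smooth_on_of_holomorphic:
  assumes "g holomorphic_on ball 0 r"
  shows "smooth_on (\<lambda>t. g (of_real t)) (ball 0 r)"
proof (rule smooth_on_coinduct[where X = "{\<lambda>t. g (of_real t) | g. g holomorphic_on ball 0 r}"])
  fix f assume "f \<in> {\<lambda>t. g (complex_of_real t) | g. g holomorphic_on ball 0 r}"
  then obtain g where f: "f = (\<lambda>t. g (of_real t))" and g: "g holomorphic_on ball 0 r" by auto
  have "(f has_vector_derivative deriv g (of_real t)) (at t within ball 0 r)" if "t \<in> ball 0 r" for t
    unfolding f using that
    by (intro has_vector_derivative_real_field has_field_derivative_at_within[OF holomorphic_derivI[OF g]]) auto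
  then show "\<exists>f'\<in>{\<lambda>t. g (complex_of_real t) | g. g holomorphic_on ball 0 r}.
      \<forall>t\<in>ball 0 r. (f has_vector_derivative f' t) (at t within ball 0 r)"
    using g by (intro bexI[of _ "\<lambda>t. deriv g (of_real t)"]) (auto intro: holomorphic_deriv)
qed (use assms in auto)

text \<open>Lets the exponent found in the real analytic case serve the smooth claim, too.\<close>

lemma analytic_germ_smooth:
  assumes "analytic_germ f"
  shows "smooth_germ f"
proof -
  obtain r g where "r > 0" "g holomorphic_on ball 0 r" "\<And>t. t \<in> ball 0 r \<Longrightarrow> f t = g (of_real t)"
    using analytic_germE[OF assms] by blast
  then show ?thesis
    using smooth_on_cong[OF smooth_on_of_holomorphic] by (intro smooth_germI) auto
qed

lemma holomorphic_on_integral: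
  fixes U :: "complex set" and z :: "real \<Rightarrow> complex"
  assumes U: "open U" "convex U" and a: "\<And>j. j \<le> n \<Longrightarrow> a j holomorphic_on U"
    and h: "continuous_on {0..1} h" and z: "continuous_on {0..1} z"
    and nz: "\<And>t x. t \<in> U \<Longrightarrow> x \<in> {0..1} \<Longrightarrow> (\<Sum>j\<le>n. a j t * z x ^ (n - j)) \<noteq> 0"
  shows "(\<lambda>t. integral {0..1} (\<lambda>x. h x / (\<Sum>j\<le>n. a j t * z x ^ (n - j)))) holomorphic_on U"
proof -
  define D where "D = (\<lambda>t x. \<Sum>j\<le>n. a j t * z x ^ (n - j))"
  define D' where "D' = (\<lambda>t x. \<Sum>j\<le>n. deriv (a j) t * z x ^ (n - j))"
  have contfst: "continuous_on (U \<times> {0..1}) (\<lambda>y. f (fst y))" if "f holomorphic_on U" for f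
    by (rule continuous_on_compose2[OF holomorphic_on_imp_continuous_on[OF that]])
      (auto intro: continuous_intros)
  have contsnd: "continuous_on (U \<times> {0..1}) (\<lambda>y. g (snd y))" if "continuous_on {0..1} g" for g :: "real \<Rightarrow> complex"
    by (rule continuous_on_compose2[OF that]) (auto intro: continuous_intros)
  have contD: "continuous_on (U \<times> {0..1}) (\<lambda>y. D (fst y) (snd y))"
    unfolding D_def by (intro continuous_intros contfst contsnd a z) auto
  have contD': "continuous_on (U \<times> {0..1}) (\<lambda>y. D' (fst y) (snd y))"
    unfolding D'_def by (intro continuous_intros contfst contsnd holomorphic_deriv a U z) auto
  have nzD: "D t x \<noteq> 0" if "t \<in> U" "x \<in> {0..1}" for t x using nz that by (simp add: D_def)
  have contx: "continuous_on {0..1} (\<lambda>x. D t x)" for t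
    unfolding D_def by (intro continuous_intros z)
  have "(\<lambda>t. integral (cbox 0 1) (\<lambda>x. h x / D t x ^ 1)) holomorphic_on U"
  proof (rule leibniz_rule_holomorphic[OF _ _ _ U(2)])
    fix t :: complex and x :: real assume t: "t \<in> U" and x: "x \<in> cbox 0 1"
    have "((\<lambda>t. D t x) has_field_derivative D' t x) (at t within U)"
      unfolding D_def D'_def
    proof (intro DERIV_sum DERIV_cmult_right)
      fix j assume "j \<in> {..n}"
      then show "(a j has_field_derivative deriv (a j) t) (at t within U)"
        using holomorphic_derivI[OF a U(1) t] has_field_derivative_at_within by auto
    qed
    from DERIV_chain2[OF reciprocal_power_derivative[of "D t x" "h x" 1 UNIV] this]
    show "((\<lambda>t. h x / D t x ^ 1) has_field_derivative (- of_nat 1 * h x / D t x ^ Suc 1) * D' t x)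
        (at t within U)"
      using nzD[OF t, of x] x by simp
  next
    fix t assume "t \<in> U"
    then have "continuous_on {0..1} (\<lambda>x. h x / D t x ^ 1)"
      by (intro continuous_intros h contx) (use nzD in auto)
    then show "(\<lambda>x. h x / D t x ^ 1) integrable_on cbox 0 1"
      using integrable_continuous_real by simp
  next
    show "continuous_on (U \<times> cbox 0 1) (\<lambda>(t, x). - of_nat 1 * h x / D t x ^ Suc 1 * D' t x)"
      unfolding case_prod_beta cbox_interval
      by (intro continuous_intros contD contD' contsnd[OF h]) (use nzD in auto)
  qed
  then show ?thesis by (simp add: D_def)
qed

text \<open>The axioms are checked on holomorphic extensions, where complex analysis supplies them:
  division by \<open>t\<close> is a removable singularity, and the integrals are holomorphic in a
  complex parameter.\<close>

interpretation analytic_germ: germ_class analytic_germ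
proof
  show "analytic_germ (\<lambda>_. c)" for c
    by (rule analytic_germI[of 1 "\<lambda>_. c"]) auto
  show "analytic_germ (\<lambda>t. f t + g t)" if "analytic_germ f" "analytic_germ g" for f g
    using that unfolding analytic_germ_def
  proof eventually_elim
    case (elim r)
    then obtain F G where "F holomorphic_on ball 0 r" "G holomorphic_on ball 0 r"
      "\<forall>t\<in>ball 0 r. f t = F (of_real t)" "\<forall>t\<in>ball 0 r. g t = G (of_real t)" by blast
    then show ?case by (intro exI[of _ "\<lambda>z. F z + G z"]) (auto intro: holomorphic_intros)
  qed
  show "analytic_germ (\<lambda>t. f t * g t)" if "analytic_germ f" "analytic_germ g" for f g
    using that unfolding analytic_germ_def
  proof eventually_elim
    case (elim r)
    then obtain F G where "F holomorphic_on ball 0 r" "G holomorphic_on ball 0 r"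
      "\<forall>t\<in>ball 0 r. f t = F (of_real t)" "\<forall>t\<in>ball 0 r. g t = G (of_real t)" by blast
    then show ?case by (intro exI[of _ "\<lambda>z. F z * G z"]) (auto intro: holomorphic_intros)
  qed
  show "analytic_germ complex_of_real"
    by (rule analytic_germI[of 1 "\<lambda>z. z"]) auto
  show "analytic_germ g" if "analytic_germ f" "\<forall>\<^sub>F t in nhds 0. f t = g t" for f g
    using that(1) eventually_at_right_balls[OF that(2)] unfolding analytic_germ_def
    by eventually_elim auto
  show "isCont f 0" if "analytic_germ f" for f
    using that by (intro smooth_germ_isCont analytic_germ_smooth)
  show "analytic_germ (\<lambda>t. f (t ^ N))" if f: "analytic_germ f" and N: "N > 0" for f N
  proof -
    obtain r g where g: "r > 0" "g holomorphic_on ball 0 r" "\<And>t. t \<in> ball 0 r \<Longrightarrow> f t = g (of_real t)"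
      using analytic_germE[OF f(1)] by blast
    have "(g \<circ> (\<lambda>w. w ^ N)) holomorphic_on ball 0 (min r 1)"
      using norm_power_less_min[OF _ N, where 'a = complex] by (intro holomorphic_on_compose_gen[OF _ g(2)] holomorphic_intros) auto
    then show ?thesis using g(1,3) norm_power_less_min[OF _ N, where 'a = real]
      by (intro analytic_germI[of "min r 1" "g \<circ> (\<lambda>w. w ^ N)"]) auto
  qed
  show "\<exists>g. analytic_germ g \<and> (\<forall>\<^sub>F t in nhds 0. f t = complex_of_real t * g t)"
    if f: "analytic_germ f" "f 0 = 0" for f
  proof -
    obtain r g where g: "r > 0" "g holomorphic_on ball 0 r" "\<And>t. t \<in> ball 0 r \<Longrightarrow> f t = g (of_real t)"
      using analytic_germE[OF f(1)] by blast
    define q where "q = (\<lambda>z. if z = 0 then deriv g 0 else (g z - g 0) / (z - 0))"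
    have q: "q holomorphic_on ball 0 r"
      unfolding q_def using g by (intro pole_lemma) auto
    have "g 0 = 0" using g(1) g(3)[of 0] f(2) by simp
    then have "g z = z * q z" for z by (simp add: q_def)
    moreover have "\<forall>\<^sub>F t in nhds 0. t \<in> ball 0 r" using g(1) by (intro eventually_nhds_in_open) auto
    ultimately have "\<forall>\<^sub>F t in nhds 0. f t = of_real t * q (of_real t)"
      using g(3) by (auto elim: eventually_mono)
    then show ?thesis using analytic_germI[OF g(1) q, of "\<lambda>t. q (of_real t)"] by blast
  qed
  fix n :: nat and a :: "nat \<Rightarrow> real \<Rightarrow> complex" and h z :: "real \<Rightarrow> complex"
  assume a: "\<And>j. j \<le> n \<Longrightarrow> analytic_germ (a j)" and h: "continuous_on {0..1} h" and z: "continuous_on {0..1} z"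
    and nz: "\<And>x. x \<in> {0..1} \<Longrightarrow> (\<Sum>j\<le>n. a j 0 * z x ^ (n - j)) \<noteq> 0"
  have "\<forall>\<^sub>F r in at_right 0. \<forall>j\<in>{..n}. \<exists>g. g holomorphic_on ball 0 r \<and> (\<forall>t\<in>ball 0 r. a j t = g (of_real t))"
    using a by (intro eventually_ball_finite) (auto simp: analytic_germ_def)
  then obtain b where "b > 0" "\<And>y. 0 < y \<Longrightarrow> y < b \<Longrightarrow>
      \<forall>j\<in>{..n}. \<exists>g. g holomorphic_on ball 0 y \<and> (\<forall>t\<in>ball 0 y. a j t = g (of_real t))"
    unfolding eventually_at_right_field by blast
  from this(1) this(2)[of "b / 2"] have "b / 2 > 0"
    "\<forall>j\<in>{..n}. \<exists>g. g holomorphic_on ball 0 (b / 2) \<and> (\<forall>t\<in>ball 0 (b / 2). a j t = g (of_real t))"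
    by auto
  then obtain r G where r: "r > 0" and G: "\<And>j. j \<le> n \<Longrightarrow> G j holomorphic_on ball 0 r"
    "\<And>j t. j \<le> n \<Longrightarrow> t \<in> ball 0 r \<Longrightarrow> a j t = G j (of_real t)"
    by (metis atMost_iff)
  \<comment> \<open>Here \<open>t\<close> is complex: the denominator must not vanish in a full
    disc, although it is given on the real line only.\<close>
  have "\<forall>\<^sub>F t in nhds 0. \<forall>x\<in>{0..1}. (\<Sum>j\<le>n. G j t * z x ^ (n - j)) \<noteq> 0"
  proof (rule poly_family_nonzero_near[OF _ z])
    show "isCont (G j) 0" if "j \<le> n" for j
      using G(1)[OF that] r holomorphic_on_imp_continuous_on continuous_on_eq_continuous_at[of "ball 0 r" "G j"]
      by auto
    have "a j 0 = G j 0" if "j \<le> n" for j using G(2)[OF that, of 0] r by simp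
    then show "(\<Sum>j\<le>n. G j 0 * z x ^ (n - j)) \<noteq> 0" if "x \<in> {0..1}" for x
      using nz[OF that] by (simp cong: sum.cong_simp)
  qed
  then obtain d where d: "d > 0" "\<And>t x. t \<in> ball 0 d \<Longrightarrow> x \<in> {0..1} \<Longrightarrow> (\<Sum>j\<le>n. G j t * z x ^ (n - j)) \<noteq> 0"
    unfolding eventually_nhds_metric by (auto simp: dist_commute)
  define \<rho> where "\<rho> = min r d"
  show "analytic_germ (\<lambda>t. integral {0..1} (\<lambda>x. h x / (\<Sum>j\<le>n. a j t * z x ^ (n - j))))"
  proof (rule analytic_germI)
    show "\<rho> > 0" using r d by (simp add: \<rho>_def)
    show "(\<lambda>t. integral {0..1} (\<lambda>x. h x / (\<Sum>j\<le>n. G j t * z x ^ (n - j)))) holomorphic_on ball 0 \<rho>"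
      by (intro holomorphic_on_integral h z holomorphic_on_subset[OF G(1)] d(2)) (auto simp: \<rho>_def)
    show "integral {0..1} (\<lambda>x. h x / (\<Sum>j\<le>n. a j t * z x ^ (n - j))) =
        integral {0..1} (\<lambda>x. h x / (\<Sum>j\<le>n. G j (of_real t) * z x ^ (n - j)))" if "t \<in> ball 0 \<rho>" for t
    proof -
      have "(\<Sum>j\<le>n. a j t * z x ^ (n - j)) = (\<Sum>j\<le>n. G j (of_real t) * z x ^ (n - j))" for x
        using that by (intro sum.cong) (auto simp: G(2) \<rho>_def)
      then show ?thesis by simp
    qed
  qed
qed

subsection \<open>Splitting off the roots in a disc\<close>

lemma has_contour_integral_root_power:
  assumes "r > 0" "dist w y \<noteq> r"
  shows "((\<lambda>z. z ^ e / (z - y)) has_contour_integral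
    (2 * of_real pi * \<i> * (if dist w y < r then y ^ e else 0))) (circlepath w r)"
proof (cases "dist w y < r")
  case True
  have "(\<lambda>z. z ^ e) holomorphic_on cball w r" by (intro holomorphic_intros)
  from Cauchy_integral_circlepath_simple[OF this, of y] show ?thesis
    using True by (simp add: dist_norm norm_minus_commute)
next
  case False
  then have far: "dist w y > r" using assms by simp
  \<comment> \<open>This disc reaches up to the pole \<open>y\<close> without containing it, and it
    contains the circle.\<close>
  have "(\<lambda>z. z ^ e / (z - y)) holomorphic_on ball w (dist w y)"
    by (intro holomorphic_intros) auto
  then have "((\<lambda>z. z ^ e / (z - y)) has_contour_integral 0) (circlepath w r)"
    by (rule Cauchy_theorem_disc_simple) (use far assms(1) in \<open>auto simp: path_image_circlepath\<close>)
  then show ?thesis using False by simp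
qed

lemma has_contour_integral_psum:
  assumes "r > 0" "\<And>y. y \<in># M \<Longrightarrow> dist w y \<noteq> r"
  shows "((\<lambda>z. \<Sum>y\<in>#M. z ^ e / (z - y)) has_contour_integral
    (2 * of_real pi * \<i> * psum e (filter_mset (\<lambda>y. dist w y < r) M))) (circlepath w r)"
  using assms(2)
proof (induction M)
  case (add y M)
  from has_contour_integral_add[OF has_contour_integral_root_power[OF assms(1), of w y e] add.IH] add.prems
  show ?case by (auto simp: algebra_simps split: if_splits)
qed (simp add: has_contour_integral_0)

text \<open>The logarithmic derivative of the polynomial, from differentiating its product form and
  its expanded form. It rewrites the contour integrand in terms of coefficients. For
  \<open>j = size M\<close> the truncated exponent is harmless, as its factor is 0.\<close>

lemma sum_mset_reciprocal_eq:
  assumes "z \<notin># M"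
  shows "(\<Sum>y\<in>#M. 1 / (z - y)) =
    (\<Sum>j\<le>size M. of_nat (size M - j) * esym M j * z ^ (size M - j - 1)) /
    (\<Sum>j\<le>size M. esym M j * z ^ (size M - j))"
proof -
  have "((\<lambda>z. \<Prod>y\<in>#M. z - y) has_field_derivative (\<Prod>y\<in>#M. z - y) * (\<Sum>y\<in>#M. 1 / (z - y))) (at z)"
    using assms
  proof (induction M)
    case (add y M)
    then have "((\<lambda>z. (z - y) * (\<Prod>y\<in>#M. z - y)) has_field_derivative
        (z - y) * ((\<Prod>y\<in>#M. z - y) * (\<Sum>y\<in>#M. 1 / (z - y))) + 1 * (\<Prod>y\<in>#M. z - y)) (at z)"
      by (intro DERIV_mult') (auto intro!: derivative_eq_intros)
    moreover have "(z - y) * ((\<Prod>y\<in>#M. z - y) * (\<Sum>y\<in>#M. 1 / (z - y))) + 1 * (\<Prod>y\<in>#M. z - y) =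
        ((z - y) * (\<Prod>y\<in>#M. z - y)) * (1 / (z - y) + (\<Sum>y\<in>#M. 1 / (z - y)))"
      using add.prems by (simp add: distrib_left)
    ultimately show ?case by simp
  qed simp
  moreover have "((\<lambda>z. \<Sum>j\<le>size M. esym M j * z ^ (size M - j)) has_field_derivative
      (\<Sum>j\<le>size M. of_nat (size M - j) * esym M j * z ^ (size M - j - 1))) (at z)"
    by (auto intro!: derivative_eq_intros sum.cong)
  ultimately have "(\<Prod>y\<in>#M. z - y) * (\<Sum>y\<in>#M. 1 / (z - y)) =
      (\<Sum>j\<le>size M. of_nat (size M - j) * esym M j * z ^ (size M - j - 1))"
    using DERIV_unique by (simp add: prod_mset_eq_esym)
  moreover have "(\<Prod>y\<in>#M. z - y) \<noteq> 0" using assms by (auto simp: prod_mset_zero_iff)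
  ultimately show ?thesis by (simp add: prod_mset_eq_esym field_simps)
qed

context germ_class
begin

lemma tendsto: "C f \<Longrightarrow> (f \<longlongrightarrow> f 0) (nhds 0)"
  using cont by (simp add: tendsto_nhds_iff isCont_def)

text \<open>The residue theorem for \<open>z ^ e * p' / p\<close>, with \<open>p\<close> the
  polynomial with roots \<open>M t\<close>: the integral over the circle is \<open>2 \<pi> i\<close>
  times the power sum of the enclosed roots. Rewritten with coefficients, the integral has the form
  that the axiom \<open>integral\<close> covers.\<close>

lemma root_curve_psum_disc:
  assumes M: "root_curve n M" and r: "r > 0" and sep: "\<And>y. y \<in># M 0 \<Longrightarrow> dist w y \<noteq> r"
  shows "C (\<lambda>t. psum e (filter_mset (\<lambda>y. dist w y < r) (M t)))"
proof -
  define \<gamma> where "\<gamma> = circlepath w r"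
  define \<gamma>' where "\<gamma>' = (\<lambda>x :: real. 2 * of_real pi * \<i> * of_real r * exp (2 * of_real pi * \<i> * of_real x))"
  define D where "D = (\<lambda>t x. \<Sum>j\<le>n. esym (M t) j * \<gamma> x ^ (n - j))"
  have size: "size (M t) = n" for t using M by (simp add: root_curve_def)
  have D: "D t x = (\<Prod>y\<in>#M t. \<gamma> x - y)" for t x by (simp add: D_def prod_mset_eq_esym size)
  have cont\<gamma>: "continuous_on {0..1} \<gamma>"
    unfolding \<gamma>_def using path_circlepath by (simp add: path_def)
  have cont': "continuous_on {0..1} \<gamma>'" unfolding \<gamma>'_def by (intro continuous_intros)
  have dist: "dist w (\<gamma> x) = r" if "x \<in> {0..1}" for x
    using that r path_image_circlepath[of w r] unfolding \<gamma>_def path_image_def by force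
  have nz: "D 0 x \<noteq> 0" if "x \<in> {0..1}" for x
    using dist[OF that] sep[of "\<gamma> x"] by (auto simp: D prod_mset_zero_iff)
  \<comment> \<open>Everything in the integrand that does not depend on \<open>t\<close>: the
    velocity of the circle, \<open>z ^ e\<close>, and the power of \<open>z\<close> from the
    derivative of the polynomial.\<close>
  define h where "h = (\<lambda>j x. \<gamma>' x * \<gamma> x ^ (e + (n - j - 1)))"
  have "C (\<lambda>t. integral {0..1} (\<lambda>x. h j x / D t x))" for j
    unfolding D_def
  proof (rule integral)
    show "C (\<lambda>t. esym (M t) j)" for j using M by (rule root_curve_esym)
    show "continuous_on {0..1} (h j)" unfolding h_def by (intro continuous_intros cont\<gamma> cont')
    show "(\<Sum>j\<le>n. esym (M 0) j * \<gamma> x ^ (n - j)) \<noteq> 0" if "x \<in> {0..1}" for x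
      using nz[OF that] by (simp add: D_def)
  qed (rule cont\<gamma>)
  then have "C (\<lambda>t. 1 / (2 * of_real pi * \<i>) *
      (\<Sum>j\<le>n. (of_nat (n - j) * esym (M t) j) * integral {0..1} (\<lambda>x. h j x / D t x)))"
    using M by (intro cmult sum mult const root_curve_esym)
  moreover have "\<forall>\<^sub>F t in nhds 0. \<forall>x\<in>{0..1}. D t x \<noteq> 0"
    unfolding D_def
    by (rule poly_family_nonzero_near[OF cont[OF root_curve_esym[OF M]] cont\<gamma>])
       (use nz in \<open>simp add: D_def\<close>)
  then have "\<forall>\<^sub>F t in nhds 0. 1 / (2 * of_real pi * \<i>) *
      (\<Sum>j\<le>n. (of_nat (n - j) * esym (M t) j) * integral {0..1} (\<lambda>x. h j x / D t x)) =
      psum e (filter_mset (\<lambda>y. dist w y < r) (M t))"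
  proof eventually_elim
    case (elim t)
    have notin: "\<gamma> x \<notin># M t" if "x \<in> {0..1}" for x
    proof -
      have "D t x \<noteq> 0" using elim that by blast
      then show ?thesis by (auto simp: D prod_mset_zero_iff)
    qed
    have "dist w y \<noteq> r" if "y \<in># M t" for y
    proof
      assume "dist w y = r"
      then have "y \<in> path_image \<gamma>" using r by (simp add: \<gamma>_def path_image_circlepath)
      then show False using notin that by (auto simp: path_image_def)
    qed
    then have "((\<lambda>z. \<Sum>y\<in>#M t. z ^ e / (z - y)) has_contour_integral
        (2 * of_real pi * \<i> * psum e (filter_mset (\<lambda>y. dist w y < r) (M t)))) (circlepath w r)"
      by (intro has_contour_integral_psum r)
    then have "((\<lambda>x. (\<Sum>y\<in>#M t. \<gamma> x ^ e / (\<gamma> x - y)) * \<gamma>' x) has_integral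
        (2 * of_real pi * \<i> * psum e (filter_mset (\<lambda>y. dist w y < r) (M t)))) {0..1}"
      unfolding has_contour_integral_def
      by (rule has_integral_eq[rotated]) (simp add: \<gamma>_def \<gamma>'_def vector_derivative_circlepath01)
    then have "2 * of_real pi * \<i> * psum e (filter_mset (\<lambda>y. dist w y < r) (M t)) =
        integral {0..1} (\<lambda>x. (\<Sum>y\<in>#M t. \<gamma> x ^ e / (\<gamma> x - y)) * \<gamma>' x)"
      by (simp add: integral_unique)
    also have "\<dots> = integral {0..1} (\<lambda>x. \<Sum>j\<le>n. (of_nat (n - j) * esym (M t) j) * (h j x / D t x))"
    proof (rule integral_cong)
      fix x :: real assume x: "x \<in> {0..1}"
      have "(\<Sum>y\<in>#M t. \<gamma> x ^ e / (\<gamma> x - y)) = \<gamma> x ^ e * (\<Sum>y\<in>#M t. 1 / (\<gamma> x - y))"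
        by (simp add: sum_mset_distrib_left)
      also have "\<dots> = \<gamma> x ^ e * ((\<Sum>j\<le>n. of_nat (n - j) * esym (M t) j * \<gamma> x ^ (n - j - 1)) / D t x)"
        using sum_mset_reciprocal_eq[OF notin[OF x]] by (simp add: size D_def)
      also have "\<dots> * \<gamma>' x = (\<Sum>j\<le>n. (of_nat (n - j) * esym (M t) j) * (h j x / D t x))"
        unfolding sum_divide_distrib sum_distrib_left sum_distrib_right h_def
        by (intro sum.cong) (auto simp: power_add)
      finally show "(\<Sum>y\<in>#M t. \<gamma> x ^ e / (\<gamma> x - y)) * \<gamma>' x =
          (\<Sum>j\<le>n. (of_nat (n - j) * esym (M t) j) * (h j x / D t x))" by simp
    qed
    also have "\<dots> = (\<Sum>j\<le>n. (of_nat (n - j) * esym (M t) j) * integral {0..1} (\<lambda>x. h j x / D t x))"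
    proof (subst integral_sum)
      fix j
      have "continuous_on {0..1} (D t)" unfolding D_def by (intro continuous_intros cont\<gamma>)
      then have "continuous_on {0..1} (\<lambda>x. (of_nat (n - j) * esym (M t) j) * (h j x / D t x))"
        unfolding h_def using elim by (intro continuous_intros cont\<gamma> cont') auto
      then show "(\<lambda>x. (of_nat (n - j) * esym (M t) j) * (h j x / D t x)) integrable_on {0..1}"
        by (rule integrable_continuous_real)
    qed (simp_all only: integral_mult_right finite_atMost)
    finally show ?case by (simp add: divide_simps mult_ac)
  qed
  ultimately show ?thesis by (rule cong)
qed

text \<open>The disc about \<open>w\<close> has half the distance to the nearest other root of
  \<open>M 0\<close> as radius, so at 0 it contains copies of \<open>w\<close> only and no root lies
  on its boundary. The remaining power sums are differences.\<close>

lemma root_curve_split: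
  assumes M: "root_curve n M" and w: "w \<in># M 0" "w' \<in># M 0" "w \<noteq> w'"
  obtains p q M1 M2 where "p < n" "q < n" "root_curve p M1" "root_curve q M2"
    "\<forall>\<^sub>F t in nhds 0. M t = M1 t + M2 t" "set_mset (M1 0) \<inter> set_mset (M2 0) = {}"
proof -
  obtain d where d: "d > 0" "\<And>x. x \<in># M 0 \<Longrightarrow> x \<noteq> w \<Longrightarrow> d \<le> dist w x"
    using finite_set_avoid[of "set_mset (M 0)" w] by auto
  define r where "r = d / 2"
  have r: "r > 0" and sep: "dist w y \<noteq> r" if "y \<in># M 0" for y
    using d(1) d(2)[of y] that by (auto simp: r_def)
  define A where "A = (\<lambda>t. filter_mset (\<lambda>y. dist w y < r) (M t))"
  define B where "B = (\<lambda>t. filter_mset (\<lambda>y. \<not> dist w y < r) (M t))"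
  have AB: "M t = A t + B t" for t unfolding A_def B_def by (simp add: multiset_partition)
  have size: "size (M t) = n" for t using M by (simp add: root_curve_def)
  have psumA: "C (\<lambda>t. psum e (A t))" for e
    unfolding A_def using M r[OF w(1)] sep by (rule root_curve_psum_disc)
  have "psum e (B t) = psum e (M t) - psum e (A t)" for e t by (simp add: AB)
  moreover have "C (\<lambda>t. psum e (M t) - psum e (A t))" for e
    using M psumA by (intro diff) (auto simp: root_curve_def)
  ultimately have psumB: "C (\<lambda>t. psum e (B t))" for e by simp
  define p where "p = size (A 0)"
  define q where "q = size (B 0)"
  have pq: "p + q = n" using AB[of 0] size[of 0] by (simp add: p_def q_def)
  have "w \<in># A 0" "w' \<in># B 0"
    using w d(2)[of w'] r[OF w(1)] by (auto simp: A_def B_def r_def)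
  then have "A 0 \<noteq> {#}" "B 0 \<noteq> {#}" by auto
  then have pos: "p > 0" "q > 0" by (simp_all add: p_def q_def nonempty_has_size[symmetric])
  \<comment> \<open>The number of roots in the disc is \<open>psum 0\<close>: continuous at 0 and an
    integer, hence constant near 0.\<close>
  have "((\<lambda>t. psum 0 (A t)) \<longlongrightarrow> psum 0 (A 0)) (nhds 0)" by (rule tendsto[OF psumA])
  then have "\<forall>\<^sub>F t in nhds 0. dist (psum 0 (A t)) (psum 0 (A 0)) < 1" by (rule tendstoD) simp
  then have sizeA: "\<forall>\<^sub>F t in nhds 0. size (A t) = p"
  proof eventually_elim
    case (elim t)
    then have "dist (of_int (int (size (A t))) :: complex) (of_int (int p)) < 1"
      by (simp add: psum_0 p_def)
    then have "\<bar>int (size (A t)) - int p\<bar> < 1"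
      unfolding dist_norm of_int_diff[symmetric] norm_of_int by linarith
    then show ?case by simp
  qed
  \<comment> \<open>Away from 0 the number of roots in the disc may change; dummy roots keep the
    sizes constant there.\<close>
  define M1 where "M1 = (\<lambda>t. if size (A t) = p then A t else replicate_mset p 0)"
  define M2 where "M2 = (\<lambda>t. if size (A t) = p then B t else replicate_mset q 0)"
  have sizeB: "size (B t) = q" if "size (A t) = p" for t
    using AB[of t] size[of t] that pq by simp
  have "root_curve p M1" unfolding root_curve_def
  proof (intro conjI allI)
    show "size (M1 t) = p" for t by (simp add: M1_def)
    show "C (\<lambda>t. psum e (M1 t))" for e
      by (rule cong[OF psumA[of e]]) (use sizeA in \<open>auto elim!: eventually_mono simp: M1_def\<close>)
  qed
  moreover have "root_curve q M2" unfolding root_curve_def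
  proof (intro conjI allI)
    show "size (M2 t) = q" for t by (simp add: M2_def sizeB)
    show "C (\<lambda>t. psum e (M2 t))" for e
      by (rule cong[OF psumB[of e]]) (use sizeA in \<open>auto elim!: eventually_mono simp: M2_def\<close>)
  qed
  moreover have "\<forall>\<^sub>F t in nhds 0. M t = M1 t + M2 t"
    using sizeA by eventually_elim (simp add: M1_def M2_def AB)
  moreover have "set_mset (M1 0) \<inter> set_mset (M2 0) = {}"
  proof -
    have "M1 0 = A 0" "M2 0 = B 0" by (simp_all add: M1_def M2_def p_def)
    then show ?thesis by (auto simp: A_def B_def)
  qed
  ultimately show ?thesis using that[of p q M1 M2] pq pos by simp
qed

end

subsection \<open>Clusters of roots\<close>

text \<open>The neighbourhood is punctured because \<open>f\<close> may vanish at 0. A constant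
  factor in the bound would be absorbed by a larger \<open>p\<close>.\<close>

definition nonflat :: "(real \<Rightarrow> complex) \<Rightarrow> bool" where
  "nonflat f \<longleftrightarrow> (\<exists>p. \<forall>\<^sub>F t in at 0. \<bar>t\<bar> ^ p \<le> norm (f t))"

lemma filterlim_power_nhds_0: "N > 0 \<Longrightarrow> filterlim (\<lambda>t :: real. t ^ N) (nhds 0) (nhds 0)"
proof -
  assume "N > 0"
  have "((\<lambda>t :: real. t ^ N) \<longlongrightarrow> 0 ^ N) (nhds 0)" by (intro tendsto_power filterlim_ident)
  then show ?thesis using \<open>N > 0\<close> by (simp add: zero_power)
qed

lemma filterlim_power_at_0:
  assumes "N > 0"
  shows "filterlim (\<lambda>t :: real. t ^ N) (at 0) (at 0)"
proof (rule filterlim_atI)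
  show "filterlim (\<lambda>t :: real. t ^ N) (nhds 0) (at 0)"
    by (rule filterlim_mono[OF filterlim_power_nhds_0[OF assms] order_refl]) (simp add: at_within_def)
  show "\<forall>\<^sub>F t :: real in at 0. t ^ N \<noteq> 0"
    unfolding eventually_at_filter by (intro always_eventually) simp
qed

lemma eventually_power_nhds_0:
  "\<forall>\<^sub>F t :: real in nhds 0. P t \<Longrightarrow> N > 0 \<Longrightarrow> \<forall>\<^sub>F t in nhds 0. P (t ^ N)"
  using eventually_compose_filterlim[OF _ filterlim_power_nhds_0] .

lemma eventually_at_0_power:
  "\<forall>\<^sub>F t :: real in at 0. P t \<Longrightarrow> N > 0 \<Longrightarrow> \<forall>\<^sub>F t in at 0. P (t ^ N)"
  using eventually_compose_filterlim[OF _ filterlim_power_at_0] .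

lemma eventually_abs_less_nhds_0: "c > 0 \<Longrightarrow> \<forall>\<^sub>F t :: real in nhds 0. \<bar>t\<bar> < c"
  unfolding eventually_nhds_metric by (auto intro!: exI[of _ c])

lemma eventually_nhds_imp_at: "\<forall>\<^sub>F t in nhds x. P t \<Longrightarrow> \<forall>\<^sub>F t in at x. P t"
  by (simp add: eventually_at_filter eventually_mono)

lemma nonflat_power:
  assumes "nonflat f" "N > 0"
  shows "nonflat (\<lambda>t. f (t ^ N))"
proof -
  obtain p where "\<forall>\<^sub>F t in at 0. \<bar>t\<bar> ^ p \<le> norm (f t)" using assms(1) by (auto simp: nonflat_def)
  from eventually_at_0_power[OF this assms(2)]
  have "\<forall>\<^sub>F t in at 0. \<bar>t\<bar> ^ (N * p) \<le> norm (f (t ^ N))" by (simp add: power_abs power_mult)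
  then show ?thesis by (auto simp: nonflat_def)
qed

lemma nonflat_monomial_mult:
  assumes "nonflat f"
  shows "nonflat (\<lambda>t. of_real t ^ R * f t)"
proof -
  obtain p where "\<forall>\<^sub>F t in at 0. \<bar>t\<bar> ^ p \<le> norm (f t)" using assms by (auto simp: nonflat_def)
  then have "\<forall>\<^sub>F t in at 0. \<bar>t\<bar> ^ (R + p) \<le> norm (of_real t ^ R * f t)"
    by eventually_elim (simp add: norm_mult norm_power power_add mult_left_mono)
  then show ?thesis by (auto simp: nonflat_def)
qed

text \<open>For a root larger than \<open>\<epsilon>\<close> the leading term would dominate: the
  other \<open>n\<close> terms together reach at most the fraction \<open>n / (n + 1)\<close> of it.
  The denominator \<open>n + 1\<close> makes the inequality strict.\<close>

lemma norm_root_le: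
  fixes \<epsilon> :: real
  assumes n: "n = size M" and x: "x \<in># M" and \<epsilon>: "0 \<le> \<epsilon>" "\<epsilon> \<le> 1"
    and small: "\<And>j. j \<in> {1..n} \<Longrightarrow> norm (esym M j) \<le> \<epsilon> ^ n / (real n + 1)"
  shows "norm x \<le> \<epsilon>"
proof (rule ccontr)
  assume "\<not> norm x \<le> \<epsilon>"
  then have big: "norm x > \<epsilon>" by simp
  have n0: "n > 0" using x n by (cases M) auto
  \<comment> \<open>Bounds all lower powers of \<open>norm x\<close> by \<open>m ^ (n - 1)\<close>,
    whether \<open>norm x\<close> is below or above 1.\<close>
  define m where "m = max 1 (norm x)"
  have "(\<Prod>y\<in>#M. x - y) = 0" using x by (auto simp: prod_mset_zero_iff)
  then have "x ^ n + (\<Sum>j=1..n. esym M j * x ^ (n - j)) = 0"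
    unfolding prod_mset_eq_esym n[symmetric] by (simp add: sum.atMost_shift sum.atLeast1_atMost_eq)
  then have "norm (x ^ n) = norm (\<Sum>j=1..n. esym M j * x ^ (n - j))"
    by (metis add_eq_0_iff norm_minus_cancel)
  also have "\<dots> \<le> (\<Sum>j=1..n. norm (esym M j) * norm x ^ (n - j))"
    by (rule order.trans[OF norm_sum]) (simp add: norm_mult norm_power)
  also have "\<dots> \<le> (\<Sum>j=1..n. \<epsilon> ^ n / (real n + 1) * m ^ (n - 1))"
  proof (intro sum_mono mult_mono small)
    fix j assume "j \<in> {1..n}"
    have "norm x ^ (n - j) \<le> m ^ (n - j)" by (intro power_mono) (auto simp: m_def)
    also have "\<dots> \<le> m ^ (n - 1)" using \<open>j \<in> {1..n}\<close> by (intro power_increasing) (auto simp: m_def)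
    finally show "norm x ^ (n - j) \<le> m ^ (n - 1)" .
  qed (use \<epsilon> in auto)
  also have "\<dots> = real n / (real n + 1) * (\<epsilon> ^ n * m ^ (n - 1))" by simp
  finally have le: "norm x ^ n \<le> real n / (real n + 1) * (\<epsilon> ^ n * m ^ (n - 1))"
    by (simp add: norm_power)
  have "\<epsilon> ^ n * m ^ (n - 1) \<le> norm x ^ n"
  proof (cases "norm x \<le> 1")
    case True
    then show ?thesis using big \<epsilon>(1) by (simp add: m_def power_mono)
  next
    case False
    then have "\<epsilon> ^ n * m ^ (n - 1) \<le> 1 * m ^ (n - 1)"
      using \<epsilon> by (intro mult_right_mono power_le_one) (auto simp: m_def)
    also have "\<dots> \<le> m ^ n" by (simp add: m_def power_increasing)
    finally show ?thesis using False by (simp add: m_def)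
  qed
  then have "real n / (real n + 1) * (\<epsilon> ^ n * m ^ (n - 1)) \<le> real n / (real n + 1) * norm x ^ n"
    by (intro mult_left_mono) auto
  also have "\<dots> < 1 * norm x ^ n"
    using big \<epsilon>(1) by (intro mult_strict_right_mono zero_less_power) auto
  finally show False using le by simp
qed

context germ_class
begin

lemma bounded_near:
  assumes "C f"
  obtains K where "K > 0" "\<forall>\<^sub>F t in nhds 0. norm (f t) \<le> K"
proof
  show "norm (f 0) + 1 > 0" by (simp add: add_nonneg_pos)
  have "\<forall>\<^sub>F t in nhds 0. dist (f t) (f 0) < 1" using tendstoD[OF tendsto[OF assms]] by simp
  then show "\<forall>\<^sub>F t in nhds 0. norm (f t) \<le> norm (f 0) + 1"
    by eventually_elim (use norm_triangle_sub in \<open>smt (verit) dist_norm\<close>)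
qed

text \<open>Division by \<open>t\<close> is repeated as long as the quotient vanishes at 0. For
  smooth germs this may go on forever without \<open>f\<close> vanishing near 0; then only one
  factorization for each \<open>p\<close> is left.\<close>

lemma finite_or_infinite_order:
  assumes "C f"
  obtains (finite) p g where "C g" "g 0 \<noteq> 0" "\<forall>\<^sub>F t in nhds 0. f t = of_real t ^ p * g t"
    | (infinite) "\<And>p. \<exists>g. C g \<and> (\<forall>\<^sub>F t in nhds 0. f t = of_real t ^ p * g t)"
proof (cases "\<exists>p g. C g \<and> g 0 \<noteq> 0 \<and> (\<forall>\<^sub>F t in nhds 0. f t = of_real t ^ p * g t)")
  case False
  have "\<exists>g. C g \<and> (\<forall>\<^sub>F t in nhds 0. f t = of_real t ^ p * g t)" for p
  proof (induction p)
    case (Suc p)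
    then obtain g where g: "C g" "\<forall>\<^sub>F t in nhds 0. f t = of_real t ^ p * g t" by blast
    with False have "g 0 = 0" by blast
    from divide[OF g(1) this] obtain h where h: "C h" "\<forall>\<^sub>F t in nhds 0. g t = of_real t * h t" by blast
    from g(2) h(2) have "\<forall>\<^sub>F t in nhds 0. f t = of_real t ^ Suc p * h t"
      by eventually_elim simp
    then show ?case using h(1) by blast
  qed (use assms in \<open>auto intro!: exI[of _ f]\<close>)
  then show ?thesis by (rule infinite)
qed (use finite in blast)

lemma monomial_mult_eq_0:
  assumes "C g" "\<forall>\<^sub>F t in nhds 0. of_real t ^ p * g t = 0"
  shows "g 0 = 0"
proof -
  have "\<forall>\<^sub>F t in at 0. g t = 0"
    using assms(2) unfolding eventually_at_filter by eventually_elim auto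
  then have "(g \<longlongrightarrow> 0) (at 0)" by (rule tendsto_eventually)
  moreover have "(g \<longlongrightarrow> g 0) (at 0)" using cont[OF assms(1)] by (simp add: isCont_def)
  ultimately show ?thesis using tendsto_unique trivial_limit_at by blast
qed

lemma nonflat_if_neq_0:
  assumes "C f" "f 0 \<noteq> 0"
  shows "nonflat f"
proof -
  have "\<forall>\<^sub>F t in nhds 0. dist (f t) (f 0) < norm (f 0) / 2"
    using assms by (intro tendstoD[OF tendsto]) auto
  moreover have "\<forall>\<^sub>F t :: real in nhds 0. \<bar>t\<bar> < norm (f 0) / 2"
    using assms by (intro eventually_abs_less_nhds_0) auto
  ultimately have "\<forall>\<^sub>F t in nhds 0. \<bar>t\<bar> ^ 1 \<le> norm (f t)"
  proof eventually_elim
    case (elim t)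
    then show ?case using norm_triangle_ineq2[of "f 0" "f t"] by (simp add: dist_norm norm_minus_commute)
  qed
  then show ?thesis unfolding nonflat_def using eventually_nhds_imp_at by blast
qed

text \<open>The centre is the exact mean and belongs to \<open>C\<close>, so once the roots of a
  cluster coincide, their common value is in the class. The last condition includes
  \<open>t = 0\<close>, where for \<open>p = 1\<close> it forces every member to equal
  \<open>\<mu> 0\<close>.\<close>

definition is_cluster :: "(real \<Rightarrow> complex) \<Rightarrow> (real \<Rightarrow> complex multiset) \<Rightarrow> bool" where
  "is_cluster \<mu> X \<longleftrightarrow> C \<mu> \<and> X 0 \<noteq> {#} \<and>
     (\<forall>t. size (X t) = size (X 0) \<and> \<Sum>\<^sub># (X t) = of_nat (size (X 0)) * \<mu> t) \<and>
     (\<forall>p. \<forall>\<^sub>F t in nhds 0. \<forall>x\<in>#X t. norm (x - \<mu> t) \<le> \<bar>t\<bar> ^ p)"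

text \<open>A list, so that its length counts the clusters; \<open>sorted_wrt\<close> states
  nonflatness once for each pair of positions.\<close>

definition clustered ::
    "(real \<Rightarrow> complex multiset) \<Rightarrow> ((real \<Rightarrow> complex) \<times> (real \<Rightarrow> complex multiset)) list \<Rightarrow> bool" where
  "clustered M L \<longleftrightarrow> (\<forall>\<^sub>F t in nhds 0. M t = (\<Sum>(\<mu>, X)\<leftarrow>L. X t)) \<and>
     (\<forall>(\<mu>, X)\<in>set L. is_cluster \<mu> X) \<and>
     sorted_wrt (\<lambda>(\<mu>, X) (\<nu>, Y). nonflat (\<lambda>t. \<mu> t - \<nu> t)) L"

definition clusterable :: "(real \<Rightarrow> complex multiset) \<Rightarrow> bool" where
  "clusterable M \<longleftrightarrow> (\<exists>N>0. \<exists>L. clustered (\<lambda>t. M (t ^ N)) L)"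

lemma is_cluster_power:
  assumes "is_cluster \<mu> X" "N > 0"
  shows "is_cluster (\<lambda>t. \<mu> (t ^ N)) (\<lambda>t. X (t ^ N))"
  unfolding is_cluster_def
proof (intro conjI allI)
  show "C (\<lambda>t. \<mu> (t ^ N))" using assms by (intro subst) (auto simp: is_cluster_def)
  fix p
  have "\<forall>\<^sub>F t in nhds 0. \<forall>x\<in>#X t. norm (x - \<mu> t) \<le> \<bar>t\<bar> ^ p" using assms(1) by (simp add: is_cluster_def)
  from eventually_power_nhds_0[OF this assms(2)] eventually_abs_less_nhds_0[of 1, OF zero_less_one]
  show "\<forall>\<^sub>F t in nhds 0. \<forall>x\<in>#X (t ^ N). norm (x - \<mu> (t ^ N)) \<le> \<bar>t\<bar> ^ p"
  proof eventually_elim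
    case (elim t)
    have "\<bar>t ^ N\<bar> ^ p \<le> \<bar>t\<bar> ^ p"
      using elim(2) assms(2) power_decreasing[of 1 N "\<bar>t\<bar>"] by (intro power_mono) (auto simp: power_abs)
    then show ?case using elim(1) by (meson order.trans)
  qed
qed (use assms in \<open>auto simp: is_cluster_def zero_power\<close>)

lemma clustered_power:
  assumes "clustered M L" "N > 0"
  shows "clustered (\<lambda>t. M (t ^ N)) (map (\<lambda>(\<mu>, X). (\<lambda>t. \<mu> (t ^ N), \<lambda>t. X (t ^ N))) L)"
proof -
  have "\<forall>\<^sub>F t in nhds 0. M t = (\<Sum>(\<mu>, X)\<leftarrow>L. X t)" using assms(1) by (simp add: clustered_def)
  from eventually_power_nhds_0[OF this assms(2)]
  have "\<forall>\<^sub>F t in nhds 0. M (t ^ N) =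
      (\<Sum>(\<mu>, X)\<leftarrow>map (\<lambda>(\<mu>, X). (\<lambda>t. \<mu> (t ^ N), \<lambda>t. X (t ^ N))) L. X t)"
    by (simp add: o_def case_prod_unfold)
  moreover have "sorted_wrt (\<lambda>(\<mu>, X) (\<nu>, Y). nonflat (\<lambda>t. \<mu> t - \<nu> t))
      (map (\<lambda>(\<mu>, X). (\<lambda>t. \<mu> (t ^ N), \<lambda>t. X (t ^ N))) L)"
    unfolding sorted_wrt_map
  proof (rule sorted_wrt_mono_rel)
    show "sorted_wrt (\<lambda>(\<mu>, X) (\<nu>, Y). nonflat (\<lambda>t. \<mu> t - \<nu> t)) L"
      using assms(1) by (simp add: clustered_def)
    fix x y :: "(real \<Rightarrow> complex) \<times> (real \<Rightarrow> complex multiset)"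
    assume "(case x of (\<mu>, X) \<Rightarrow> \<lambda>(\<nu>, Y). nonflat (\<lambda>t. \<mu> t - \<nu> t)) y"
    then show "(case case x of (\<mu>, X) \<Rightarrow> (\<lambda>t. \<mu> (t ^ N), \<lambda>t. X (t ^ N)) of
        (\<mu>, X) \<Rightarrow> \<lambda>(\<nu>, Y). nonflat (\<lambda>t. \<mu> t - \<nu> t))
        (case y of (\<mu>, X) \<Rightarrow> (\<lambda>t. \<mu> (t ^ N), \<lambda>t. X (t ^ N)))"
      using nonflat_power[OF _ assms(2), of "\<lambda>t. fst x t - fst y t"] by (simp add: case_prod_unfold)
  qed
  moreover have "\<forall>(\<mu>, X)\<in>set (map (\<lambda>(\<mu>, X). (\<lambda>t. \<mu> (t ^ N), \<lambda>t. X (t ^ N))) L). is_cluster \<mu> X"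
    using assms by (auto simp: clustered_def intro!: is_cluster_power)
  ultimately show ?thesis by (simp add: clustered_def)
qed

lemma is_cluster_affine:
  assumes "is_cluster \<mu> X" "C a"
  shows "is_cluster (\<lambda>t. of_real t ^ R * \<mu> t + a t) (\<lambda>t. image_mset (\<lambda>x. of_real t ^ R * x + a t) (X t))"
  unfolding is_cluster_def
proof (intro conjI allI)
  show "C (\<lambda>t. of_real t ^ R * \<mu> t + a t)"
    using assms by (intro add mult power of_real) (auto simp: is_cluster_def)
  show "\<Sum>\<^sub># (image_mset (\<lambda>x. of_real t ^ R * x + a t) (X t)) =
      of_nat (size (image_mset (\<lambda>x. of_real 0 ^ R * x + a 0) (X 0))) * (of_real t ^ R * \<mu> t + a t)" for t
  proof -
    have "\<Sum>\<^sub># (image_mset (\<lambda>x. of_real t ^ R * x + a t) Y) = of_real t ^ R * \<Sum>\<^sub># Y + of_nat (size Y) * a t"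
      for Y by (induction Y) (auto simp: algebra_simps)
    then show ?thesis using assms(1) by (simp add: is_cluster_def algebra_simps)
  qed
  fix p
  have "\<forall>\<^sub>F t in nhds 0. \<forall>x\<in>#X t. norm (x - \<mu> t) \<le> \<bar>t\<bar> ^ p" using assms(1) by (simp add: is_cluster_def)
  with eventually_abs_less_nhds_0[of 1, OF zero_less_one]
  show "\<forall>\<^sub>F t in nhds 0. \<forall>x\<in>#image_mset (\<lambda>x. of_real t ^ R * x + a t) (X t).
      norm (x - (of_real t ^ R * \<mu> t + a t)) \<le> \<bar>t\<bar> ^ p"
  proof eventually_elim
    case (elim t)
    have "norm (of_real t ^ R * x + a t - (of_real t ^ R * \<mu> t + a t)) \<le> \<bar>t\<bar> ^ p" if "x \<in># X t" for x
    proof -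
      have "norm (of_real t ^ R * x + a t - (of_real t ^ R * \<mu> t + a t)) = \<bar>t\<bar> ^ R * norm (x - \<mu> t)"
        by (simp add: norm_mult[symmetric] norm_power[symmetric] right_diff_distrib[symmetric]
            flip: norm_of_real) (simp add: norm_mult norm_power)
      also have "\<dots> \<le> 1 * \<bar>t\<bar> ^ p" using elim that by (intro mult_mono power_le_one) auto
      finally show ?thesis by simp
    qed
    then show ?case by auto
  qed
qed (use assms in \<open>auto simp: is_cluster_def\<close>)

text \<open>A common shift cancels in differences of centres, and the factor \<open>t ^ R\<close>
  raises their order by the finite amount \<open>R\<close>.\<close>

lemma clustered_affine:
  assumes "clustered M L" "C a"
  shows "clustered (\<lambda>t. image_mset (\<lambda>x. of_real t ^ R * x + a t) (M t))
    (map (\<lambda>(\<mu>, X). (\<lambda>t. of_real t ^ R * \<mu> t + a t,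
       \<lambda>t. image_mset (\<lambda>x. of_real t ^ R * x + a t) (X t))) L)"
proof -
  have sum: "image_mset f (\<Sum>(\<mu>, X)\<leftarrow>L. X t) = (\<Sum>(\<mu>, X)\<leftarrow>L. image_mset f (X t))" for f t L
    by (induction L) auto
  have "\<forall>\<^sub>F t in nhds 0. M t = (\<Sum>(\<mu>, X)\<leftarrow>L. X t)" using assms(1) by (simp add: clustered_def)
  then have "\<forall>\<^sub>F t in nhds 0. image_mset (\<lambda>x. of_real t ^ R * x + a t) (M t) =
      (\<Sum>(\<mu>, X)\<leftarrow>map (\<lambda>(\<mu>, X). (\<lambda>t. of_real t ^ R * \<mu> t + a t,
         \<lambda>t. image_mset (\<lambda>x. of_real t ^ R * x + a t) (X t))) L. X t)"
    by eventually_elim (simp add: sum[unfolded case_prod_unfold] o_def case_prod_unfold)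
  moreover have "sorted_wrt (\<lambda>(\<mu>, X) (\<nu>, Y). nonflat (\<lambda>t. \<mu> t - \<nu> t))
      (map (\<lambda>(\<mu>, X). (\<lambda>t. of_real t ^ R * \<mu> t + a t,
         \<lambda>t. image_mset (\<lambda>x. of_real t ^ R * x + a t) (X t))) L)"
    unfolding sorted_wrt_map
  proof (rule sorted_wrt_mono_rel)
    show "sorted_wrt (\<lambda>(\<mu>, X) (\<nu>, Y). nonflat (\<lambda>t. \<mu> t - \<nu> t)) L"
      using assms(1) by (simp add: clustered_def)
    fix x y :: "(real \<Rightarrow> complex) \<times> (real \<Rightarrow> complex multiset)"
    assume "(case x of (\<mu>, X) \<Rightarrow> \<lambda>(\<nu>, Y). nonflat (\<lambda>t. \<mu> t - \<nu> t)) y"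
    then show "(case case x of (\<mu>, X) \<Rightarrow> (\<lambda>t. of_real t ^ R * \<mu> t + a t,
          \<lambda>t. image_mset (\<lambda>x. of_real t ^ R * x + a t) (X t)) of
        (\<mu>, X) \<Rightarrow> \<lambda>(\<nu>, Y). nonflat (\<lambda>t. \<mu> t - \<nu> t))
        (case y of (\<mu>, X) \<Rightarrow> (\<lambda>t. of_real t ^ R * \<mu> t + a t,
          \<lambda>t. image_mset (\<lambda>x. of_real t ^ R * x + a t) (X t)))"
      using nonflat_monomial_mult[of "\<lambda>t. fst x t - fst y t" R]
      by (simp add: case_prod_unfold right_diff_distrib)
  qed
  moreover have "\<forall>(\<mu>, X)\<in>set (map (\<lambda>(\<mu>, X). (\<lambda>t. of_real t ^ R * \<mu> t + a t,
      \<lambda>t. image_mset (\<lambda>x. of_real t ^ R * x + a t) (X t))) L). is_cluster \<mu> X"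
    using assms by (auto simp: clustered_def intro!: is_cluster_affine)
  ultimately show ?thesis by (simp add: clustered_def)
qed

lemma clustered_cong:
  assumes "clustered M L" "\<forall>\<^sub>F t in nhds 0. M t = M' t"
  shows "clustered M' L"
proof -
  have "\<forall>\<^sub>F t in nhds 0. M t = (\<Sum>(\<mu>, X)\<leftarrow>L. X t)" using assms(1) by (simp add: clustered_def)
  with assms(2) have "\<forall>\<^sub>F t in nhds 0. M' t = (\<Sum>(\<mu>, X)\<leftarrow>L. X t)" by eventually_elim simp
  then show ?thesis using assms(1) by (simp add: clustered_def)
qed

text \<open>Undoes both normalizations of Puiseux's algorithm: the rescaling with
  \<open>a = 0\<close>, the centring with \<open>R = 0\<close> and \<open>N0 = 1\<close>.\<close>

lemma clusterable_affine:
  assumes B: "clusterable B" and a: "C a" and N0: "N0 > 0"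
    and eq: "\<forall>\<^sub>F t in nhds 0. M (t ^ N0) = image_mset (\<lambda>x. of_real t ^ R * x + a t) (B t)"
  shows "clusterable M"
proof -
  obtain N L where N: "N > 0" "clustered (\<lambda>t. B (t ^ N)) L" using B by (auto simp: clusterable_def)
  from clustered_affine[OF N(2), where a = "\<lambda>t. a (t ^ N)" and R = "N * R"] obtain L' where
    "clustered (\<lambda>t. image_mset (\<lambda>x. of_real t ^ (N * R) * x + a (t ^ N)) (B (t ^ N))) L'"
    using subst[OF a N(1)] by blast
  moreover have "\<forall>\<^sub>F t in nhds 0. image_mset (\<lambda>x. of_real t ^ (N * R) * x + a (t ^ N)) (B (t ^ N)) = M (t ^ (N * N0))"
    using eventually_power_nhds_0[OF eq N(1)] by eventually_elim (simp add: power_mult)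
  ultimately have "clustered (\<lambda>t. M (t ^ (N * N0))) L'" by (rule clustered_cong)
  then show ?thesis using N(1) N0 by (auto simp: clusterable_def intro!: exI[of _ "N * N0"])
qed

text \<open>At \<open>t = 0\<close> a cluster consists of copies of its centre. Disjointness of root
  sets at 0 thereby passes to the centres.\<close>

lemma clustered_centre:
  assumes "clustered M L" "(\<mu>, X) \<in> set L"
  shows "\<mu> 0 \<in># M 0"
proof -
  have X: "is_cluster \<mu> X" using assms by (auto simp: clustered_def)
  then obtain x where x: "x \<in># X 0" by (auto simp: is_cluster_def)
  have "\<forall>\<^sub>F t in nhds 0. \<forall>x\<in>#X t. norm (x - \<mu> t) \<le> \<bar>t\<bar> ^ 1" using X unfolding is_cluster_def by blast
  from eventually_nhds_x_imp_x[OF this] x have "x = \<mu> 0" by simp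
  moreover have "\<forall>\<^sub>F t in nhds 0. M t = (\<Sum>(\<mu>, X)\<leftarrow>L. X t)" using assms(1) by (simp add: clustered_def)
  from eventually_nhds_x_imp_x[OF this] have "M 0 = (\<Sum>(\<mu>, X)\<leftarrow>L. X 0)" .
  ultimately show ?thesis using x assms(2) by (auto intro!: bexI[of _ "(\<mu>, X)"])
qed

text \<open>Both sides are brought to the exponent \<open>N1 * N2\<close>. Centres from different
  summands differ already at 0, so their differences are nonflat.\<close>

lemma clusterable_add:
  assumes "clusterable M1" "clusterable M2" and disj: "set_mset (M1 0) \<inter> set_mset (M2 0) = {}"
  shows "clusterable (\<lambda>t. M1 t + M2 t)"
proof -
  obtain N1 L1 N2 L2 where N: "N1 > 0" "clustered (\<lambda>t. M1 (t ^ N1)) L1" "N2 > 0" "clustered (\<lambda>t. M2 (t ^ N2)) L2"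
    using assms(1,2) by (auto simp: clusterable_def)
  from clustered_power[OF N(2,3)] obtain L where L: "clustered (\<lambda>t. M1 (t ^ (N1 * N2))) L"
    by (auto simp: power_mult[symmetric] mult.commute)
  from clustered_power[OF N(4,1)] obtain L' where L': "clustered (\<lambda>t. M2 (t ^ (N1 * N2))) L'"
    by (auto simp: power_mult[symmetric])
  have "nonflat (\<lambda>t. \<mu> t - \<nu> t)" if "(\<mu>, X) \<in> set L" "(\<nu>, Y) \<in> set L'" for \<mu> X \<nu> Y
  proof (rule nonflat_if_neq_0)
    show "C (\<lambda>t. \<mu> t - \<nu> t)"
      using L L' that by (intro diff) (auto simp: clustered_def is_cluster_def)
    show "\<mu> 0 - \<nu> 0 \<noteq> 0"
      using clustered_centre[OF L that(1)] clustered_centre[OF L' that(2)] N(1,3) disj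
      by (auto simp: zero_power)
  qed
  moreover have "\<forall>\<^sub>F t in nhds 0. M1 (t ^ (N1 * N2)) + M2 (t ^ (N1 * N2)) = (\<Sum>(\<mu>, X)\<leftarrow>L @ L'. X t)"
  proof -
    have "\<forall>\<^sub>F t in nhds 0. M1 (t ^ (N1 * N2)) = (\<Sum>(\<mu>, X)\<leftarrow>L. X t)"
      "\<forall>\<^sub>F t in nhds 0. M2 (t ^ (N1 * N2)) = (\<Sum>(\<mu>, X)\<leftarrow>L'. X t)"
      using L L' by (auto simp: clustered_def)
    then show ?thesis by eventually_elim simp
  qed
  ultimately have "clustered (\<lambda>t. M1 (t ^ (N1 * N2)) + M2 (t ^ (N1 * N2))) (L @ L')"
    using L L' by (auto simp: clustered_def sorted_wrt_append)
  then show ?thesis using N(1,3) by (auto simp: clusterable_def intro!: exI[of _ "N1 * N2"])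
qed

text \<open>By the root bound \<open>norm_root_le\<close>, flat coefficients make all roots flat.
  They form a single cluster about their mean 0.\<close>

lemma clusterable_flat:
  assumes M: "root_curve n M" and n: "n > 0" and centred: "\<And>t. \<Sum>\<^sub># (M t) = 0"
    and flat: "\<And>j p. j \<in> {1..n} \<Longrightarrow> \<exists>g. C g \<and> (\<forall>\<^sub>F t in nhds 0. esym (M t) j = of_real t ^ p * g t)"
  shows "clusterable M"
proof -
  have size: "size (M t) = n" for t using M by (simp add: root_curve_def)
  have "\<forall>\<^sub>F t in nhds 0. \<forall>x\<in>#M t. norm (x - 0) \<le> \<bar>t\<bar> ^ p" for p
  proof -
    have "\<forall>\<^sub>F t in nhds 0. norm (esym (M t) j) \<le> (\<bar>t\<bar> ^ p) ^ n / (real n + 1)" if j: "j \<in> {1..n}" for j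
    proof -
      \<comment> \<open>One power of \<open>t\<close> beyond \<open>p * n\<close> absorbs the bound
        \<open>K\<close> of \<open>g\<close> and the denominator \<open>n + 1\<close>.\<close>
      obtain g where g: "C g" "\<forall>\<^sub>F t in nhds 0. esym (M t) j = of_real t ^ (p * n + 1) * g t"
        using flat[OF j] by blast
      obtain K where K: "K > 0" "\<forall>\<^sub>F t in nhds 0. norm (g t) \<le> K" using bounded_near[OF g(1)] by blast
      have "\<forall>\<^sub>F t :: real in nhds 0. \<bar>t\<bar> < 1 / ((real n + 1) * K)"
        using K(1) by (intro eventually_abs_less_nhds_0) simp
      with g(2) K(2) show ?thesis
      proof eventually_elim
        case (elim t)
        have "norm (esym (M t) j) = (\<bar>t\<bar> ^ p) ^ n * (\<bar>t\<bar> * norm (g t))"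
          unfolding elim(1) by (simp add: norm_mult norm_power power_mult)
        also have "\<bar>t\<bar> * norm (g t) \<le> 1 / ((real n + 1) * K) * K"
          using elim(2,3) K(1) by (intro mult_mono) auto
        also have "\<dots> = 1 / (real n + 1)" using K(1) by simp
        finally show ?case by (simp add: mult_left_mono)
      qed
    qed
    then have "\<forall>\<^sub>F t in nhds 0. \<forall>j\<in>{1..n}. norm (esym (M t) j) \<le> (\<bar>t\<bar> ^ p) ^ n / (real n + 1)"
      by (intro eventually_ball_finite) auto
    with eventually_abs_less_nhds_0[of 1, OF zero_less_one] show ?thesis
    proof eventually_elim
      case (elim t)
      then show ?case
        using norm_root_le[of n "M t" _ "\<bar>t\<bar> ^ p"] by (auto simp: size power_le_one)
    qed
  qed
  then have "is_cluster (\<lambda>_. 0) M"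
    using n const centred by (auto simp: is_cluster_def size nonempty_has_size)
  then have "clustered (\<lambda>t. M (t ^ 1)) [(\<lambda>_. 0, M)]" by (simp add: clustered_def)
  then show ?thesis unfolding clusterable_def by blast
qed

text \<open>The Newton polygon: \<open>r / n!\<close> is the slope of its first edge.\<close>

lemma rescale_to_distinct_roots:
  assumes M: "root_curve n M" and centred: "\<And>t. \<Sum>\<^sub># (M t) = 0"
    and nonflat: "\<not> (\<forall>j\<in>{1..n}. \<forall>p. \<exists>g. C g \<and> (\<forall>\<^sub>F t in nhds 0. esym (M t) j = of_real t ^ p * g t))"
  obtains N r B w w' where "N > 0" "root_curve n B" "w \<in># B 0" "w' \<in># B 0" "w \<noteq> w'"
    "\<forall>\<^sub>F t in nhds 0. M (t ^ N) = image_mset ((*) (of_real t ^ r)) (B t)"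
proof -
  have size: "size (M t) = n" for t using M by (simp add: root_curve_def)
  have esym1: "esym X 1 = - \<Sum>\<^sub># X" for X using newton_identity[of X 1] 
    by (simp add: psum_0 psum_1 algebra_simps add_eq_0_iff)
  define fin where "fin = (\<lambda>j p g. C g \<and> g 0 \<noteq> 0 \<and> (\<forall>\<^sub>F t in nhds 0. esym (M t) j = of_real t ^ p * g t))"
  define S where "S = {j\<in>{1..n}. \<exists>p g. fin j p g}"
  have "\<forall>j\<in>S. \<exists>p g. fin j p g" by (auto simp: S_def)
  then obtain ord u where ord: "\<And>j. j \<in> S \<Longrightarrow> fin j (ord j) (u j)" by metis
  have inf: "\<exists>g. C g \<and> (\<forall>\<^sub>F t in nhds 0. esym (M t) j = of_real t ^ p * g t)"
    if "j \<in> {1..n} - S" for j p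
  proof -
    have nofin: "\<not> fin j q g" for q g using that by (auto simp: S_def)
    show ?thesis
    proof (cases rule: finite_or_infinite_order[OF root_curve_esym[OF M, of j]])
      case (1 q g)
      then show ?thesis using nofin by (auto simp: fin_def)
    qed blast
  qed
  have "S \<noteq> {}"
  proof
    assume "S = {}"
    with inf nonflat show False by simp
  qed
  \<comment> \<open>Every \<open>j \<le> n\<close> divides \<open>n!\<close>, so after
    \<open>t\<close> is replaced by \<open>t ^ N\<close> all slopes \<open>N * ord j / j\<close> are
    integers.\<close>
  define N where "N = (fact n :: nat)"
  have N: "N > 0" by (simp add: N_def)
  define slope where "slope = (\<lambda>j. N * ord j div j)"
  have slope: "N * ord j = j * slope j" if "j \<in> S" for j
  proof -
    have "j dvd N" unfolding N_def using that by (intro dvd_fact) (auto simp: S_def)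
    then show ?thesis by (simp add: slope_def)
  qed
  define r where "r = Min (slope ` S)"
  have finS: "finite S" by (simp add: S_def)
  have "r \<in> slope ` S" unfolding r_def using finS \<open>S \<noteq> {}\<close> by (intro Min_in) auto
  then obtain j0 where j0: "j0 \<in> S" "slope j0 = r" by blast
  have r: "r \<le> slope j" if "j \<in> S" for j using that finS by (simp add: r_def)
  have "\<exists>b. C b \<and> (\<forall>\<^sub>F t in nhds 0. esym (M (t ^ N)) j = of_real t ^ (r * j) * b t) \<and> (j = j0 \<longrightarrow> b 0 \<noteq> 0)"
    if j: "j \<in> {1..n}" for j
  proof (cases "j \<in> S")
    case True
    \<comment> \<open>The power of \<open>t\<close> left in the \<open>j\<close>-th coefficient
      after rescaling. It is 0 at \<open>j0\<close>, where the minimal slope is attained, so that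
      coefficient survives at 0.\<close>
    define d where "d = j * (slope j - r)"
    have d: "N * ord j = r * j + d"
      using r[OF True] slope[OF True] by (simp add: d_def diff_mult_distrib2 mult.commute)
    define b where "b = (\<lambda>t. of_real t ^ d * u j (t ^ N))"
    have "C b" unfolding b_def using ord[OF True] N by (intro mult power of_real subst) (auto simp: fin_def)
    moreover have "\<forall>\<^sub>F t in nhds 0. esym (M t) j = of_real t ^ ord j * u j t"
      using ord[OF True] by (simp add: fin_def)
    from eventually_power_nhds_0[OF this N]
    have "\<forall>\<^sub>F t in nhds 0. esym (M (t ^ N)) j = of_real t ^ (r * j) * b t"
      by eventually_elim (simp add: b_def power_mult[symmetric] d power_add mult.assoc)
    moreover have "b 0 \<noteq> 0" if "j = j0"
      using that j0(2) ord[OF True] N by (simp add: b_def d_def fin_def zero_power)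
    ultimately show ?thesis by blast
  next
    case False
    then obtain g where g: "C g" "\<forall>\<^sub>F t in nhds 0. esym (M t) j = of_real t ^ (r * j) * g t"
      using inf[of j "r * j"] j by blast
    \<comment> \<open>Here \<open>t ^ (N * (r * j))\<close> is available while only
      \<open>t ^ (r * j)\<close> is removed; the surplus goes into \<open>b\<close>.\<close>
    define b where "b = (\<lambda>t. of_real t ^ ((N - 1) * (r * j)) * g (t ^ N))"
    have "C b" unfolding b_def using g N by (intro mult power of_real subst) auto
    moreover have "N * (r * j) = r * j + (N - 1) * (r * j)" using N by (cases N) auto
    then have "\<forall>\<^sub>F t in nhds 0. esym (M (t ^ N)) j = of_real t ^ (r * j) * b t"
      using eventually_power_nhds_0[OF g(2) N]
      by (auto elim!: eventually_mono simp: b_def power_mult[symmetric] power_add mult.assoc)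
    ultimately show ?thesis using False j0(1) by blast
  qed
  then have "\<forall>j\<in>{1..n}. \<exists>b. C b \<and>
      (\<forall>\<^sub>F t in nhds 0. esym (M (t ^ N)) j = of_real t ^ (r * j) * b t) \<and> (j = j0 \<longrightarrow> b 0 \<noteq> 0)" by blast
  from bchoice[OF this] obtain b where "\<forall>j\<in>{1..n}. C (b j) \<and>
      (\<forall>\<^sub>F t in nhds 0. esym (M (t ^ N)) j = of_real t ^ (r * j) * b j t) \<and> (j = j0 \<longrightarrow> b j 0 \<noteq> 0)"
    by blast
  moreover have "j0 \<in> {1..n}" using j0(1) by (simp add: S_def)
  ultimately have b: "\<And>j. j \<in> {1..n} \<Longrightarrow> C (b j)"
    "\<And>j. j \<in> {1..n} \<Longrightarrow> \<forall>\<^sub>F t in nhds 0. esym (M (t ^ N)) j = of_real t ^ (r * j) * b j t"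
    "b j0 0 \<noteq> 0"
    by blast+
  have "\<exists>X. size X = n \<and> (\<forall>j\<le>n. esym X j = (if j = 0 then 1 else b j t))" for t
    by (rule exists_mset_esym) simp
  then obtain B where B: "\<And>t. size (B t) = n" "\<And>t j. j \<le> n \<Longrightarrow> esym (B t) j = (if j = 0 then 1 else b j t)"
    by metis
  have "root_curve n B"
  proof (rule root_curveI_esym[OF B(1)])
    fix j
    consider "j = 0" | "j \<in> {1..n}" | "j > n" by force
    then show "C (\<lambda>t. esym (B t) j)"
    proof cases
      case 2
      then show ?thesis using B(2) b(1) by simp
    qed (simp_all add: const esym_eq_0 B(1))
  qed
  moreover have "\<forall>\<^sub>F t in nhds 0. M (t ^ N) = image_mset ((*) (of_real t ^ r)) (B t)"
  proof -
    have "\<forall>\<^sub>F t in nhds 0. \<forall>j\<in>{1..n}. esym (M (t ^ N)) j = of_real t ^ (r * j) * b j t"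
      using b(2) by (intro eventually_ball_finite) auto
    then show ?thesis
    proof eventually_elim
      case (elim t)
      show ?case
      proof (rule mset_eq_if_esym_eq)
        fix j assume "j \<le> size (image_mset ((*) (of_real t ^ r)) (B t))"
        then have "j \<le> n" by (simp add: B(1))
        then show "esym (M (t ^ N)) j = esym (image_mset ((*) (of_real t ^ r)) (B t)) j"
          using elim by (cases "j = 0") (auto simp: esym_scale B(2) power_mult)
      qed (simp add: size B(1))
    qed
  qed
  moreover
  have "\<exists>w\<in>#B 0. \<exists>w'\<in>#B 0. w \<noteq> w'"
  proof (rule ccontr)
    \<comment> \<open>If all roots of \<open>B 0\<close> were equal, their vanishing sum would make
      all of them 0, against the nonzero coefficient at \<open>j0\<close>.\<close>
    assume same: "\<not> ?thesis"
    have n: "n > 0" using j0(1) by (auto simp: S_def)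
    then have "B 0 \<noteq> {#}" using B(1)[of 0] by auto
    then obtain w where "w \<in># B 0" by blast
    with same have rep: "B 0 = replicate_mset n w"
      using B(1)[of 0] by (metis set_mset_subset_singletonD singletonI subsetI)
    \<comment> \<open>The sum of the roots vanishes for \<open>t\<close> off 0 by centring, and at 0
      by continuity.\<close>
    have "b 1 0 = 0"
    proof (rule monomial_mult_eq_0)
      show "C (b 1)" using b(1) n by simp
      have "\<forall>\<^sub>F t in nhds 0. esym (M (t ^ N)) 1 = of_real t ^ (r * 1) * b 1 t" using n by (intro b(2)) auto
      then show "\<forall>\<^sub>F t in nhds 0. of_real t ^ (r * 1) * b 1 t = 0"
        by eventually_elim (metis centred esym1 minus_zero)
    qed
    then have "esym (B 0) 1 = 0" using B(2)[of 1 0] n by simp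
    moreover have "\<Sum>\<^sub># (B 0) = of_nat n * w" unfolding rep by simp
    ultimately have "w = 0" using esym1[of "B 0"] n by simp
    \<comment> \<open>Scaling by 0 fixes \<open>B 0\<close>, so \<open>esym_scale\<close> shows that
      its coefficients of positive index vanish.\<close>
    then have "image_mset ((*) 0) (B 0) = B 0" unfolding rep by simp
    then have "esym (B 0) j0 = 0 ^ j0 * esym (B 0) j0" using esym_scale[of 0 "B 0" j0] by simp
    then show False using B(2)[of j0 0] b(3) j0(1) by (auto simp: S_def power_0_left)
  qed
  then obtain w w' where "w \<in># B 0" "w' \<in># B 0" "w \<noteq> w'" by blast
  ultimately show ?thesis using that[of N B w w' r] N by blast
qed

theorem root_curve_clusterable:
  assumes "root_curve n M"
  shows "clusterable M"
  using assms
proof (induction n arbitrary: M rule: less_induct)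
  case (less n)
  show ?case
  proof (cases "n = 0")
    case True
    then have "M t = {#}" for t using less.prems by (simp add: root_curve_def)
    then have "clustered (\<lambda>t. M (t ^ 1)) []" by (simp add: clustered_def)
    then show ?thesis unfolding clusterable_def by blast
  next
    case False
    have size: "size (M t) = n" for t using less.prems by (simp add: root_curve_def)
    define a where "a = (\<lambda>t. 1 / of_nat n * psum 1 (M t))"
    have a: "C a" unfolding a_def using less.prems by (intro cmult) (simp add: root_curve_def)
    define M' where "M' = (\<lambda>t. image_mset (\<lambda>x. x - a t) (M t))"
    have M': "root_curve n M'" unfolding M'_def using less.prems a by (rule root_curve_shift)
    have centred: "\<Sum>\<^sub># (M' t) = 0" for t
    proof -
      have "\<Sum>\<^sub># (image_mset (\<lambda>x. x - c) Y) = \<Sum>\<^sub># Y - of_nat (size Y) * c" for Y and c :: complex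
        by (induction Y) (auto simp: algebra_simps)
      then show ?thesis using False by (simp add: M'_def size a_def psum_1)
    qed
    have "clusterable M'"
    proof (cases "\<forall>j\<in>{1..n}. \<forall>p. \<exists>g. C g \<and> (\<forall>\<^sub>F t in nhds 0. esym (M' t) j = of_real t ^ p * g t)")
      case True
      then show ?thesis using clusterable_flat[OF M' _ centred] False by blast
    next
      case nonflat: False
      obtain N r B w w' where B: "N > 0" "root_curve n B" "w \<in># B 0" "w' \<in># B 0" "w \<noteq> w'"
        "\<forall>\<^sub>F t in nhds 0. M' (t ^ N) = image_mset ((*) (of_real t ^ r)) (B t)"
        by (rule rescale_to_distinct_roots[OF M' centred nonflat]) (rule that)
      obtain p q M1 M2 where split: "p < n" "q < n" "root_curve p M1" "root_curve q M2"
        "\<forall>\<^sub>F t in nhds 0. B t = M1 t + M2 t" "set_mset (M1 0) \<inter> set_mset (M2 0) = {}"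
        by (rule root_curve_split[OF B(2-5)]) (rule that)
      have "clusterable (\<lambda>t. M1 t + M2 t)"
        using less.IH[OF split(1,3)] less.IH[OF split(2,4)] split(6) by (rule clusterable_add)
      then show ?thesis
      proof (rule clusterable_affine[OF _ const B(1)])
        show "\<forall>\<^sub>F t in nhds 0. M' (t ^ N) = image_mset (\<lambda>x. of_real t ^ r * x + 0) (M1 t + M2 t)"
          using B(6) split(5) by eventually_elim simp
      qed
    qed
    then show ?thesis
    proof (rule clusterable_affine[OF _ a, where ?N0.0 = 1 and R = 0])
      show "\<forall>\<^sub>F t in nhds 0. M (t ^ 1) = image_mset (\<lambda>x. of_real t ^ 0 * x + a t) (M' t)"
        by (simp add: M'_def image_mset.compositionality o_def)
    qed simp
  qed
qed

end

subsection \<open>Genericity\<close>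

context germ_class
begin

text \<open>The centres are at least \<open>\<bar>t\<bar> ^ p\<close> apart, the roots within
  \<open>\<bar>t\<bar> ^ (p + 2)\<close> of them; for \<open>0 < \<bar>t\<bar> < 1 / 2\<close> no
  root can be near both.\<close>

lemma clusters_disjoint:
  assumes X: "is_cluster \<mu> X" and Y: "is_cluster \<nu> Y" and nonflat: "nonflat (\<lambda>t. \<mu> t - \<nu> t)"
  shows "\<forall>\<^sub>F t in at 0. set_mset (X t) \<inter> set_mset (Y t) = {}"
proof -
  obtain p where p: "\<forall>\<^sub>F t in at 0. \<bar>t\<bar> ^ p \<le> norm (\<mu> t - \<nu> t)" using nonflat by (auto simp: nonflat_def)
  have small: "2 * s ^ (p + 2) < s ^ p" if "0 < s" "s < 1 / 2" for s :: real
  proof -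
    have "s\<^sup>2 < (1 / 2)\<^sup>2" using that by (intro power_strict_mono) auto
    then have "s ^ p * (2 * s\<^sup>2) < s ^ p * 1"
      using that by (intro mult_strict_left_mono) (auto simp: power2_eq_square)
    then show ?thesis by (simp add: power_add power2_eq_square mult_ac)
  qed
  have "\<forall>\<^sub>F t in at 0. \<forall>x\<in>#X t. norm (x - \<mu> t) \<le> \<bar>t\<bar> ^ (p + 2)"
    "\<forall>\<^sub>F t in at 0. \<forall>x\<in>#Y t. norm (x - \<nu> t) \<le> \<bar>t\<bar> ^ (p + 2)"
    using X Y unfolding is_cluster_def by (blast intro: eventually_nhds_imp_at)+
  moreover have "\<forall>\<^sub>F t :: real in at 0. \<bar>t\<bar> < 1 / 2"
    by (intro eventually_nhds_imp_at eventually_abs_less_nhds_0) simp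
  moreover have "\<forall>\<^sub>F t :: real in at 0. t \<noteq> 0" by (simp add: eventually_at_filter)
  ultimately show ?thesis using p
  proof eventually_elim
    case (elim t)
    show ?case
    proof (rule ccontr)
      assume "set_mset (X t) \<inter> set_mset (Y t) \<noteq> {}"
      then obtain x where "x \<in># X t" "x \<in># Y t" by blast
      then have "norm (x - \<mu> t) \<le> \<bar>t\<bar> ^ (p + 2)" "norm (x - \<nu> t) \<le> \<bar>t\<bar> ^ (p + 2)"
        using elim by blast+
      moreover have "norm (\<mu> t - \<nu> t) \<le> norm (x - \<nu> t) + norm (x - \<mu> t)"
        using norm_triangle_ineq4[of "x - \<nu> t" "x - \<mu> t"] by simp
      ultimately have "\<bar>t\<bar> ^ p \<le> 2 * \<bar>t\<bar> ^ (p + 2)" using elim by linarith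
      moreover have "2 * \<bar>t\<bar> ^ (p + 2) < \<bar>t\<bar> ^ p" using elim by (intro small) auto
      ultimately show False by linarith
    qed
  qed
qed

text \<open>For \<open>t\<close> off 0 the clusters are nonempty and disjoint, so they contain at
  least \<open>length L\<close> distinct roots. If there are no more, each cluster has one distinct
  root, which is then its mean.\<close>

lemma clusters_collapse:
  assumes L: "clustered M L" and few: "\<forall>\<^sub>F t in nhds 0. card (set_mset (M t)) \<le> length L"
  shows "\<forall>\<^sub>F t in nhds 0. \<forall>(\<mu>, X)\<in>set L. X t = replicate_mset (size (X 0)) (\<mu> t)"
proof -
  define \<mu> where "\<mu> = (\<lambda>i. fst (L ! i))"
  define X where "X = (\<lambda>i. snd (L ! i))"
  have cluster: "is_cluster (\<mu> i) (X i)" if "i < length L" for i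
    using L nth_mem[OF that] by (auto simp: clustered_def \<mu>_def X_def case_prod_beta)
  then have size: "size (X i t) = size (X i 0)" "\<Sum>\<^sub># (X i t) = of_nat (size (X i 0)) * \<mu> i t"
    "X i 0 \<noteq> {#}" if "i < length L" for i t
    using that unfolding is_cluster_def by blast+
  have eq: "X i t = replicate_mset (size (X i 0)) (\<mu> i t)"
    if i: "i < length L" and y: "set_mset (X i t) = {y}" for i t y
  proof -
    have "X i t = replicate_mset (size (X i 0)) y"
      using y size(1)[OF i] by (metis order_refl set_mset_subset_singletonD)
    moreover from this have "of_nat (size (X i 0)) * y = of_nat (size (X i 0)) * \<mu> i t"
      using size(2)[OF i, of t] by simp
    then have "y = \<mu> i t" using size(3)[OF i] by simp
    ultimately show ?thesis by simp
  qed
  have "\<forall>\<^sub>F t in at 0. \<forall>i<length L. X i t = replicate_mset (size (X i 0)) (\<mu> i t)"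
  proof -
    have "\<forall>\<^sub>F t in at 0. \<forall>(i, j)\<in>{(i, j). i < j \<and> j < length L}. set_mset (X i t) \<inter> set_mset (X j t) = {}"
    proof (rule eventually_ball_finite)
      show "finite {(i, j). i < j \<and> j < length L}"
        by (rule finite_subset[of _ "{..<length L} \<times> {..<length L}"]) auto
      have "\<forall>\<^sub>F t in at 0. set_mset (X i t) \<inter> set_mset (X j t) = {}" if "i < j" "j < length L" for i j
      proof (rule clusters_disjoint)
        show "nonflat (\<lambda>t. \<mu> i t - \<mu> j t)"
          using L that unfolding clustered_def sorted_wrt_iff_nth_less by (auto simp: \<mu>_def case_prod_beta)
      qed (use cluster that in auto)
      then show "\<forall>ij\<in>{(i, j). i < j \<and> j < length L}.
          \<forall>\<^sub>F t in at 0. case ij of (i, j) \<Rightarrow> set_mset (X i t) \<inter> set_mset (X j t) = {}"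
        by auto
    qed
    moreover have "\<forall>\<^sub>F t in at 0. card (set_mset (M t)) \<le> length L"
      using few by (rule eventually_nhds_imp_at)
    moreover have "\<forall>\<^sub>F t in at 0. M t = (\<Sum>(\<mu>, X)\<leftarrow>L. X t)"
      using L by (intro eventually_nhds_imp_at) (simp add: clustered_def)
    ultimately show ?thesis
    proof eventually_elim
      case (elim t)
      have "set_mset (X i t) \<inter> set_mset (X j t) = {}" if "i < j" "j < length L" for i j
        using elim(1) that by auto
      then have disj: "set_mset (X i t) \<inter> set_mset (X j t) = {}"
        if "i < length L" "j < length L" "i \<noteq> j" for i j
        using that by (metis Int_commute linorder_neqE_nat)
      have "set_mset (M t) = (\<Union>i<length L. set_mset (X i t))"
        unfolding elim(3) by (auto simp: X_def set_conv_nth case_prod_beta)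
      then have card: "card (set_mset (M t)) = (\<Sum>i<length L. card (set_mset (X i t)))"
        using disj by (simp add: card_UN_disjoint)
      have ne: "X i t \<noteq> {#}" if "i < length L" for i using size(1,3)[OF that] by (metis size_eq_0_iff_empty)
      then have pos: "card (set_mset (X i t)) \<ge> 1" if "i < length L" for i
        using that by (simp add: Suc_le_eq card_gt_0_iff)
      have "card (set_mset (X i t)) = 1" if "i < length L" for i
      proof (rule ccontr)
        assume "card (set_mset (X i t)) \<noteq> 1"
        with pos[OF that] have "1 < card (set_mset (X i t))" by simp
        then have "(\<Sum>i<length L. 1) < (\<Sum>i<length L. card (set_mset (X i t)))"
          using pos that by (intro sum_strict_mono_ex1) auto
        then show False using elim(2) card by simp
      qed
      then show ?case using eq by (metis card_1_singletonE)
    qed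
  qed
  \<comment> \<open>Different clusters may meet at 0, so counting fails there; the flatness of a
    cluster settles this point.\<close>
  moreover have "X i 0 = replicate_mset (size (X i 0)) (\<mu> i 0)" if i: "i < length L" for i
  proof -
    have "\<forall>\<^sub>F t in nhds 0. \<forall>x\<in>#X i t. norm (x - \<mu> i t) \<le> \<bar>t\<bar> ^ 1"
      using cluster[OF i] unfolding is_cluster_def by blast
    from eventually_nhds_x_imp_x[OF this] have "set_mset (X i 0) \<subseteq> {\<mu> i 0}" by auto
    then have "set_mset (X i 0) = {\<mu> i 0}" using size(3)[OF i] by auto
    then show ?thesis by (rule eq[OF i])
  qed
  ultimately have "\<forall>\<^sub>F t in nhds 0. \<forall>i<length L. X i t = replicate_mset (size (X i 0)) (\<mu> i t)"
    by (simp add: eventually_nhds_conv_at)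
  then show ?thesis
  proof eventually_elim
    case (elim t)
    show ?case
    proof clarify
      fix \<nu> Y assume "(\<nu>, Y) \<in> set L"
      then obtain i where "i < length L" "L ! i = (\<nu>, Y)" by (auto simp: in_set_conv_nth)
      with elim[rule_format, of i] show "Y t = replicate_mset (size (Y 0)) (\<nu> t)"
        by (simp add: \<mu>_def X_def)
    qed
  qed
qed

text \<open>An application of \<open>norm_Delta_mset_le\<close> with
  \<open>\<epsilon> = \<bar>t\<bar> ^ p\<close>: bounded centres keep the roots bounded.\<close>

lemma Delta_flat:
  assumes L: "clustered M L" and size: "\<And>t. size (M t) = n" and k: "length L < k"
  shows "\<exists>K. \<forall>\<^sub>F t in nhds 0. norm (Delta_mset k (M t)) \<le> K * \<bar>t\<bar> ^ p"
proof -
  define \<mu> where "\<mu> = (\<lambda>i. fst (L ! i))"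
  define X where "X = (\<lambda>i. snd (L ! i))"
  have cluster: "is_cluster (\<mu> i) (X i)" if "i < length L" for i
    using L nth_mem[OF that] by (auto simp: clustered_def \<mu>_def X_def case_prod_beta)
  have "\<exists>K. \<forall>\<^sub>F t in nhds 0. norm (\<mu> i t) \<le> K" if "i < length L" for i
    using bounded_near[of "\<mu> i"] cluster[OF that] by (metis is_cluster_def)
  then obtain B where B: "\<And>i. i < length L \<Longrightarrow> \<forall>\<^sub>F t in nhds 0. norm (\<mu> i t) \<le> B i" by metis
  \<comment> \<open>The sum dominates every bound \<open>B i\<close>; the 1 covers the distance of a
    root from its centre.\<close>
  define K where "K = 1 + (\<Sum>i<length L. \<bar>B i\<bar>)"
  have K: "B i + 1 \<le> K" if "i < length L" for i
    using member_le_sum[of i "{..<length L}" "\<lambda>i. \<bar>B i\<bar>"] that by (simp add: K_def)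
  have K1: "K \<ge> 1" by (simp add: K_def sum_nonneg)
  have "\<forall>\<^sub>F t in nhds 0. \<forall>i\<in>{..<length L}. norm (\<mu> i t) \<le> B i" using B by (intro eventually_ball_finite) auto
  moreover have "\<forall>\<^sub>F t in nhds 0. \<forall>i\<in>{..<length L}. \<forall>x\<in>#X i t. norm (x - \<mu> i t) \<le> \<bar>t\<bar> ^ p"
    using cluster by (intro eventually_ball_finite) (auto simp: is_cluster_def)
  moreover have "\<forall>\<^sub>F t in nhds 0. M t = (\<Sum>(\<mu>, X)\<leftarrow>L. X t)" using L by (simp add: clustered_def)
  moreover have "\<forall>\<^sub>F t :: real in nhds 0. \<bar>t\<bar> < 1" by (rule eventually_abs_less_nhds_0) simp
  ultimately have "\<forall>\<^sub>F t in nhds 0. norm (Delta_mset k (M t)) \<le> (2 ^ n * (4 * K\<^sup>2) ^ (k * k) * 4) * \<bar>t\<bar> ^ p"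
  proof eventually_elim
    case (elim t)
    have le1: "\<bar>t\<bar> ^ p \<le> 1" using elim(4) by (simp add: power_le_one)
    have near: "\<exists>i<length L. norm (x - \<mu> i t) \<le> \<bar>t\<bar> ^ p" if "x \<in># M t" for x
      using that elim(2) unfolding elim(3) by (auto simp: X_def set_conv_nth case_prod_beta)
    have "norm x \<le> K" if x: "x \<in># M t" for x
    proof -
      obtain i where i: "i < length L" "norm (x - \<mu> i t) \<le> \<bar>t\<bar> ^ p" using near[OF x] by blast
      have "norm x \<le> norm (\<mu> i t) + norm (x - \<mu> i t)" by (rule norm_triangle_sub)
      moreover have "norm (\<mu> i t) \<le> B i" using elim(1) i(1) by simp
      ultimately show ?thesis using i(2) le1 K[OF i(1)] by linarith
    qed
    from norm_Delta_mset_le[of "M t" "length L" "\<lambda>i. \<mu> i t" "\<bar>t\<bar> ^ p" K k, OF near this K1 k]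
    have "norm (Delta_mset k (M t)) \<le> 2 ^ n * ((4 * K\<^sup>2) ^ (k * k) * (2 * \<bar>t\<bar> ^ p)\<^sup>2)" by (simp add: size)
    also have "\<dots> = (2 ^ n * (4 * K\<^sup>2) ^ (k * k) * 4) * (\<bar>t\<bar> ^ p * \<bar>t\<bar> ^ p)"
      by (simp add: power2_eq_square mult_ac)
    also have "\<dots> \<le> (2 ^ n * (4 * K\<^sup>2) ^ (k * k) * 4) * (1 * \<bar>t\<bar> ^ p)"
      using le1 by (intro mult_left_mono mult_right_mono) auto
    finally show ?case by simp
  qed
  then show ?thesis by blast
qed

end

text \<open>The decay of \<open>f\<close> is known only on one side, along
  \<open>t0 + \<sigma> * t ^ N\<close>. Hadamard division works on all of \<open>I\<close>, and
  whether the next quotient vanishes at \<open>t0\<close> is decided by its limit along that curve.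
  So \<open>f\<close> is divisible by every power of \<open>s - t0\<close>.\<close>

lemma flatness_order_eq_infinity:
  fixes I :: "real set" and \<sigma> t0 :: real
  assumes I: "is_interval I" "t0 \<in> I" and f: "smooth_on f I" and \<sigma>: "\<sigma> \<in> {1, -1}" and N: "N > 0"
    and side: "\<forall>\<^sub>F t in nhds 0. t0 + \<sigma> * t ^ N \<in> I"
    and flat: "\<And>p. \<exists>K. \<forall>\<^sub>F t in nhds 0. norm (f (t0 + \<sigma> * t ^ N)) \<le> K * \<bar>t\<bar> ^ p"
  shows "flatness_order I t0 f = \<infinity>"
proof -
  have "\<exists>g. smooth_on g I \<and> (\<forall>s\<in>I. f s = of_real (s - t0) ^ p * g s)" for p
  proof (induction p)
    case (Suc p)
    then obtain g where g: "smooth_on g I" "\<And>s. s \<in> I \<Longrightarrow> f s = of_real (s - t0) ^ p * g s" by blast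
    \<comment> \<open>The power \<open>N * p\<close> compensates the factor
      \<open>(s - t0) ^ p\<close>; the one extra \<open>t\<close> makes the quotient tend to
      0.\<close>
    obtain K where K: "\<forall>\<^sub>F t in nhds 0. norm (f (t0 + \<sigma> * t ^ N)) \<le> K * \<bar>t\<bar> ^ (N * p + 1)" using flat by blast
    have bound: "\<forall>\<^sub>F t in at 0. norm (g (t0 + \<sigma> * t ^ N)) \<le> K * \<bar>t\<bar>"
    proof -
      have "\<forall>\<^sub>F t :: real in at 0. t \<noteq> 0" by (simp add: eventually_at_filter)
      with eventually_nhds_imp_at[OF K] eventually_nhds_imp_at[OF side] show ?thesis
      proof eventually_elim
        case (elim t)
        have "norm (f (t0 + \<sigma> * t ^ N)) = \<bar>t\<bar> ^ (N * p) * norm (g (t0 + \<sigma> * t ^ N))"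
          using g(2)[OF elim(2)] \<sigma>
          by (auto simp: norm_mult norm_power power_mult abs_mult power_abs)
        with elim(1) have "\<bar>t\<bar> ^ (N * p) * norm (g (t0 + \<sigma> * t ^ N)) \<le> \<bar>t\<bar> ^ (N * p) * (K * \<bar>t\<bar>)"
          by (simp add: mult_ac)
        then show ?case using elim(3) by (simp add: mult_le_cancel_left)
      qed
    qed
    have lim: "((\<lambda>t. t0 + \<sigma> * t ^ N) \<longlongrightarrow> t0) (at 0)"
      using N by (auto intro!: tendsto_eq_intros simp: zero_power)
    have "(g \<longlongrightarrow> g t0) (at t0 within I)"
      using smooth_on_continuous[OF g(1)] I(2) by (simp add: continuous_on_def)
    then have lim_g: "((\<lambda>t. g (t0 + \<sigma> * t ^ N)) \<longlongrightarrow> g t0) (at 0)"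
    proof (rule filterlim_compose)
      show "filterlim (\<lambda>t. t0 + \<sigma> * t ^ N) (at t0 within I) (at 0)"
        unfolding filterlim_at
      proof
        have "\<forall>\<^sub>F t :: real in at 0. t \<noteq> 0" by (simp add: eventually_at_filter)
        with eventually_nhds_imp_at[OF side] show "\<forall>\<^sub>F t in at 0. t0 + \<sigma> * t ^ N \<in> I \<and> t0 + \<sigma> * t ^ N \<noteq> t0"
          by eventually_elim (use \<sigma> in auto)
      qed (rule lim)
    qed
    have "((\<lambda>t. K * \<bar>t\<bar>) \<longlongrightarrow> 0) (at 0)" by (auto intro!: tendsto_eq_intros)
    then have "((\<lambda>t. g (t0 + \<sigma> * t ^ N)) \<longlongrightarrow> 0) (at 0)"
      by (rule Lim_null_comparison[OF bound])
    then have "g t0 = 0" using lim_g tendsto_unique trivial_limit_at by blast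
    from smooth_on_divide[OF g(1) I this] obtain h where
      h: "smooth_on h I" "\<And>s. s \<in> I \<Longrightarrow> g s = of_real (s - t0) * h s" by blast
    show ?case by (rule exI[of _ h]) (use g h in simp)
  qed (use f in auto)
  then have factor: "\<exists>g. smooth_on g I \<and> (\<forall>s\<in>I. f s = of_real (s - t0) ^ p * g s)" for p .
  have le: "enat p \<le> flatness_order I t0 f" for p
  proof -
    obtain g where g: "smooth_on g I" "\<forall>s\<in>I. f s = of_real (s - t0) ^ p * g s" using factor by blast
    have "continuous_on (I \<inter> ball t0 1) g"
      by (rule continuous_on_subset[OF smooth_on_continuous[OF g(1)]]) simp
    then have "\<exists>\<delta>>0. \<exists>g. continuous_on (I \<inter> ball t0 \<delta>) g \<and>
        (\<forall>t\<in>I \<inter> ball t0 \<delta>. f t = complex_of_real (t - t0) ^ p * g t)"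
      using g(2) by (intro exI[of _ 1] conjI exI[of _ g]) auto
    then show ?thesis unfolding flatness_order_def by (intro Sup_upper CollectI exI[of _ p] conjI refl)
  qed
  show ?thesis
  proof (rule ccontr)
    assume "flatness_order I t0 f \<noteq> \<infinity>"
    then obtain m where "flatness_order I t0 f = enat m" by auto
    with le[of "Suc m"] show False by simp
  qed
qed

text \<open>The ring arguments at the level of functions on a whole set: flatness in the genericity
  condition is measured along \<open>I\<close>.\<close>

interpretation smooth_functions: function_ring "\<lambda>f. smooth_on f J" for J
  by unfold_locales (auto intro: smooth_on_const smooth_on_add smooth_on_mult)

text \<open>The curve is used twice: over \<open>I\<close>, where it makes
  \<open>\<Delta>\<^sub>k\<close> smooth, and as a curve of germs after the substitution, where it
  yields the clusters. The former carries the flatness found on one side to \<open>I\<close>, where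
  genericity applies.\<close>

lemma (in germ_class) generic_curve_roots:
  fixes I :: "real set" and a :: "nat \<Rightarrow> real \<Rightarrow> complex" and \<sigma> t0 :: real
  assumes I: "is_interval I" "t0 \<in> I"
    and P: "\<And>t z. t \<in> I \<Longrightarrow> poly (P t) z = z ^ n + (\<Sum>j=1..n. (-1) ^ j * a j t * z ^ (n - j))"
    and smooth: "\<And>j. j \<in> {1..n} \<Longrightarrow> smooth_on (a j) I"
    and generic: "generic_curve n I P"
    and \<sigma>: "\<sigma> \<in> {1, -1}" and side: "\<forall>\<^sub>F t in nhds 0. t0 + \<sigma> * t\<^sup>2 \<in> I"
    and coeffs: "\<And>j. j \<in> {1..n} \<Longrightarrow> C (\<lambda>t. a j (t0 + \<sigma> * t\<^sup>2))"
  obtains N lam where "N > 0" "\<And>j. j \<in> {1..n} \<Longrightarrow> C (lam j)"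
    "\<forall>\<^sub>F t in nhds 0. \<forall>z. poly (P (t0 + \<sigma> * t ^ (2 * N))) z = (\<Prod>j=1..n. z - lam j t)"
proof -
  define c where "c = (\<lambda>t j. if j = 0 then 1 else (-1) ^ j * a j t)"
  have Pc: "poly (P t) z = (\<Sum>j\<le>n. c t j * z ^ (n - j))" if "t \<in> I" for t z
    using P[OF that] by (simp add: c_def sum.atMost_shift sum.atLeast1_atMost_eq)
  note factors = poly_factors_mset[of "c t" "P t" n for t, OF _ Pc]
  \<comment> \<open>Outside \<open>I\<close> nothing is known about \<open>P\<close>; dummy roots
    keep the size equal to \<open>n\<close>.\<close>
  define R where "R = (\<lambda>t. if t \<in> I then proots (P t) else replicate_mset n 0)"
  have sizeR: "size (R t) = n" for t using factors(1)[of t] by (simp add: R_def c_def)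
  have esymR: "esym (R t) j = c t j" if "t \<in> I" "j \<le> n" for t j
    using factors(3)[OF _ that(1,2)] that by (simp add: R_def c_def)
  have polyR: "poly (P t) z = (\<Prod>x\<in>#R t. z - x)" if "t \<in> I" for t z
    using factors(2)[OF _ that] that by (simp add: R_def c_def)
  have "smooth_functions.root_curve I n R"
  proof (rule smooth_functions.root_curveI_esym[OF sizeR])
    fix j
    consider "j = 0" | "j \<in> {1..n}" | "j > n" by force
    then show "smooth_on (\<lambda>t. esym (R t) j) I"
    proof cases
      case 2
      then have "smooth_on (\<lambda>t. (-1) ^ j * a j t) I" by (intro smooth_functions.cmult smooth)
      then show ?thesis by (rule smooth_on_cong) (use 2 esymR in \<open>auto simp: c_def\<close>)
    qed (simp_all add: smooth_on_const esym_eq_0 sizeR)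
  qed
  then have smooth_Delta: "smooth_on (\<lambda>t. Delta k (P t)) I" for k
    by (rule smooth_on_cong[OF smooth_functions.root_curve_Delta]) (simp add: R_def Delta_eq_Delta_mset)
  define M where "M = (\<lambda>t. R (t0 + \<sigma> * t\<^sup>2))"
  have curve: "root_curve n M"
  proof (rule root_curveI_esym)
    show "size (M t) = n" for t by (simp add: M_def sizeR)
    fix j
    consider "j = 0" | "j \<in> {1..n}" | "j > n" by force
    then show "C (\<lambda>t. esym (M t) j)"
    proof cases
      case 2
      then have "C (\<lambda>t. (-1) ^ j * a j (t0 + \<sigma> * t\<^sup>2))" by (intro cmult coeffs)
      moreover have "\<forall>\<^sub>F t in nhds 0. (-1) ^ j * a j (t0 + \<sigma> * t\<^sup>2) = esym (M t) j"
        using side by eventually_elim (use 2 esymR in \<open>auto simp: c_def M_def\<close>)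
      ultimately show ?thesis by (rule cong)
    qed (simp_all add: const esym_eq_0 M_def sizeR)
  qed
  obtain N L where N: "N > 0" and L: "clustered (\<lambda>t. M (t ^ N)) L"
    using root_curve_clusterable[OF curve] unfolding clusterable_def by blast
  have M_eq: "M (t ^ N) = R (t0 + \<sigma> * t ^ (2 * N))" for t
    by (simp add: M_def power_mult[symmetric] mult.commute)
  have side': "\<forall>\<^sub>F t in nhds 0. t0 + \<sigma> * t ^ (2 * N) \<in> I"
    using eventually_power_nhds_0[OF side N] by (simp add: power_mult[symmetric] mult.commute)
  have M_Delta: "\<forall>\<^sub>F t in nhds 0. \<forall>k. Delta k (P (t0 + \<sigma> * t ^ (2 * N))) = Delta_mset k (M (t ^ N))"
    using side' by eventually_elim (simp add: M_eq R_def Delta_eq_Delta_mset)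
  have infinite_order: "flatness_order I t0 (\<lambda>t. Delta k (P t)) = \<infinity>" if k: "length L < k" for k
  proof (rule flatness_order_eq_infinity[OF I smooth_Delta \<sigma> _ side'])
    show "2 * N > 0" using N by simp
    fix p
    obtain K where "\<forall>\<^sub>F t in nhds 0. norm (Delta_mset k (M (t ^ N))) \<le> K * \<bar>t\<bar> ^ p"
      using Delta_flat[OF L _ k] by (auto simp: M_def sizeR)
    with M_Delta have "\<forall>\<^sub>F t in nhds 0. norm (Delta k (P (t0 + \<sigma> * t ^ (2 * N)))) \<le> K * \<bar>t\<bar> ^ p"
      by eventually_elim simp
    then show "\<exists>K. \<forall>\<^sub>F t in nhds 0. norm (Delta k (P (t0 + \<sigma> * t ^ (2 * N)))) \<le> K * \<bar>t\<bar> ^ p" by blast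
  qed
  have germ_zero: "germ_zero_at I t0 (\<lambda>t. Delta k (P t))" if "k \<in> {length L<..n}" for k
  proof (rule ccontr)
    \<comment> \<open>Genericity concerns only the largest index with a nonzero germ. Were some germ
      above \<open>length L\<close> nonzero, that largest index would be \<open>Max S\<close>, where
      the order of flatness is infinite.\<close>
    define S where "S = {k \<in> {length L<..n}. \<not> germ_zero_at I t0 (\<lambda>t. Delta k (P t))}"
    assume "\<not> germ_zero_at I t0 (\<lambda>t. Delta k (P t))"
    with that have "k \<in> S" by (simp add: S_def)
    moreover have finS: "finite S" by (simp add: S_def)
    ultimately have "Max S \<in> S" by (intro Max_in) auto
    moreover have "germ_zero_at I t0 (\<lambda>t. Delta j (P t))" if "j \<in> {Max S<..n}" for j
    proof (rule ccontr)
      assume "\<not> germ_zero_at I t0 (\<lambda>t. Delta j (P t))"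
      with that \<open>Max S \<in> S\<close> have "j \<in> S" by (auto simp: S_def)
      then have "j \<le> Max S" using finS by simp
      then show False using that by simp
    qed
    moreover have max: "length L < Max S" "Max S \<in> {1..n}" "\<not> germ_zero_at I t0 (\<lambda>t. Delta (Max S) (P t))"
      using \<open>Max S \<in> S\<close> unfolding S_def by auto
    ultimately have "flatness_order I t0 (\<lambda>t. Delta (Max S) (P t)) \<noteq> \<infinity>"
      using generic I(2) unfolding generic_curve_def by blast
    then show False using infinite_order[OF max(1)] by simp
  qed
  have "\<forall>\<^sub>F t in nhds 0. \<forall>k\<in>{length L<..n}. Delta k (P (t0 + \<sigma> * t ^ (2 * N))) = 0"
  proof (rule eventually_ball_finite)
    show "\<forall>k\<in>{length L<..n}. \<forall>\<^sub>F t in nhds 0. Delta k (P (t0 + \<sigma> * t ^ (2 * N))) = 0"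
    proof
      fix k assume "k \<in> {length L<..n}"
      then obtain \<delta> where \<delta>: "\<delta> > 0" "\<And>t. t \<in> I \<inter> ball t0 \<delta> \<Longrightarrow> Delta k (P t) = 0"
        using germ_zero unfolding germ_zero_at_def by blast
      have "\<forall>\<^sub>F t in nhds 0. \<bar>t ^ (2 * N)\<bar> < \<delta>"
        using eventually_power_nhds_0[OF eventually_abs_less_nhds_0[OF \<delta>(1)], of "2 * N"] N by simp
      with side' show "\<forall>\<^sub>F t in nhds 0. Delta k (P (t0 + \<sigma> * t ^ (2 * N))) = 0"
        by eventually_elim (use \<delta>(2) \<sigma> in \<open>auto simp: dist_real_def\<close>)
    qed
  qed simp
  with M_Delta have "\<forall>\<^sub>F t in nhds 0. card (set_mset (M (t ^ N))) \<le> length L"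
  proof eventually_elim
    case (elim t)
    have "card (set_mset (M (t ^ N))) \<le> n"
    proof -
      obtain xs where "mset xs = M (t ^ N)" using ex_mset by blast
      then show ?thesis
        using card_length[of xs] sizeR unfolding M_def by (metis set_mset_mset size_mset)
    qed
    \<comment> \<open>The number of distinct roots is an index at which \<open>Delta_mset\<close>
      does not vanish, so it cannot exceed \<open>length L\<close>.\<close>
    then show ?case using elim Delta_mset_neq_0[OF refl, of "M (t ^ N)"]
      by (metis greaterThanAtMost_iff not_less)
  qed
  from clusters_collapse[OF L this]
  have collapse: "\<forall>\<^sub>F t in nhds 0. \<forall>(\<mu>, X)\<in>set L. X t = replicate_mset (size (X 0)) (\<mu> t)" .
  \<comment> \<open>Each centre is repeated with the constant size of its cluster as
    multiplicity.\<close>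
  define lams where "lams = concat (map (\<lambda>(\<mu>, X). replicate (size (X 0)) \<mu>) L)"
  have "\<forall>\<^sub>F t in nhds 0. M (t ^ N) = (\<Sum>(\<mu>, X)\<leftarrow>L. X t)" using L by (simp add: clustered_def)
  with collapse have M_lams: "\<forall>\<^sub>F t in nhds 0. M (t ^ N) = mset (map (\<lambda>\<mu>. \<mu> t) lams)"
  proof eventually_elim
    case (elim t)
    have "(\<Sum>(\<mu>, X)\<leftarrow>K. X t) = mset (map (\<lambda>\<mu>. \<mu> t) (concat (map (\<lambda>(\<mu>, X). replicate (size (X 0)) \<mu>) K)))"
      if "set K \<subseteq> set L" for K
      using that by (induction K) (use elim(1) in \<open>auto simp: mset_replicate\<close>)
    then show ?case using elim(2) by (simp add: lams_def)
  qed
  have len: "length lams = n"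
    using arg_cong[OF eventually_nhds_x_imp_x[OF M_lams], of size] by (simp add: M_def sizeR)
  show ?thesis
  proof
    show "N > 0" by (rule N)
    show "C (lams ! (j - 1))" if "j \<in> {1..n}" for j
    proof -
      have "lams ! (j - 1) \<in> set lams" using that len by (intro nth_mem) auto
      then show ?thesis using L unfolding lams_def clustered_def is_cluster_def by auto
    qed
    show "\<forall>\<^sub>F t in nhds 0. \<forall>z. poly (P (t0 + \<sigma> * t ^ (2 * N))) z = (\<Prod>j=1..n. z - (lams ! (j - 1)) t)"
      using side' M_lams
    proof eventually_elim
      case (elim t)
      show ?case
      proof
        fix z
        have "poly (P (t0 + \<sigma> * t ^ (2 * N))) z = (\<Prod>x\<in>#mset (map (\<lambda>\<mu>. \<mu> t) lams). z - x)"
          using polyR[OF elim(1)] elim(2) by (simp add: M_eq)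
        also have "\<dots> = (\<Prod>\<mu>\<leftarrow>lams. z - \<mu> t)"
          by (simp add: mset_map[symmetric] prod_mset_prod_list o_def del: mset_map)
        also have "\<dots> = (\<Prod>j<n. z - (lams ! j) t)"
          by (simp add: prod.list_conv_set_nth len atLeast0LessThan)
        also have "\<dots> = (\<Prod>j=1..n. z - (lams ! (j - 1)) t)"
          by (simp add: prod.atLeast1_atMost_eq)
        finally show "poly (P (t0 + \<sigma> * t ^ (2 * N))) z = (\<Prod>j=1..n. z - (lams ! (j - 1)) t)" .
      qed
    qed
  qed
qed

subsection \<open>Parameterizing the roots on both sides\<close>

lemma real_analytic_on_subset:
  assumes "real_analytic_on f J" "K \<subseteq> J"
  shows "real_analytic_on f K"
  unfolding real_analytic_on_def
proof
  fix s assume "s \<in> K"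
  then obtain r c where "r > 0" "\<forall>t\<in>J \<inter> ball s r. (\<lambda>k. c k * of_real (t - s) ^ k) sums f t"
    using assms unfolding real_analytic_on_def by blast
  then show "\<exists>r>0. \<exists>c. \<forall>t\<in>K \<inter> ball s r. (\<lambda>k. c k * of_real (t - s) ^ k) sums f t"
    using assms(2) by blast
qed

lemma real_analytic_on_shift:
  assumes "real_analytic_on f (ball 0 \<delta>)"
  shows "real_analytic_on (\<lambda>t. f (t - t0)) (ball t0 \<delta>)"
  unfolding real_analytic_on_def
proof
  fix s assume "s \<in> ball t0 \<delta>"
  then have "s - t0 \<in> ball 0 \<delta>" by (simp add: dist_real_def)
  then obtain r c where "r > 0"
    and c: "\<And>t. t \<in> ball 0 \<delta> \<inter> ball (s - t0) r \<Longrightarrow> (\<lambda>k. c k * of_real (t - (s - t0)) ^ k) sums f t"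
    using assms unfolding real_analytic_on_def by blast
  moreover have "(\<lambda>k. c k * of_real (t - s) ^ k) sums f (t - t0)" if "t \<in> ball t0 \<delta> \<inter> ball s r" for t
    using c[of "t - t0"] that by (simp add: dist_real_def)
  ultimately show "\<exists>r>0. \<exists>c. \<forall>t\<in>ball t0 \<delta> \<inter> ball s r. (\<lambda>k. c k * of_real (t - s) ^ k) sums f (t - t0)"
    by blast
qed

lemma eventually_at_right_0E:
  assumes "\<forall>\<^sub>F \<delta> in at_right (0 :: real). R \<delta>"
  obtains \<delta> where "\<delta> > 0" "R \<delta>"
proof -
  obtain b where "b > 0" "\<And>y. 0 < y \<Longrightarrow> y < b \<Longrightarrow> R y"
    using assms unfolding eventually_at_right_field by blast
  then show ?thesis using that[of "b / 2"] by simp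
qed

text \<open>The germs live on a full neighbourhood of 0. They are translated to \<open>t0\<close>
  and only then restricted to \<open>J\<close>, which may be one-sided.\<close>

lemma smooth_roots_nearI:
  assumes lam: "\<And>j. j \<in> {1..n} \<Longrightarrow> smooth_germ (lam j)"
    and eq: "\<forall>\<^sub>F t in nhds 0. \<forall>z. poly (Q (t0 + t)) z = (\<Prod>j=1..n. z - lam j t)"
  shows "smooth_roots_near n Q J t0"
proof -
  have "\<forall>\<^sub>F \<delta> in at_right 0. \<forall>j\<in>{1..n}. smooth_on (lam j) (ball 0 \<delta>)"
    using lam by (intro eventually_ball_finite) (auto simp: smooth_germ_def)
  moreover have "\<forall>\<^sub>F \<delta> in at_right 0. \<forall>t\<in>ball 0 \<delta>. \<forall>z. poly (Q (t0 + t)) z = (\<Prod>j=1..n. z - lam j t)"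
    using eq by (rule eventually_at_right_balls)
  ultimately have "\<forall>\<^sub>F \<delta> in at_right 0. (\<forall>j\<in>{1..n}. smooth_on (lam j) (ball 0 \<delta>)) \<and>
      (\<forall>t\<in>ball 0 \<delta>. \<forall>z. poly (Q (t0 + t)) z = (\<Prod>j=1..n. z - lam j t))"
    by eventually_elim blast
  then obtain \<delta> where \<delta>: "\<delta> > 0" "\<And>j. j \<in> {1..n} \<Longrightarrow> smooth_on (lam j) (ball 0 \<delta>)"
    "\<And>t z. t \<in> ball 0 \<delta> \<Longrightarrow> poly (Q (t0 + t)) z = (\<Prod>j=1..n. z - lam j t)"
    by (rule eventually_at_right_0E) (use that in blast)
  have "smooth_on (\<lambda>t. lam j (t - t0)) (J \<inter> ball t0 \<delta>)" if "j \<in> {1..n}" for j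
  proof -
    have "smooth_on (\<lambda>t. lam j (0 + 1 * (t - t0) ^ 1)) (ball t0 \<delta>)"
      by (rule smooth_on_affine_power[OF \<delta>(2)[OF that]]) (auto simp: dist_real_def)
    from smooth_on_subset[OF this, of "J \<inter> ball t0 \<delta>"] show ?thesis by simp
  qed
  moreover have "root_parameterization n Q (J \<inter> ball t0 \<delta>) (\<lambda>j t. lam j (t - t0))"
    unfolding root_parameterization_def
  proof (intro ballI allI)
    fix t z assume "t \<in> J \<inter> ball t0 \<delta>"
    then have "t - t0 \<in> ball 0 \<delta>" by (simp add: dist_real_def abs_minus_commute)
    from \<delta>(3)[OF this, of z] show "poly (Q t) z = (\<Prod>j=1..n. z - lam j (t - t0))" by simp
  qed
  ultimately show ?thesis using \<delta>(1) unfolding smooth_roots_near_def by blast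
qed

lemma real_analytic_roots_nearI:
  assumes lam: "\<And>j. j \<in> {1..n} \<Longrightarrow> analytic_germ (lam j)"
    and eq: "\<forall>\<^sub>F t in nhds 0. \<forall>z. poly (Q (t0 + t)) z = (\<Prod>j=1..n. z - lam j t)"
  shows "real_analytic_roots_near n Q J t0"
proof -
  have "\<forall>\<^sub>F \<delta> in at_right 0. \<forall>j\<in>{1..n}. \<exists>g. g holomorphic_on ball 0 \<delta> \<and> (\<forall>t\<in>ball 0 \<delta>. lam j t = g (of_real t))"
    using lam by (intro eventually_ball_finite) (auto simp: analytic_germ_def)
  moreover have "\<forall>\<^sub>F \<delta> in at_right 0. \<forall>t\<in>ball 0 \<delta>. \<forall>z. poly (Q (t0 + t)) z = (\<Prod>j=1..n. z - lam j t)"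
    using eq by (rule eventually_at_right_balls)
  ultimately have "\<forall>\<^sub>F \<delta> in at_right 0.
      (\<forall>j\<in>{1..n}. \<exists>g. g holomorphic_on ball 0 \<delta> \<and> (\<forall>t\<in>ball 0 \<delta>. lam j t = g (of_real t))) \<and>
      (\<forall>t\<in>ball 0 \<delta>. \<forall>z. poly (Q (t0 + t)) z = (\<Prod>j=1..n. z - lam j t))"
    by eventually_elim blast
  then obtain \<delta> where \<delta>: "\<delta> > 0"
    "\<And>j. j \<in> {1..n} \<Longrightarrow> \<exists>g. g holomorphic_on ball 0 \<delta> \<and> (\<forall>t\<in>ball 0 \<delta>. lam j t = g (of_real t))"
    "\<And>t z. t \<in> ball 0 \<delta> \<Longrightarrow> poly (Q (t0 + t)) z = (\<Prod>j=1..n. z - lam j t)"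
    by (rule eventually_at_right_0E) (use that in blast)
  have analytic: "real_analytic_on (lam j) (ball 0 \<delta>)" if j: "j \<in> {1..n}" for j
  proof -
    obtain g where "g holomorphic_on ball 0 \<delta>" "\<forall>t\<in>ball 0 \<delta>. lam j t = g (of_real t)"
      using \<delta>(2)[OF j] by blast
    then show ?thesis by (intro analytic_germ_real_analytic_on[OF \<delta>(1)]) auto
  qed
  have "real_analytic_on (\<lambda>t. lam j (t - t0)) (J \<inter> ball t0 \<delta>)" if "j \<in> {1..n}" for j
    using real_analytic_on_shift[OF analytic[OF that]] by (rule real_analytic_on_subset) auto
  moreover have "root_parameterization n Q (J \<inter> ball t0 \<delta>) (\<lambda>j t. lam j (t - t0))"
    unfolding root_parameterization_def
  proof (intro ballI allI)
    fix t z assume "t \<in> J \<inter> ball t0 \<delta>"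
    then have "t - t0 \<in> ball 0 \<delta>" by (simp add: dist_real_def abs_minus_commute)
    from \<delta>(3)[OF this, of z] show "poly (Q t) z = (\<Prod>j=1..n. z - lam j (t - t0))" by simp
  qed
  ultimately show ?thesis using \<delta>(1) unfolding real_analytic_roots_near_def by blast
qed

text \<open>For the side on which \<open>I\<close> has no point besides \<open>t0\<close>: the roots
  of one polynomial, as constant functions.\<close>

lemma roots_near_singleton:
  assumes P: "\<And>z. poly (Q t0) z = z ^ n + (\<Sum>j=1..n. c j * z ^ (n - j))"
  shows "smooth_roots_near n Q {t0} t0" "real_analytic_roots_near n Q {t0} t0"
proof -
  define d where "d = (\<lambda>j. if j = 0 then 1 else c j)"
  have "poly (Q t0) z = (\<Sum>j\<le>n. d j * z ^ (n - j))" for z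
    using P by (simp add: d_def sum.atMost_shift sum.atLeast1_atMost_eq)
  from poly_factors_mset(1,2)[of d, OF _ this] have factors: "size (proots (Q t0)) = n"
    "\<And>z. poly (Q t0) z = (\<Prod>x\<in>#proots (Q t0). z - x)" by (simp_all add: d_def)
  obtain xs where xs: "mset xs = proots (Q t0)" using ex_mset by blast
  have len: "length xs = n" using factors(1) xs by (metis size_mset)
  define lam where "lam = (\<lambda>j (t :: real). xs ! (j - 1))"
  have "poly (Q t0) z = (\<Prod>j=1..n. z - lam j t0)" for z
  proof -
    have "poly (Q t0) z = (\<Prod>x\<leftarrow>xs. z - x)"
      unfolding factors(2) xs[symmetric] by (simp add: mset_map[symmetric] prod_mset_prod_list del: mset_map)
    also have "\<dots> = (\<Prod>j<n. z - xs ! j)"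
      by (simp add: prod.list_conv_set_nth len atLeast0LessThan)
    also have "\<dots> = (\<Prod>j=1..n. z - lam j t0)"
      by (simp add: prod.atLeast1_atMost_eq lam_def)
    finally show ?thesis .
  qed
  then have "root_parameterization n Q ({t0} \<inter> ball t0 1) lam" by (simp add: root_parameterization_def)
  moreover have "smooth_on (lam j) K" for j K unfolding lam_def by (rule smooth_on_const)
  moreover have "real_analytic_on (lam j) ({t0} \<inter> ball t0 1)" for j
    unfolding real_analytic_on_def
  proof
    fix s assume s: "s \<in> {t0} \<inter> ball t0 1"
    have "(\<lambda>k. (if k = 0 then lam j t0 else 0) * of_real (t0 - s) ^ k) = (\<lambda>k. if k = 0 then lam j t0 else 0)"
      by auto
    then have "(\<lambda>k. (if k = 0 then lam j t0 else 0) * of_real (t0 - s) ^ k) sums lam j t0"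
      using sums_single[of 0 "\<lambda>_. lam j t0"] by simp
    then show "\<exists>r>0. \<exists>c. \<forall>t\<in>{t0} \<inter> ball t0 1 \<inter> ball s r. (\<lambda>k. c k * of_real (t - s) ^ k) sums lam j t"
      by (intro exI[of _ 1] conjI exI[of _ "\<lambda>k. if k = 0 then lam j t0 else 0"]) auto
  qed
  ultimately show "smooth_roots_near n Q {t0} t0" "real_analytic_roots_near n Q {t0} t0"
    unfolding smooth_roots_near_def real_analytic_roots_near_def
    by (intro exI[of _ 1] exI[of _ lam] conjI; simp)+
qed

text \<open>At an endpoint \<open>f\<close> has one-sided derivatives only; the square maps a full
  neighbourhood of 0 into \<open>I\<close>, so the composition is a two-sided germ.\<close>

lemma smooth_germ_square:
  assumes f: "smooth_on f I" and side: "\<forall>\<^sub>F t in nhds 0. t0 + \<sigma> * t\<^sup>2 \<in> I"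
  shows "smooth_germ (\<lambda>t. f (t0 + \<sigma> * t\<^sup>2))"
proof -
  obtain \<delta> where \<delta>: "\<delta> > 0" "\<And>t. t \<in> ball 0 \<delta> \<Longrightarrow> t0 + \<sigma> * t\<^sup>2 \<in> I"
    using side unfolding eventually_nhds_metric by (auto simp: dist_commute)
  have "smooth_on (\<lambda>t. f (t0 + \<sigma> * (t - 0)\<^sup>2)) (ball 0 \<delta>)"
    by (rule smooth_on_affine_power[OF f]) (use \<delta>(2) in auto)
  then show ?thesis using \<delta>(1) by (intro smooth_germI[of \<delta>]) auto
qed

text \<open>The power series of \<open>f\<close> at \<open>t0\<close> is only known to represent \<open>f\<close> on one side of \<open>t0\<close>; a point of
  convergence on that side makes it holomorphic in a disc.\<close>

lemma analytic_germ_square: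
  assumes f: "real_analytic_on f I" and t0: "t0 \<in> I" and \<sigma>: "\<sigma> \<in> {1, -1}"
    and s0: "s0 > 0" and side: "\<And>s. 0 \<le> s \<Longrightarrow> s \<le> s0 \<Longrightarrow> t0 + \<sigma> * s \<in> I"
  shows "analytic_germ (\<lambda>t. f (t0 + \<sigma> * t\<^sup>2))"
proof -
  obtain r c where r: "r > 0" and c: "\<And>t. t \<in> I \<inter> ball t0 r \<Longrightarrow> (\<lambda>k. c k * of_real (t - t0) ^ k) sums f t"
    using f t0 unfolding real_analytic_on_def by blast
  \<comment> \<open>Halving \<open>r\<close> puts \<open>t0 + \<sigma> * s\<close> itself inside the
    ball where the series is known to converge.\<close>
  define s where "s = min s0 (r / 2)"
  have s: "s > 0" "s \<le> s0" "s < r" using s0 r by (auto simp: s_def)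
  have sums: "(\<lambda>k. c k * of_real (\<sigma> * u) ^ k) sums f (t0 + \<sigma> * u)" if "0 \<le> u" "u \<le> s" for u
    using c[of "t0 + \<sigma> * u"] side[of u] \<sigma> that s by (auto simp: dist_real_def)
  define h where "h = (\<lambda>w. \<Sum>k. c k * w ^ k)"
  have "(\<lambda>k. c k * (w - 0) ^ k) sums h w" if "w \<in> ball 0 s" for w
  proof -
    have "summable (\<lambda>k. c k * of_real (\<sigma> * s) ^ k)" using sums[of s] s by (simp add: sums_iff)
    then have "summable (\<lambda>k. c k * w ^ k)"
      by (rule powser_inside) (use that \<sigma> s in \<open>auto simp: norm_mult\<close>)
    then show ?thesis by (simp add: h_def summable_sums)
  qed
  then have h: "h holomorphic_on ball 0 s" by (rule power_series_holomorphic)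
  have small: "norm (w ^ 2) < s" if "norm w < min s 1" for w :: complex
    using norm_power_less_min[OF that] by simp
  have "(h \<circ> (\<lambda>w. of_real \<sigma> * w\<^sup>2)) holomorphic_on ball 0 (min s 1)"
  proof (rule holomorphic_on_compose_gen[OF _ h])
    show "(\<lambda>w. of_real \<sigma> * w\<^sup>2) ` ball 0 (min s 1) \<subseteq> ball (0 :: complex) s"
      using small \<sigma> by (auto simp: norm_mult)
  qed (intro holomorphic_intros)
  moreover have "f (t0 + \<sigma> * t\<^sup>2) = (h \<circ> (\<lambda>w. of_real \<sigma> * w\<^sup>2)) (of_real t)" if t: "t \<in> ball 0 (min s 1)" for t
  proof -
    have "norm (t ^ 2) < s" using t by (intro norm_power_less_min) auto
    then have "(\<lambda>k. c k * of_real (\<sigma> * t\<^sup>2) ^ k) sums f (t0 + \<sigma> * t\<^sup>2)" by (intro sums) auto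
    then show ?thesis by (simp add: h_def sums_iff)
  qed
  ultimately show ?thesis using s by (intro analytic_germI[of "min s 1" "h \<circ> (\<lambda>w. of_real \<sigma> * w\<^sup>2)"]) auto
qed

text \<open>The factor \<open>K\<close> makes room for merging the exponents of the two
  signs.\<close>

lemma roots_near_one_side:
  fixes I :: "real set" and a :: "nat \<Rightarrow> real \<Rightarrow> complex" and \<sigma> t0 :: real
  assumes I: "is_interval I" "t0 \<in> I"
    and P: "\<And>t z. t \<in> I \<Longrightarrow> poly (P t) z = z ^ n + (\<Sum>j=1..n. (-1) ^ j * a j t * z ^ (n - j))"
    and smooth: "\<And>j. j \<in> {1..n} \<Longrightarrow> smooth_on (a j) I"
    and generic: "generic_curve n I P" and \<sigma>: "\<sigma> \<in> {1, -1}"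
  shows "\<exists>N>0. \<forall>K>0.
      let Q = \<lambda>t. P (t0 + \<sigma> * (t - t0) ^ (2 * N * K)); J = {t. t0 + \<sigma> * (t - t0) ^ (2 * N * K) \<in> I}
      in smooth_roots_near n Q J t0 \<and>
        ((\<forall>j\<in>{1..n}. real_analytic_on (a j) I) \<longrightarrow> real_analytic_roots_near n Q J t0)"
proof (cases "\<exists>s>0. t0 + \<sigma> * s \<in> I")
  case False
  \<comment> \<open>An even power of \<open>t - t0\<close> is positive off \<open>t0\<close>, so
    without points of \<open>I\<close> on this side the parameter domain is
    \<open>{t0}\<close>.\<close>
  have "{t. t0 + \<sigma> * (t - t0) ^ (2 * 1 * K) \<in> I} = {t0}" if "K > 0" for K
  proof -
    have "t = t0" if "t0 + \<sigma> * (t - t0) ^ (2 * 1 * K) \<in> I" for t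
    proof (rule ccontr)
      assume "t \<noteq> t0"
      then have "(t - t0) ^ (2 * 1 * K) > 0" by (simp add: power_mult)
      with False that show False by blast
    qed
    then show ?thesis using I(2) \<open>K > 0\<close> by (auto simp: zero_power)
  qed
  moreover have "poly (P (t0 + \<sigma> * (t0 - t0) ^ (2 * 1 * K))) z =
      z ^ n + (\<Sum>j=1..n. ((-1) ^ j * a j t0) * z ^ (n - j))" if "K > 0" for K z
    using P[OF I(2)] that by (simp add: zero_power)
  ultimately show ?thesis
    using roots_near_singleton[of "\<lambda>t. P (t0 + \<sigma> * (t - t0) ^ (2 * 1 * K))" t0 n "\<lambda>j. (-1) ^ j * a j t0" for K]
    by (intro exI[of _ 1]) (simp add: Let_def)
next
  case True
  then obtain s0 where s0: "s0 > 0" "t0 + \<sigma> * s0 \<in> I" by blast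
  have side: "t0 + \<sigma> * s \<in> I" if "0 \<le> s" "s \<le> s0" for s
  proof -
    have "t0 + \<sigma> * s \<in> closed_segment t0 (t0 + \<sigma> * s0)"
      using \<sigma> that s0(1) by (auto simp: closed_segment_eq_real_ivl)
    then show ?thesis using I s0(2) by (meson closed_segment_subset is_interval_convex subsetD)
  qed
  have near: "\<forall>\<^sub>F t in nhds 0. t0 + \<sigma> * t\<^sup>2 \<in> I"
  proof -
    have "\<forall>\<^sub>F t in nhds 0. \<bar>t\<^sup>2\<bar> < s0"
      using eventually_power_nhds_0[OF eventually_abs_less_nhds_0[OF s0(1)], of 2] by simp
    then show ?thesis by eventually_elim (use side in auto)
  qed
  have substitute: "\<forall>\<^sub>F t in nhds 0. \<forall>z. poly (P (t0 + \<sigma> * ((t0 + t) - t0) ^ (2 * N * K))) z =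
      (\<Prod>j=1..n. z - lam j (t ^ K))"
    if "\<forall>\<^sub>F t in nhds 0. \<forall>z. poly (P (t0 + \<sigma> * t ^ (2 * N))) z = (\<Prod>j=1..n. z - lam j t)" "K > 0"
    for N K and lam :: "nat \<Rightarrow> real \<Rightarrow> complex"
    using eventually_power_nhds_0[OF that] by (simp add: power_mult[symmetric] mult_ac)
  show ?thesis
  proof (cases "\<forall>j\<in>{1..n}. real_analytic_on (a j) I")
    case True
    then have "analytic_germ (\<lambda>t. a j (t0 + \<sigma> * t\<^sup>2))" if "j \<in> {1..n}" for j
      using that analytic_germ_square[OF _ I(2) \<sigma> s0(1) side] by blast
    note roots = analytic_germ.generic_curve_roots[OF I P smooth generic \<sigma> near this]
    have "\<exists>N lam. N > 0 \<and> (\<forall>j\<in>{1..n}. analytic_germ (lam j)) \<and>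
        (\<forall>\<^sub>F t in nhds 0. \<forall>z. poly (P (t0 + \<sigma> * t ^ (2 * N))) z = (\<Prod>j=1..n. z - lam j t))"
      by (rule roots) blast+
    then obtain N lam where N: "N > 0" and lam: "\<And>j. j \<in> {1..n} \<Longrightarrow> analytic_germ (lam j)"
      "\<forall>\<^sub>F t in nhds 0. \<forall>z. poly (P (t0 + \<sigma> * t ^ (2 * N))) z = (\<Prod>j=1..n. z - lam j t)"
      by blast
    have "smooth_roots_near n (\<lambda>t. P (t0 + \<sigma> * (t - t0) ^ (2 * N * K))) J t0"
      "real_analytic_roots_near n (\<lambda>t. P (t0 + \<sigma> * (t - t0) ^ (2 * N * K))) J t0" if "K > 0" for K J
      using analytic_germ.subst[OF lam(1) that] analytic_germ_smooth
      by (intro smooth_roots_nearI[OF _ substitute[OF lam(2) that]]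
          real_analytic_roots_nearI[OF _ substitute[OF lam(2) that]]; blast)+
    then show ?thesis using N by (intro exI[of _ N]) (simp add: Let_def)
  next
    case False
    have "smooth_germ (\<lambda>t. a j (t0 + \<sigma> * t\<^sup>2))" if "j \<in> {1..n}" for j
      using smooth_germ_square[OF smooth[OF that] near] .
    note roots = smooth_germ.generic_curve_roots[OF I P smooth generic \<sigma> near this]
    have "\<exists>N lam. N > 0 \<and> (\<forall>j\<in>{1..n}. smooth_germ (lam j)) \<and>
        (\<forall>\<^sub>F t in nhds 0. \<forall>z. poly (P (t0 + \<sigma> * t ^ (2 * N))) z = (\<Prod>j=1..n. z - lam j t))"
      by (rule roots) blast+
    then obtain N lam where N: "N > 0" and lam: "\<And>j. j \<in> {1..n} \<Longrightarrow> smooth_germ (lam j)"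
      "\<forall>\<^sub>F t in nhds 0. \<forall>z. poly (P (t0 + \<sigma> * t ^ (2 * N))) z = (\<Prod>j=1..n. z - lam j t)"
      by blast
    have "smooth_roots_near n (\<lambda>t. P (t0 + \<sigma> * (t - t0) ^ (2 * N * K))) J t0" if "K > 0" for K J
      using smooth_germ.subst[OF lam(1) that]
      by (intro smooth_roots_nearI[OF _ substitute[OF lam(2) that]])
    then show ?thesis using N False by (intro exI[of _ N]) (auto simp: Let_def)
  qed
qed

theorem proposition3p2:
  fixes I :: "real set" and n :: nat and a :: "nat \<Rightarrow> real \<Rightarrow> complex"
    and P :: "real \<Rightarrow> complex poly" and t0 :: real
  assumes "is_interval I"
    and "\<forall>t\<in>I. \<forall>z. poly (P t) z = z ^ n + (\<Sum>j=1..n. (-1) ^ j * a j t * z ^ (n - j))"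
    and "\<forall>j\<in>{1..n}. smooth_on (a j) I"
    and "generic_curve n I P"
    and "t0 \<in> I"
  shows "\<exists>N>0. \<forall>\<sigma>\<in>{1, -1 :: real}.
           smooth_roots_near n (\<lambda>t. P (t0 + \<sigma> * (t - t0) ^ N)) {t. t0 + \<sigma> * (t - t0) ^ N \<in> I} t0 \<and>
           ((\<forall>j\<in>{1..n}. real_analytic_on (a j) I) \<longrightarrow>
              real_analytic_roots_near n (\<lambda>t. P (t0 + \<sigma> * (t - t0) ^ N))
                {t. t0 + \<sigma> * (t - t0) ^ N \<in> I} t0)"
proof -
  define good where "good = (\<lambda>\<sigma> N.
    smooth_roots_near n (\<lambda>t. P (t0 + \<sigma> * (t - t0) ^ N)) {t. t0 + \<sigma> * (t - t0) ^ N \<in> I} t0 \<and>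
    ((\<forall>j\<in>{1..n}. real_analytic_on (a j) I) \<longrightarrow>
       real_analytic_roots_near n (\<lambda>t. P (t0 + \<sigma> * (t - t0) ^ N)) {t. t0 + \<sigma> * (t - t0) ^ N \<in> I} t0))"
  have "\<exists>N>0. \<forall>K>0. good \<sigma> (2 * N * K)" if "\<sigma> \<in> {1, -1}" for \<sigma>
    using roots_near_one_side[of I t0 P n a \<sigma>] assms that by (simp add: good_def Let_def)
  from this[of 1] this[of "-1"] obtain N1 N2 where N: "N1 > 0" "N2 > 0"
    "\<And>K. K > 0 \<Longrightarrow> good 1 (2 * N1 * K)" "\<And>K. K > 0 \<Longrightarrow> good (-1) (2 * N2 * K)" by auto
  \<comment> \<open>Taking \<open>K = N2\<close> for one sign and \<open>K = N1\<close> for the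
    other gives the same exponent.\<close>
  have "good 1 (2 * N1 * N2)" "good (-1) (2 * N1 * N2)"
    using N(3)[OF N(2)] N(4)[OF N(1)] by (simp_all add: mult_ac)
  then have "\<forall>\<sigma>\<in>{1, -1}. good \<sigma> (2 * N1 * N2)" by simp
  moreover have "2 * N1 * N2 > 0" using N(1,2) by simp
  ultimately show ?thesis unfolding good_def by blast
qed

end
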